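(* Let $\nu\in\mathbb{R}$ and let $N\ge1$ be an integer. The reproducing kernel of $\mathbf{F}_\nu^{(N)}(\mathbb{C}/\mathbb{Z})$ is $$K_{\mathbf{F}_\nu^{(N)}(\mathbb{C}/\mathbb{Z})}(z,w)=e^{\pi\overline{w}z}\sum_{k\in\mathbb{Z}}e^{2\pi ik\nu}e^{-\frac{\pi}{2}k^2+\pi(z-\overline{w})k}L^{1}_{N-1}\left(\pi|z-w-k|^2\right)=\sum_{r=0}^{N-1}K_{\mathcal{F}_\nu^{(r)}(\mathbb{C}/\mathbb{Z})}(z,w),$$ where $K_{\mathcal{F}_\nu^{(r)}(\mathbb{C}/\mathbb{Z})}$ is the reproducing kernel of $\mathcal{F}_\nu^{(r)}(\mathbb{C}/\mathbb{Z})$. Moreover, one has the orthogonal decompositions $$\mathbf{F}_\nu^{(N)}(\mathbb{C}/\mathbb{Z})=\bigoplus_{r=0}^{N-1}\mathcal{F}_\nu^{(r)}(\mathbb{C}/\mathbb{Z})\qquad\text{and}\qquad L^2(\mathbb{C}/\mathbb{Z},e^{-\pi|z|^2})=\bigoplus_{r=0}^{\infty}\mathcal{F}_\nu^{(r)}(\mathbb{C}/\mathbb{Z}).$$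
   Context: Identify $z=x+i\xi$ with $(x,\xi)$; $dz$ is Lebesgue measure on $\mathbb{R}^2$. $L^2(\mathbb{C}/\mathbb{Z},e^{-\pi|z|^2})$ is the Hilbert space of measurable $F:\mathbb{C}\to\mathbb{C}$ satisfying $F(z+k)=e^{2\pi ik\nu}e^{\pi kz+\frac{\pi}{2}k^2}F(z)$ for all $k\in\mathbb{Z}$ and $\|F\|^2=\int_{[0,1)\times\mathbb{R}}|F(z)|^2e^{-\pi|z|^2}dz<\infty$. $\mathbf{F}_\nu^{(N)}(\mathbb{C}/\mathbb{Z})$ (polyanalytic Fock space) is the subspace of those $F$ with $\partial_{\overline z}^NF=0$ on $\mathbb{C}$. $\mathcal{F}_{2,\nu}(\mathbb{C}/\mathbb{Z})$ is the subspace of entire functions. $\mathcal{F}_\nu^{(r)}(\mathbb{C}/\mathbb{Z})$ (true polyanalytic Fock space), $r\ge0$, is the subspace of functions that are constant multiples of $e^{\pi|z|^2}\partial_z^r\left[e^{-\pi|z|^2}F_0(z)\right]$ with $F_0\in\mathcal{F}_{2,\nu}(\mathbb{C}/\mathbb{Z})$. The reproducing kernel $K$ of a space is characterized by $F(z)=\int_{[0,1)\times\mathbb{R}}F(w)K(z,w)e^{-\pi|w|^2}dw$ for all $F$ in the space, with $\overline{K(z,\cdot)}$ in the space. $L_n^{\alpha}(x)=\sum_{i=0}^n(-1)^i\binom{n+\alpha}{n-i}\frac{x^i}{i!}$ are the Laguerre polynomials. *)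

theory Defs
  imports "HOL-Analysis.Analysis"
begin

text \<open>
  Elements of the weighted \<open>L\<^sup>2\<close> space are represented by functions that satisfy the
  quasi-periodicity condition at every point. As the integers are countable, every almost-everywhere
  class has such a representative. Two representatives are the same vector of the Hilbert space iff
  \<open>wnorm\<close> of their difference is \<open>0\<close>.
\<close>

definition strip :: "complex set" where
  "strip = {z. 0 \<le> Re z \<and> Re z < 1}"

definition quasi_periodic :: "real \<Rightarrow> (complex \<Rightarrow> complex) \<Rightarrow> bool" where
  "quasi_periodic \<nu> F \<longleftrightarrow>
     (\<forall>z. \<forall>k::int. F (z + of_int k) =
        exp (2 * of_real pi * \<i> * of_int k * of_real \<nu>) *
        exp (of_real pi * of_int k * z + of_real pi / 2 * (of_int k)\<^sup>2) * F z)"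

definition winner :: "(complex \<Rightarrow> complex) \<Rightarrow> (complex \<Rightarrow> complex) \<Rightarrow> complex" where
  "winner F G = (LINT z:strip|lebesgue. F z * cnj (G z) * of_real (exp (- pi * (cmod z)\<^sup>2)))"

definition wnorm :: "(complex \<Rightarrow> complex) \<Rightarrow> real" where
  "wnorm F = sqrt (LINT z:strip|lebesgue. (cmod (F z))\<^sup>2 * exp (- pi * (cmod z)\<^sup>2))"

definition L2_qp :: "real \<Rightarrow> (complex \<Rightarrow> complex) set" where
  "L2_qp \<nu> = {F. F \<in> borel_measurable lebesgue \<and> quasi_periodic \<nu> F \<and>
     set_integrable lebesgue strip (\<lambda>z. (cmod (F z))\<^sup>2 * exp (- pi * (cmod z)\<^sup>2))}"

text \<open>Wirtinger derivatives. The Frechet derivative is real-linear, so its values at \<open>1\<close> and \<open>\<i>\<close>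
  are the partial derivatives with respect to \<open>x\<close> and \<open>\<xi>\<close>, where \<open>z = x + \<i>\<xi>\<close>.\<close>

definition d_z :: "(complex \<Rightarrow> complex) \<Rightarrow> complex \<Rightarrow> complex" where
  "d_z F = (\<lambda>z. (frechet_derivative F (at z) 1 - \<i> * frechet_derivative F (at z) \<i>) / 2)"

definition d_zbar :: "(complex \<Rightarrow> complex) \<Rightarrow> complex \<Rightarrow> complex" where
  "d_zbar F = (\<lambda>z. (frechet_derivative F (at z) 1 + \<i> * frechet_derivative F (at z) \<i>) / 2)"

text \<open>\<open>k\<close>-fold continuous differentiability in the real sense. Since \<open>frechet_derivative\<close> is a
  total function, the classical meaning of iterated derivatives needs this regularity.\<close>

primrec C_diff :: "nat \<Rightarrow> (complex \<Rightarrow> complex) \<Rightarrow> bool" where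
  "C_diff 0 F \<longleftrightarrow> continuous_on UNIV F"
| "C_diff (Suc k) F \<longleftrightarrow> F differentiable_on UNIV \<and>
     C_diff k (\<lambda>z. frechet_derivative F (at z) 1) \<and>
     C_diff k (\<lambda>z. frechet_derivative F (at z) \<i>)"

definition fock :: "real \<Rightarrow> (complex \<Rightarrow> complex) set" where
  "fock \<nu> = {F \<in> L2_qp \<nu>. F holomorphic_on UNIV}"

definition poly_fock :: "real \<Rightarrow> nat \<Rightarrow> (complex \<Rightarrow> complex) set" where
  "poly_fock \<nu> N = {F \<in> L2_qp \<nu>. C_diff N F \<and> (\<forall>z. (d_zbar ^^ N) F z = 0)}"

definition true_poly_fock :: "real \<Rightarrow> nat \<Rightarrow> (complex \<Rightarrow> complex) set" where
  "true_poly_fock \<nu> r =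
     {(\<lambda>z. c * (of_real (exp (pi * (cmod z)\<^sup>2)) *
              (d_z ^^ r) (\<lambda>u. of_real (exp (- pi * (cmod u)\<^sup>2)) * F0 u) z)) | c F0. F0 \<in> fock \<nu>}"

definition is_reproducing_kernel ::
  "(complex \<Rightarrow> complex) set \<Rightarrow> (complex \<Rightarrow> complex \<Rightarrow> complex) \<Rightarrow> bool" where
  "is_reproducing_kernel H K \<longleftrightarrow>
     (\<forall>z. (\<lambda>w. cnj (K z w)) \<in> H) \<and>
     (\<forall>F\<in>H. \<forall>z. F z =
        (LINT w:strip|lebesgue. F w * K z w * of_real (exp (- pi * (cmod w)\<^sup>2))))"

definition reproducing_kernel ::
  "(complex \<Rightarrow> complex) set \<Rightarrow> complex \<Rightarrow> complex \<Rightarrow> complex" where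
  "reproducing_kernel H = (THE K. is_reproducing_kernel H K)"

definition laguerre :: "nat \<Rightarrow> real \<Rightarrow> real \<Rightarrow> real" where
  "laguerre n \<alpha> x = (\<Sum>i\<le>n. (-1) ^ i * ((real n + \<alpha>) gchoose (n - i)) * x ^ i / fact i)"

text \<open>Closedness is relative to \<open>H\<close>, and up to equality almost everywhere.\<close>

definition closed_subspace :: "(complex \<Rightarrow> complex) set \<Rightarrow> (complex \<Rightarrow> complex) set \<Rightarrow> bool" where
  "closed_subspace H V \<longleftrightarrow>
     V \<subseteq> H \<and> (\<lambda>z. 0) \<in> V \<and>
     (\<forall>F\<in>V. \<forall>G\<in>V. (\<lambda>z. F z + G z) \<in> V) \<and>
     (\<forall>c. \<forall>F\<in>V. (\<lambda>z. c * F z) \<in> V) \<and>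
     (\<forall>F\<in>H. (\<forall>e>0. \<exists>G\<in>V. wnorm (\<lambda>z. F z - G z) < e) \<longrightarrow>
        (\<exists>G\<in>V. wnorm (\<lambda>z. F z - G z) = 0))"

definition orthogonal_family :: "'i set \<Rightarrow> ('i \<Rightarrow> (complex \<Rightarrow> complex) set) \<Rightarrow> bool" where
  "orthogonal_family I V \<longleftrightarrow> pairwise (\<lambda>r s. \<forall>F\<in>V r. \<forall>G\<in>V s. winner F G = 0) I"

text \<open>In the next two definitions the components of a vector are unique as functions, not only up to
  equality almost everywhere; this is the right notion for summands consisting of continuous
  functions.\<close>

definition finite_orthogonal_sum ::
  "(complex \<Rightarrow> complex) set \<Rightarrow> 'i set \<Rightarrow> ('i \<Rightarrow> (complex \<Rightarrow> complex) set) \<Rightarrow> bool" where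
  "finite_orthogonal_sum H I V \<longleftrightarrow>
     finite I \<and> (\<forall>r\<in>I. closed_subspace H (V r)) \<and> orthogonal_family I V \<and>
     bij_betw (\<lambda>f z. \<Sum>r\<in>I. f r z) (Pi\<^sub>E I V) H"

definition hilbert_orthogonal_sum ::
  "(complex \<Rightarrow> complex) set \<Rightarrow> (nat \<Rightarrow> (complex \<Rightarrow> complex) set) \<Rightarrow> bool" where
  "hilbert_orthogonal_sum H V \<longleftrightarrow>
     (\<forall>r. closed_subspace H (V r)) \<and> orthogonal_family UNIV V \<and>
     (\<forall>F\<in>H. \<exists>!f. (\<forall>r. f r \<in> V r) \<and>
        (\<lambda>n. wnorm (\<lambda>z. F z - (\<Sum>r<n. f r z))) \<longlonglongrightarrow> 0)"

end

theory Submission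
  imports Defs "HOL-Probability.Characteristic_Functions" "HOL-Complex_Analysis.Complex_Analysis"
    "HOL-Real_Asymp.Real_Asymp"
begin

text \<open>
  Dividing by \<open>exp (pi * z\<^sup>2 / 2)\<close> turns quasi-periodic functions into functions that are periodic in
  \<open>Re z\<close> up to a character. Their Fourier modes of frequency \<open>\<mu> \<in> \<nu> + \<int>\<close> are functions of \<open>Im z\<close>,
  and on each of them \<open>d_z\<close> acts as the Hermite raising operator centred at \<open>- \<mu>\<close>. So the Hermite
  functions of degree \<open>r\<close> in all the modes form an orthonormal basis of the \<open>r\<close>-th true polyanalytic
  space. These bases together are complete: their closed span contains \<open>exp (pi * z\<^sup>2 / 2)\<close> times all
  trigonometric functions, hence times all bounded Borel functions. A quasi-periodic function
  annihilated by \<open>d_zbar ^^ N\<close> has Fourier modes that are polynomials of degree less than \<open>N\<close> times a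
  Gaussian, so it is orthogonal to the levels \<open>r \<ge> N\<close>. The kernel of the level \<open>r\<close> is the
  sum of the basis over the frequencies \<open>\<nu> + n\<close>; Poisson summation in \<open>\<nu>\<close> makes it a series of
  Fourier transforms of products of two shifted Hermite functions, which are Gaussians times Laguerre
  polynomials because the Hermite polynomials are an Appell sequence.
\<close>

section \<open>Square integrable functions\<close>

text \<open>The vectors here are functions, not classes modulo null sets, so each Hilbert space fact
  must be brought back to equality at every point. Two facts allow it. The basis functions of one
  level decay exponentially in the frequency, locally uniformly in z; hence an expansion with square
  summable coefficients converges at each point and has a continuous sum. And a continuous
  quasi-periodic function that vanishes almost everywhere on the strip vanishes everywhere. The
  Gaussian with constant 2 * pi arises from |exp (pi * z^2 / 2)|^2 * exp (- pi * |z|^2) = exp (- 2 *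
  pi * (Im z)^2). Each mode thus sees the same Gaussian, shifted by its frequency, and all modes
  share one family of Hermite polynomials. Completeness is reached by turning polynomials in Im z
  into exponentials through the power series; a suitable real exponent cancels the growth of the
  mode in Im z and leaves pure characters. L^1_{N-1} enters as the sum of L^0_r over r < N, by
  Pascal's rule.\<close>

definition sq_int :: "'a measure \<Rightarrow> ('a \<Rightarrow> complex) \<Rightarrow> bool" where
  "sq_int M f \<longleftrightarrow> f \<in> borel_measurable M \<and> integrable M (\<lambda>x. (cmod (f x))\<^sup>2)"

definition ip :: "'a measure \<Rightarrow> ('a \<Rightarrow> complex) \<Rightarrow> ('a \<Rightarrow> complex) \<Rightarrow> complex" where
  "ip M f g = (\<integral>x. f x * cnj (g x) \<partial>M)"

definition nrm :: "'a measure \<Rightarrow> ('a \<Rightarrow> complex) \<Rightarrow> real" where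
  "nrm M f = sqrt (\<integral>x. (cmod (f x))\<^sup>2 \<partial>M)"

lemma sq_intD [dest]:
  assumes "sq_int M f"
  shows "f \<in> borel_measurable M" "integrable M (\<lambda>x. (cmod (f x))\<^sup>2)"
  using assms by (auto simp: sq_int_def)

lemma sq_int_bound:
  assumes "f \<in> borel_measurable M" "integrable M D" "AE x in M. (cmod (f x))\<^sup>2 \<le> D x"
  shows "sq_int M f"
  unfolding sq_int_def
proof
  have [measurable]: "f \<in> borel_measurable M" by fact
  show "integrable M (\<lambda>x. (cmod (f x))\<^sup>2)"
    by (rule Bochner_Integration.integrable_bound[OF assms(2)]) (use assms(3) in auto)
qed fact

lemma norm_add_square_le: "(norm (a + b))\<^sup>2 \<le> 2 * (norm a)\<^sup>2 + 2 * (norm b)\<^sup>2"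
proof -
  have "(norm (a + b))\<^sup>2 \<le> (norm a + norm b)\<^sup>2"
    by (intro power_mono norm_triangle_ineq) auto
  also have "\<dots> \<le> 2 * (norm a)\<^sup>2 + 2 * (norm b)\<^sup>2"
    using sum_squares_bound[of "norm a" "norm b"] by (simp add: power2_sum)
  finally show ?thesis .
qed

lemma sq_int_add:
  assumes "sq_int M f" "sq_int M g"
  shows "sq_int M (\<lambda>x. f x + g x)"
proof (rule sq_int_bound)
  show "integrable M (\<lambda>x. 2 * (cmod (f x))\<^sup>2 + 2 * (cmod (g x))\<^sup>2)"
    using assms by (auto simp: sq_int_def)
qed (use assms norm_add_square_le in \<open>auto simp: sq_int_def\<close>)

lemma sq_int_scale:
  assumes "sq_int M f"
  shows "sq_int M (\<lambda>x. c * f x)"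
  using assms by (auto simp: sq_int_def norm_mult power_mult_distrib)

lemma sq_int_diff:
  assumes "sq_int M f" "sq_int M g"
  shows "sq_int M (\<lambda>x. f x - g x)"
  using sq_int_add[OF assms(1) sq_int_scale[OF assms(2), of "-1"]] by simp

lemma sq_int_zero [simp]: "sq_int M (\<lambda>x. 0)"
  by (simp add: sq_int_def)

lemma sq_int_sum:
  assumes "\<And>i. i \<in> I \<Longrightarrow> sq_int M (f i)"
  shows "sq_int M (\<lambda>x. \<Sum>i\<in>I. f i x)"
  using assms by (induction I rule: infinite_finite_induct) (auto intro: sq_int_add)

lemma ip_integrable:
  assumes "sq_int M f" "sq_int M g"
  shows "integrable M (\<lambda>x. f x * cnj (g x))"
proof (rule Bochner_Integration.integrable_bound)
  show "integrable M (\<lambda>x. (cmod (f x))\<^sup>2 + (cmod (g x))\<^sup>2)"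
    using assms by (auto simp: sq_int_def)
  have [measurable]: "f \<in> borel_measurable M" "g \<in> borel_measurable M"
    using assms by auto
  show "(\<lambda>x. f x * cnj (g x)) \<in> borel_measurable M"
    by (intro borel_measurable_times borel_measurable_continuous_on[of cnj] continuous_intros) auto
  have "cmod (f x) * cmod (g x) \<le> (cmod (f x))\<^sup>2 + (cmod (g x))\<^sup>2" for x
    using sum_squares_bound[of "cmod (f x)" "cmod (g x)"]
      mult_nonneg_nonneg[OF norm_ge_zero[of "f x"] norm_ge_zero[of "g x"]] by linarith
  then show "AE x in M. norm (f x * cnj (g x)) \<le> norm ((cmod (f x))\<^sup>2 + (cmod (g x))\<^sup>2)"
    by (auto simp: norm_mult)
qed

lemma ip_add_left:
  assumes "sq_int M f" "sq_int M g" "sq_int M h"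
  shows "ip M (\<lambda>x. f x + g x) h = ip M f h + ip M g h"
  unfolding ip_def
  by (simp add: distrib_right ip_integrable[OF assms(1,3)] ip_integrable[OF assms(2,3)])

lemma ip_scale_left: "ip M (\<lambda>x. c * f x) h = c * ip M f h"
  unfolding ip_def by (simp add: mult.assoc)

lemma ip_diff_left:
  assumes "sq_int M f" "sq_int M g" "sq_int M h"
  shows "ip M (\<lambda>x. f x - g x) h = ip M f h - ip M g h"
  unfolding ip_def
  by (simp add: left_diff_distrib ip_integrable[OF assms(1,3)] ip_integrable[OF assms(2,3)])

lemma ip_zero_left [simp]: "ip M (\<lambda>x. 0) h = 0"
  by (simp add: ip_def)

lemma ip_sum_left:
  assumes "\<And>i. i \<in> I \<Longrightarrow> sq_int M (f i)" "sq_int M h"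
  shows "ip M (\<lambda>x. \<Sum>i\<in>I. f i x) h = (\<Sum>i\<in>I. ip M (f i) h)"
  using assms
proof (induction I rule: infinite_finite_induct)
  case (insert i I)
  then show ?case
    using ip_add_left[of M "f i" "\<lambda>x. \<Sum>i\<in>I. f i x" h] sq_int_sum[of I M f] by simp
qed auto

lemma ip_commute: "ip M g f = cnj (ip M f g)"
  unfolding ip_def using Bochner_Integration.integral_cnj[of M "\<lambda>x. f x * cnj (g x)"] by (simp add: mult.commute)

lemma ip_add_right:
  assumes "sq_int M f" "sq_int M g" "sq_int M h"
  shows "ip M h (\<lambda>x. f x + g x) = ip M h f + ip M h g"
  using ip_add_left[OF assms] by (metis ip_commute complex_cnj_add)

lemma ip_scale_right: "ip M h (\<lambda>x. c * f x) = cnj c * ip M h f"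
  by (metis ip_commute complex_cnj_mult ip_scale_left)

lemma ip_diff_right:
  assumes "sq_int M f" "sq_int M g" "sq_int M h"
  shows "ip M h (\<lambda>x. f x - g x) = ip M h f - ip M h g"
  using ip_diff_left[OF assms] by (metis ip_commute complex_cnj_diff)

lemma ip_sum_right:
  assumes "\<And>i. i \<in> I \<Longrightarrow> sq_int M (f i)" "sq_int M h"
  shows "ip M h (\<lambda>x. \<Sum>i\<in>I. f i x) = (\<Sum>i\<in>I. ip M h (f i))"
proof -
  have "ip M h (\<lambda>x. \<Sum>i\<in>I. f i x) = cnj (\<Sum>i\<in>I. ip M (f i) h)"
    by (subst ip_commute, subst ip_sum_left) (use assms in auto)
  also have "\<dots> = (\<Sum>i\<in>I. ip M h (f i))"
    by (simp add: ip_commute[of M _ h])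
  finally show ?thesis .
qed

lemma nrm_nonneg [simp]: "0 \<le> nrm M f"
  by (simp add: nrm_def)

lemma nrm_square: "(nrm M f)\<^sup>2 = (\<integral>x. (cmod (f x))\<^sup>2 \<partial>M)"
  by (simp add: nrm_def)

lemma ip_self: "ip M f f = of_real ((nrm M f)\<^sup>2)"
  unfolding nrm_square ip_def integral_complex_of_real[symmetric] complex_norm_square ..

lemma nrm_square_ip: "(nrm M f)\<^sup>2 = Re (ip M f f)"
  by (simp add: ip_self)

lemma nrm_scale: "nrm M (\<lambda>x. c * f x) = cmod c * nrm M f"
  by (simp add: nrm_def norm_mult power_mult_distrib real_sqrt_mult)

lemma nrm_eq_0_iff:
  assumes "sq_int M f"
  shows "nrm M f = 0 \<longleftrightarrow> (AE x in M. f x = 0)"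
  using integral_nonneg_eq_0_iff_AE[of M "\<lambda>x. (cmod (f x))\<^sup>2"] assms
  by (auto simp: nrm_def sq_int_def)

lemma ip_eq_0_if_nrm_eq_0:
  assumes "sq_int M f" "sq_int M g" "nrm M f = 0"
  shows "ip M f g = 0"
proof -
  have "AE x in M. f x = 0" using assms nrm_eq_0_iff by blast
  then have "AE x in M. f x * cnj (g x) = 0" by auto
  moreover have "(\<lambda>x. f x * cnj (g x)) \<in> borel_measurable M"
    using ip_integrable[OF assms(1,2)] by auto
  ultimately show ?thesis
    unfolding ip_def by (metis integral_eq_zero_AE)
qed

lemma pythagoras:
  assumes "sq_int M f" "sq_int M g" "ip M f g = 0"
  shows "(nrm M (\<lambda>x. f x + g x))\<^sup>2 = (nrm M f)\<^sup>2 + (nrm M g)\<^sup>2"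
  using assms ip_commute[of M f g]
  by (simp add: nrm_square_ip ip_add_left ip_add_right sq_int_add)

lemma Cauchy_Schwarz_ip:
  assumes "sq_int M f" "sq_int M g"
  shows "cmod (ip M f g) \<le> nrm M f * nrm M g"
proof (cases "nrm M g = 0")
  case True
  then show ?thesis
    using ip_eq_0_if_nrm_eq_0[OF assms(2,1)] ip_commute[of M f g] by simp
next
  case False
  \<comment> \<open>\<open>c * g\<close> is the projection of \<open>f\<close> onto the line spanned
    by \<open>g\<close>; Pythagoras then bounds its norm by that of \<open>f\<close>.\<close>
  define c where "c = ip M f g / of_real ((nrm M g)\<^sup>2)"
  have c: "c * of_real ((nrm M g)\<^sup>2) = ip M f g" using False by (simp add: c_def)
  let ?h = "\<lambda>x. f x - c * g x"
  have h: "sq_int M ?h" by (intro sq_int_diff sq_int_scale assms)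
  have cg: "sq_int M (\<lambda>x. c * g x)" by (intro sq_int_scale assms)
  have "ip M ?h g = 0"
    unfolding ip_diff_left[OF assms(1) cg assms(2)] ip_scale_left ip_self c by simp
  then have "ip M ?h (\<lambda>x. c * g x) = 0" by (simp add: ip_scale_right)
  from pythagoras[OF h cg this] have "(nrm M f)\<^sup>2 \<ge> (cmod c * nrm M g)\<^sup>2"
    by (simp add: nrm_scale)
  then have "cmod c * nrm M g \<le> nrm M f"
    by (rule power2_le_imp_le) simp
  then show ?thesis
    using False nrm_nonneg[of M g]
    by (simp add: c_def norm_divide norm_mult field_simps power2_eq_square)
qed

lemma nrm_triangle:
  assumes "sq_int M f" "sq_int M g"
  shows "nrm M (\<lambda>x. f x + g x) \<le> nrm M f + nrm M g"
proof (rule power2_le_imp_le)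
  have "(nrm M (\<lambda>x. f x + g x))\<^sup>2 = (nrm M f)\<^sup>2 + (nrm M g)\<^sup>2 + 2 * Re (ip M f g)"
    using ip_commute[of M f g]
    by (simp add: nrm_square_ip ip_add_left ip_add_right assms sq_int_add)
  also have "Re (ip M f g) \<le> nrm M f * nrm M g"
    using Cauchy_Schwarz_ip[OF assms] complex_Re_le_cmod order_trans by blast
  finally show "(nrm M (\<lambda>x. f x + g x))\<^sup>2 \<le> (nrm M f + nrm M g)\<^sup>2"
    by (simp add: power2_sum)
qed simp

section \<open>Limit theorems for convergence in norm\<close>

lemma nrm_dominated_convergence:
  fixes F :: "nat \<Rightarrow> 'a \<Rightarrow> complex"
  assumes F: "\<And>i. F i \<in> borel_measurable M" and f: "f \<in> borel_measurable M"
    and D: "integrable M (\<lambda>x. (D x)\<^sup>2)"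
    and bound: "\<And>i. AE x in M. cmod (F i x) \<le> D x"
    and lim: "AE x in M. (\<lambda>i. F i x) \<longlonglongrightarrow> f x"
  shows "sq_int M f" "\<And>i. sq_int M (F i)" "(\<lambda>i. nrm M (\<lambda>x. f x - F i x)) \<longlonglongrightarrow> 0"
proof -
  have fD: "AE x in M. cmod (f x) \<le> D x"
  proof -
    have "AE x in M. \<forall>i. cmod (F i x) \<le> D x" using bound by (simp add: AE_all_countable)
    with lim show ?thesis
      by eventually_elim (rule LIMSEQ_le_const2[OF tendsto_norm], auto)
  qed
  have sqD: "(cmod a)\<^sup>2 \<le> d\<^sup>2" if "cmod a \<le> d" for a d
    using that by (simp add: power_mono)
  show sf: "sq_int M f"
    by (rule sq_int_bound[OF f D]) (use fD sqD in auto)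
  show sF: "sq_int M (F i)" for i
    by (rule sq_int_bound[OF F D]) (use bound[of i] sqD in auto)
  note [measurable] = f F
  have "(\<lambda>i. \<integral>x. (cmod (f x - F i x))\<^sup>2 \<partial>M) \<longlonglongrightarrow> (\<integral>x. 0 \<partial>M)"
  proof (rule integral_dominated_convergence)
    show "integrable M (\<lambda>x. 4 * (D x)\<^sup>2)" using D by simp
    show "AE x in M. (\<lambda>i. (cmod (f x - F i x))\<^sup>2) \<longlonglongrightarrow> 0"
      using lim
    proof eventually_elim
      case (elim x)
      have "(\<lambda>i. (cmod (f x - F i x))\<^sup>2) \<longlonglongrightarrow> (cmod (f x - f x))\<^sup>2"
        by (intro tendsto_intros elim)
      then show ?case by simp
    qed
    show "AE x in M. norm ((cmod (f x - F i x))\<^sup>2) \<le> 4 * (D x)\<^sup>2" for i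
      using fD bound[of i]
    proof eventually_elim
      case (elim x)
      have "(cmod (f x - F i x))\<^sup>2 \<le> (2 * D x)\<^sup>2"
        using elim norm_triangle_ineq4[of "f x" "F i x"] by (intro power_mono) auto
      then show ?case by (simp add: power_mult_distrib)
    qed
  qed auto
  then show "(\<lambda>i. nrm M (\<lambda>x. f x - F i x)) \<longlonglongrightarrow> 0"
    unfolding nrm_def using tendsto_real_sqrt by fastforce
qed

text \<open>The bound is required only from index \<open>k\<close> on, so that the lemma applies to
  differences of later partial sums and a fixed one. There it shows that a known pointwise limit is
  also the limit in norm.\<close>

lemma nrm_Fatou:
  fixes F :: "nat \<Rightarrow> 'a \<Rightarrow> complex"
  assumes F: "\<And>i. sq_int M (F i)"
    and bound: "\<And>i. i \<ge> k \<Longrightarrow> (nrm M (F i))\<^sup>2 \<le> B"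
    and lim: "\<And>x. x \<in> space M \<Longrightarrow> (\<lambda>i. F i x) \<longlonglongrightarrow> f x"
  shows "sq_int M f" "(nrm M f)\<^sup>2 \<le> B"
proof -
  have [measurable]: "F i \<in> borel_measurable M" for i using F by auto
  have f [measurable]: "f \<in> borel_measurable M"
    by (rule borel_measurable_LIMSEQ_metric[OF _ lim]) auto
  have B: "0 \<le> B" using bound[of k] zero_le_power2[of "nrm M (F k)"] by linarith
  have "(\<integral>\<^sup>+x. ennreal ((cmod (f x))\<^sup>2) \<partial>M)
      = (\<integral>\<^sup>+x. liminf (\<lambda>i. ennreal ((cmod (F i x))\<^sup>2)) \<partial>M)"
  proof (rule nn_integral_cong)
    fix x assume "x \<in> space M"
    then have "(\<lambda>i. ennreal ((cmod (F i x))\<^sup>2)) \<longlonglongrightarrow> ennreal ((cmod (f x))\<^sup>2)"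
      by (intro tendsto_ennrealI tendsto_intros lim)
    then show "ennreal ((cmod (f x))\<^sup>2) = liminf (\<lambda>i. ennreal ((cmod (F i x))\<^sup>2))"
      by (metis lim_imp_Liminf trivial_limit_sequentially)
  qed
  also have "\<dots> \<le> liminf (\<lambda>i. \<integral>\<^sup>+x. ennreal ((cmod (F i x))\<^sup>2) \<partial>M)"
    by (rule nn_integral_liminf) simp
  also have "\<dots> \<le> ennreal B"
  proof (rule Liminf_le)
    show "\<forall>\<^sub>F i in sequentially. (\<integral>\<^sup>+x. ennreal ((cmod (F i x))\<^sup>2) \<partial>M) \<le> ennreal B"
      using eventually_ge_at_top[of k]
    proof eventually_elim
      case (elim i)
      have "(\<integral>\<^sup>+x. ennreal ((cmod (F i x))\<^sup>2) \<partial>M) = ennreal ((nrm M (F i))\<^sup>2)"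
        unfolding nrm_square using F[of i] by (intro nn_integral_eq_integral) auto
      then show ?case using bound[OF elim] by (simp add: ennreal_leI)
    qed
  qed simp
  finally have le: "(\<integral>\<^sup>+x. ennreal ((cmod (f x))\<^sup>2) \<partial>M) \<le> ennreal B" .
  then have int: "integrable M (\<lambda>x. (cmod (f x))\<^sup>2)"
    by (intro integrableI_bounded) (auto simp: le_less_trans ennreal_less_top)
  then show "sq_int M f" using f by (simp add: sq_int_def)
  have "ennreal ((nrm M f)\<^sup>2) = (\<integral>\<^sup>+x. ennreal ((cmod (f x))\<^sup>2) \<partial>M)"
    unfolding nrm_square by (rule nn_integral_eq_integral[symmetric]) (use int in auto)
  then show "(nrm M f)\<^sup>2 \<le> B" using le B by (metis ennreal_le_iff)
qed

section \<open>Orthonormal sequences with pointwise convergent expansions\<close>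

text \<open>Dominated convergence and Fatou work along sequences, whereas the sums over frequencies
  are unconditional; symmetric intervals exhaust every finite set of integers.\<close>

lemma has_sum_int_LIMSEQ:
  fixes f :: "int \<Rightarrow> 'b::{comm_monoid_add, topological_space}"
  assumes "(f has_sum S) UNIV"
  shows "(\<lambda>m. \<Sum>n\<in>{- int m..int m}. f n) \<longlonglongrightarrow> S"
proof -
  have "filterlim (\<lambda>m. {- int m..int m}) (finite_subsets_at_top UNIV) sequentially"
    unfolding filterlim_finite_subsets_at_top
  proof safe
    fix X :: "int set" assume X: "finite X"
    obtain b where b: "\<And>n. n \<in> X \<Longrightarrow> \<bar>n\<bar> \<le> b"
      using X by (metis finite_imageI imageI Max_ge)
    have "\<forall>\<^sub>F m in sequentially. m \<ge> nat b" by (rule eventually_ge_at_top)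
    then show "\<forall>\<^sub>F m in sequentially. finite {- int m..int m} \<and> X \<subseteq> {- int m..int m} \<and> {- int m..int m} \<subseteq> UNIV"
      by eventually_elim (use b in \<open>force simp: abs_le_iff\<close>)
  qed
  then show ?thesis
    using assms unfolding has_sum_def by (rule filterlim_compose[rotated])
qed

section \<open>Square summable coefficient families\<close>

definition ell2 :: "(int \<Rightarrow> complex) \<Rightarrow> bool" where
  "ell2 c \<longleftrightarrow> (\<lambda>n. (cmod (c n))\<^sup>2) summable_on UNIV"

lemma ell2_bounded:
  assumes "ell2 c"
  obtains B where "\<And>n. cmod (c n) \<le> B"
proof
  fix n
  have "sum (\<lambda>n. (cmod (c n))\<^sup>2) {n} \<le> (\<Sum>\<^sub>\<infinity>n. (cmod (c n))\<^sup>2)"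
    using assms unfolding ell2_def by (intro finite_sum_le_infsum) auto
  then show "cmod (c n) \<le> sqrt (\<Sum>\<^sub>\<infinity>n. (cmod (c n))\<^sup>2)"
    by (simp add: real_le_rsqrt)
qed

lemma ell2_scale: "ell2 c \<Longrightarrow> ell2 (\<lambda>n. a * c n)"
  unfolding ell2_def norm_mult power_mult_distrib by (rule summable_on_cmult_right)

lemma ell2_add:
  assumes "ell2 c" "ell2 d"
  shows "ell2 (\<lambda>n. c n + d n)"
  unfolding ell2_def
proof (rule summable_on_comparison_test)
  show "(\<lambda>n. 2 * (cmod (c n))\<^sup>2 + 2 * (cmod (d n))\<^sup>2) summable_on UNIV"
    using assms unfolding ell2_def by (intro summable_on_add summable_on_cmult_right)
qed (auto intro: norm_add_square_le)

lemma ell2_if_abs_summable: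
  assumes "(\<lambda>n. cmod (c n)) summable_on UNIV"
  shows "ell2 c"
  unfolding ell2_def
proof (rule summable_on_comparison_test)
  let ?T = "\<Sum>\<^sub>\<infinity>n. cmod (c n)"
  show "(\<lambda>n. ?T * cmod (c n)) summable_on UNIV"
    using assms by (rule summable_on_cmult_right)
  fix n
  have "sum (\<lambda>n. cmod (c n)) {n} \<le> ?T"
    by (intro finite_sum_le_infsum assms) auto
  then show "(cmod (c n))\<^sup>2 \<le> ?T * cmod (c n)"
    by (simp add: power2_eq_square mult_right_mono)
qed auto

lemma ell2_finite: "ell2 (\<lambda>n. if n = k then a else 0)"
proof -
  have "(\<lambda>n. (cmod (if n = k then a else 0))\<^sup>2) summable_on {k}" by simp
  then show ?thesis
    unfolding ell2_def by (rule summable_on_cong_neutral[THEN iffD1, rotated -1]) auto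
qed

text \<open>The third assumption makes point evaluation continuous on the closed span: bounded
  coefficients already give a convergent expansion at each point, and the values of the basis at a
  point are square summable, so that their conjugates are the coefficients of a vector, the
  kernel.\<close>

locale orthonormal_seq =
  fixes M :: "'a measure" and e :: "int \<Rightarrow> 'a \<Rightarrow> complex"
  assumes sq_int_e: "sq_int M (e n)"
    and ip_e: "ip M (e m) (e n) = of_bool (m = n)"
    and abs_summable_e: "x \<in> space M \<Longrightarrow> (\<lambda>n. cmod (e n x)) summable_on UNIV"
begin

definition ssum :: "(int \<Rightarrow> complex) \<Rightarrow> 'a \<Rightarrow> complex" where
  "ssum c x = (\<Sum>\<^sub>\<infinity>n. c n * e n x)"

definition part :: "(int \<Rightarrow> complex) \<Rightarrow> int set \<Rightarrow> 'a \<Rightarrow> complex" where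
  "part c A x = (\<Sum>n\<in>A. c n * e n x)"

text \<open>Selects one representative of the orthogonal projection onto the closed span: the one
  given by the pointwise sum.\<close>

definition proj :: "('a \<Rightarrow> complex) \<Rightarrow> 'a \<Rightarrow> complex" where
  "proj f = ssum (\<lambda>n. ip M f (e n))"

text \<open>Meant as the second argument of an inner product, which conjugates it; the reproducing
  kernel itself is \<open>cnj (kern x y)\<close>.\<close>

definition kern :: "'a \<Rightarrow> 'a \<Rightarrow> complex" where
  "kern x = ssum (\<lambda>n. cnj (e n x))"

lemma summable_ssum:
  assumes "ell2 c" "x \<in> space M"
  shows "(\<lambda>n. c n * e n x) summable_on UNIV"
proof -
  obtain B where B: "\<And>n. cmod (c n) \<le> B" using ell2_bounded[OF assms(1)] by blast
  have "(\<lambda>n. cmod (c n * e n x)) summable_on UNIV"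
  proof (rule summable_on_comparison_test)
    show "(\<lambda>n. B * cmod (e n x)) summable_on UNIV"
      using abs_summable_e[OF assms(2)] by (rule summable_on_cmult_right)
  qed (auto simp: norm_mult intro: mult_right_mono B)
  then show ?thesis by (rule abs_summable_summable)
qed

lemma part_LIMSEQ:
  assumes "ell2 c" "x \<in> space M"
  shows "(\<lambda>m. part c {- int m..int m} x) \<longlonglongrightarrow> ssum c x"
  unfolding part_def ssum_def
  by (intro has_sum_int_LIMSEQ has_sum_infsum summable_ssum assms)

lemma sq_int_part: "sq_int M (part c A)"
  unfolding part_def by (intro sq_int_sum sq_int_scale sq_int_e)

lemma ip_part_left:
  assumes "sq_int M g"
  shows "ip M (part c A) g = (\<Sum>n\<in>A. c n * ip M (e n) g)"
proof -
  have "ip M (part c A) g = (\<Sum>n\<in>A. ip M (\<lambda>x. c n * e n x) g)"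
    unfolding part_def by (intro ip_sum_left sq_int_scale sq_int_e assms)
  then show ?thesis by (simp add: ip_scale_left)
qed

lemma ip_part_e:
  assumes "finite A"
  shows "ip M (part c A) (e k) = (if k \<in> A then c k else 0)"
proof -
  have "ip M (part c A) (e k) = (\<Sum>n\<in>A. if k = n then c n else 0)"
    unfolding ip_part_left[OF sq_int_e] by (intro sum.cong) (auto simp: ip_e)
  then show ?thesis using assms by (simp add: sum.delta')
qed

lemma nrm_part:
  assumes "finite A"
  shows "(nrm M (part c A))\<^sup>2 = (\<Sum>n\<in>A. (cmod (c n))\<^sup>2)"
proof -
  have "ip M (part c A) (part c A) = (\<Sum>n\<in>A. c n * ip M (e n) (part c A))"
    by (rule ip_part_left[OF sq_int_part])
  also have "\<dots> = (\<Sum>n\<in>A. c n * cnj (c n))"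
    using assms by (intro sum.cong refl) (subst ip_commute, simp add: ip_part_e)
  also have "\<dots> = of_real (\<Sum>n\<in>A. (cmod (c n))\<^sup>2)"
    by (simp only: of_real_sum complex_norm_square)
  finally show ?thesis by (simp add: nrm_square_ip)
qed

text \<open>Fatou's lemma for partial sums minus a fixed partial sum bounds the squared distance
  from the pointwise sum by the tail \<open>T - S m\<close> of the squared coefficients.\<close>

lemma ssum_approx:
  assumes "ell2 c"
  shows "sq_int M (ssum c)"
    and "(\<lambda>m. nrm M (\<lambda>x. ssum c x - part c {- int m..int m} x)) \<longlonglongrightarrow> 0"
proof -
  define A where "A m = {- int m..int m}" for m
  define T where "T = (\<Sum>\<^sub>\<infinity>n. (cmod (c n))\<^sup>2)"
  define S where "S m = (\<Sum>n\<in>A m. (cmod (c n))\<^sup>2)" for m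
  have S_le: "S m \<le> T" for m
    using assms unfolding S_def T_def ell2_def A_def by (intro finite_sum_le_infsum) auto
  have S_lim: "S \<longlonglongrightarrow> T"
    using assms unfolding S_def T_def ell2_def A_def by (intro has_sum_int_LIMSEQ has_sum_infsum)
  have diff: "sq_int M (\<lambda>x. ssum c x - part c (A m) x) \<and>
      (nrm M (\<lambda>x. ssum c x - part c (A m) x))\<^sup>2 \<le> T - S m" for m
  proof -
    have bound: "(nrm M (\<lambda>x. part c (A i) x - part c (A m) x))\<^sup>2 \<le> T - S m" if "m \<le> i" for i
    proof -
      have sub: "A m \<subseteq> A i" using that by (auto simp: A_def)
      have fin: "finite (A i)" by (simp add: A_def)
      have "(\<lambda>x. part c (A i) x - part c (A m) x) = part c (A i - A m)"
        unfolding part_def by (auto simp: sum_diff[OF fin sub])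
      then have "(nrm M (\<lambda>x. part c (A i) x - part c (A m) x))\<^sup>2 = S i - S m"
        using fin sub by (simp add: nrm_part S_def sum_diff)
      with S_le[of i] show ?thesis by simp
    qed
    have lim: "(\<lambda>i. part c (A i) x - part c (A m) x) \<longlonglongrightarrow> ssum c x - part c (A m) x"
      if "x \<in> space M" for x
      unfolding A_def by (intro tendsto_intros part_LIMSEQ assms that)
    show ?thesis
      using nrm_Fatou[OF sq_int_diff[OF sq_int_part sq_int_part] bound lim] by blast
  qed
  show "sq_int M (ssum c)"
    using sq_int_add[OF conjunct1[OF diff[of 0]] sq_int_part[of c "A 0"]] by simp
  show "(\<lambda>m. nrm M (\<lambda>x. ssum c x - part c {- int m..int m} x)) \<longlonglongrightarrow> 0"
  proof (rule tendsto_sandwich[of "\<lambda>_. 0" _ _ "\<lambda>m. sqrt (T - S m)"])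
    show "(\<lambda>m. sqrt (T - S m)) \<longlonglongrightarrow> 0"
    proof -
      have "(\<lambda>m. sqrt (T - S m)) \<longlonglongrightarrow> sqrt (T - T)" by (intro tendsto_intros S_lim)
      then show ?thesis by simp
    qed
    show "\<forall>\<^sub>F m in sequentially. nrm M (\<lambda>x. ssum c x - part c {- int m..int m} x) \<le> sqrt (T - S m)"
      using diff unfolding A_def by (intro always_eventually allI real_le_rsqrt) blast
  qed auto
qed

lemma ip_ssum_LIMSEQ:
  assumes "ell2 c" "sq_int M g"
  shows "(\<lambda>m. \<Sum>n\<in>{- int m..int m}. c n * ip M (e n) g) \<longlonglongrightarrow> ip M (ssum c) g"
proof (rule LIM_zero_cancel, rule Lim_null_comparison)
  let ?d = "\<lambda>m. nrm M (\<lambda>x. ssum c x - part c {- int m..int m} x)"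
  show "(\<lambda>m. ?d m * nrm M g) \<longlonglongrightarrow> 0"
    by (rule tendsto_mult_left_zero[OF ssum_approx(2)[OF assms(1)]])
  have "cmod ((\<Sum>n\<in>{- int m..int m}. c n * ip M (e n) g) - ip M (ssum c) g) \<le> ?d m * nrm M g" for m
  proof -
    have "cmod (ip M (ssum c) g - ip M (part c {- int m..int m}) g) \<le> ?d m * nrm M g"
      unfolding ip_diff_left[OF ssum_approx(1)[OF assms(1)] sq_int_part assms(2), symmetric]
      by (intro Cauchy_Schwarz_ip sq_int_diff sq_int_part ssum_approx(1) assms)
    then show ?thesis by (simp add: ip_part_left[OF assms(2)] norm_minus_commute)
  qed
  then show "\<forall>\<^sub>F m in sequentially.
      cmod ((\<Sum>n\<in>{- int m..int m}. c n * ip M (e n) g) - ip M (ssum c) g) \<le> ?d m * nrm M g"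
    by simp
qed

lemma ip_ssum_e:
  assumes "ell2 c"
  shows "ip M (ssum c) (e k) = c k"
proof (rule LIMSEQ_unique[OF ip_ssum_LIMSEQ[OF assms sq_int_e]])
  have "(\<Sum>n\<in>{- int m..int m}. c n * ip M (e n) (e k)) = c k" if "m \<ge> nat \<bar>k\<bar>" for m
  proof -
    have "k \<in> {- int m..int m}" using that by auto
    moreover have "(\<Sum>n\<in>{- int m..int m}. c n * ip M (e n) (e k)) =
        (\<Sum>n\<in>{- int m..int m}. if k = n then c n else 0)"
      by (intro sum.cong) (auto simp: ip_e)
    ultimately show ?thesis by simp
  qed
  then show "(\<lambda>m. \<Sum>n\<in>{- int m..int m}. c n * ip M (e n) (e k)) \<longlonglongrightarrow> c k"
    by (intro tendsto_eventually) (auto simp: eventually_sequentially)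
qed

text \<open>Bessel's inequality: a partial expansion is orthogonal to what it leaves of
  \<open>f\<close>.\<close>

lemma ell2_coeffs:
  assumes "sq_int M f"
  shows "ell2 (\<lambda>n. ip M f (e n))"
proof -
  let ?c = "\<lambda>n. ip M f (e n)"
  have bessel: "(\<Sum>n\<in>A. (cmod (?c n))\<^sup>2) \<le> (nrm M f)\<^sup>2" if A: "finite A" for A
  proof -
    have sd: "sq_int M (\<lambda>x. f x - part ?c A x)" by (intro sq_int_diff assms sq_int_part)
    have "ip M (part ?c A) (\<lambda>x. f x - part ?c A x) = 0"
      unfolding ip_part_left[OF sd]
    proof (rule sum.neutral, rule ballI)
      fix n assume "n \<in> A"
      then have "ip M (\<lambda>x. f x - part ?c A x) (e n) = 0"
        using A by (simp add: ip_diff_left assms sq_int_part sq_int_e ip_part_e)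
      then show "?c n * ip M (e n) (\<lambda>x. f x - part ?c A x) = 0"
        by (subst ip_commute) simp
    qed
    from pythagoras[OF sq_int_part sd this] show ?thesis
      using A by (simp add: nrm_part)
  qed
  show ?thesis
    unfolding ell2_def
    by (rule nonneg_bdd_above_summable_on) (auto intro!: bdd_aboveI2[where M="(nrm M f)\<^sup>2"] bessel)
qed

lemma sq_int_proj: "sq_int M f \<Longrightarrow> sq_int M (proj f)"
  unfolding proj_def by (intro ssum_approx ell2_coeffs)

lemma ip_proj_e: "sq_int M f \<Longrightarrow> ip M (proj f) (e n) = ip M f (e n)"
  unfolding proj_def by (intro ip_ssum_e ell2_coeffs)

lemma proj_ssum: "ell2 c \<Longrightarrow> proj (ssum c) = ssum c"
  by (simp add: proj_def ip_ssum_e)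

lemma ssum_orthogonal:
  assumes "ell2 c" "sq_int M g" "\<And>n. ip M (e n) g = 0"
  shows "ip M (ssum c) g = 0"
  using LIMSEQ_unique[OF ip_ssum_LIMSEQ[OF assms(1,2)]] by (simp add: assms(3))

lemma ip_proj_orthogonal:
  assumes "sq_int M f" "ell2 c"
  shows "ip M (ssum c) (\<lambda>x. f x - proj f x) = 0"
proof (rule ssum_orthogonal[OF assms(2)])
  show s: "sq_int M (\<lambda>x. f x - proj f x)" by (intro sq_int_diff sq_int_proj assms)
  show "ip M (e n) (\<lambda>x. f x - proj f x) = 0" for n
    by (subst ip_commute) (simp add: ip_diff_left assms sq_int_proj sq_int_e ip_proj_e)
qed

lemma ssum_add:
  assumes "ell2 c" "ell2 d" "x \<in> space M"
  shows "ssum (\<lambda>n. c n + d n) x = ssum c x + ssum d x"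
  unfolding ssum_def distrib_right by (intro infsum_add summable_ssum assms)

lemma ssum_scale: "ssum (\<lambda>n. a * c n) x = a * ssum c x"
  unfolding ssum_def mult.assoc by (rule infsum_cmult_right')

lemma ip_ssum_proj:
  assumes "sq_int M f" "ell2 c"
  shows "ip M (ssum c) f = ip M (ssum c) (proj f)"
  using ip_proj_orthogonal[OF assms] ip_diff_right[OF assms(1) sq_int_proj[OF assms(1)] ssum_approx(1)[OF assms(2)]]
  by simp

lemma ell2_kern: "x \<in> space M \<Longrightarrow> ell2 (\<lambda>n. cnj (e n x))"
  by (rule ell2_if_abs_summable) (simp add: abs_summable_e)

text \<open>The same partial sums converge to the inner product by convergence in norm, and to the
  value at \<open>x\<close> pointwise.\<close>

lemma ip_kern:
  assumes "sq_int M f" "x \<in> space M"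
  shows "ip M f (kern x) = proj f x"
proof (rule LIMSEQ_unique)
  have "(\<lambda>m. \<Sum>n\<in>{- int m..int m}. cnj (e n x) * ip M (e n) f) \<longlonglongrightarrow> ip M (kern x) f"
    unfolding kern_def by (rule ip_ssum_LIMSEQ[OF ell2_kern[OF assms(2)] assms(1)])
  from tendsto_cnj[OF this]
  show "(\<lambda>m. part (\<lambda>n. ip M f (e n)) {- int m..int m} x) \<longlonglongrightarrow> ip M f (kern x)"
    by (simp add: part_def ip_commute[of M _ f] ip_commute[of M f, symmetric] mult.commute)
  show "(\<lambda>m. part (\<lambda>n. ip M f (e n)) {- int m..int m} x) \<longlonglongrightarrow> proj f x"
    unfolding proj_def by (intro part_LIMSEQ ell2_coeffs assms)
qed

end

section \<open>Gaussian integrals of polynomials\<close>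

text \<open>The induction asks for rate \<open>b / 2\<close> from the shorter polynomial and spends
  the other half on the extra factor \<open>t\<close>.\<close>

lemma poly_exp_bound:
  fixes P :: "complex poly"
  assumes "b > 0"
  obtains C where "C \<ge> 0" "\<And>t. cmod (poly P t) \<le> C * exp (b * cmod t)"
proof -
  have "\<exists>C\<ge>0. \<forall>t. cmod (poly P t) \<le> C * exp (b * cmod t)"
    using assms
  proof (induction P arbitrary: b)
    case 0
    then show ?case by (intro exI[of _ 0]) auto
  next
    case (pCons a P)
    then obtain C where C: "C \<ge> 0" "\<And>t. cmod (poly P t) \<le> C * exp (b / 2 * cmod t)"
      using pCons.IH[of "b / 2"] by auto
    show ?case
    proof (intro exI conjI allI)
      show "0 \<le> cmod a + C * (2 / b)" using C pCons.prems by simp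
      fix t
      have 1: "cmod t \<le> 2 / b * exp (b / 2 * cmod t)"
      proof -
        have "b / 2 * cmod t \<le> exp (b / 2 * cmod t)"
          using exp_ge_add_one_self[of "b / 2 * cmod t"] by linarith
        then show ?thesis using pCons.prems by (simp add: field_simps)
      qed
      have "cmod (poly (pCons a P) t) \<le> cmod a + cmod t * cmod (poly P t)"
        by (simp add: norm_triangle_le norm_mult)
      also have "\<dots> \<le> cmod a * exp (b * cmod t)
          + (2 / b * exp (b / 2 * cmod t)) * (C * exp (b / 2 * cmod t))"
        using pCons.prems 1 C
        by (intro add_mono mult_mono) (auto simp: mult_le_cancel_left1)
      also have "\<dots> = (cmod a + C * (2 / b)) * exp (b * cmod t)"
        by (simp add: algebra_simps flip: exp_add)
      finally show "cmod (poly (pCons a P) t) \<le> (cmod a + C * (2 / b)) * exp (b * cmod t)" .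
    qed
  qed
  then show ?thesis using that by blast
qed

lemma gaussian_integral:
  assumes "a > 0"
  shows "integrable lborel (\<lambda>t. exp (- a * t\<^sup>2) :: real)"
    and "(\<integral>t. exp (- a * t\<^sup>2) \<partial>lborel) = sqrt (pi / a)"
proof -
  define s where "s = sqrt (1 / (2 * a))"
  have s: "s > 0" "s\<^sup>2 = 1 / (2 * a)" using assms by (auto simp: s_def)
  have eq: "exp (- a * t\<^sup>2) = sqrt (pi / a) * normal_density 0 s t" for t
  proof -
    have "2 * pi * s\<^sup>2 = pi / a" "- (t - 0)\<^sup>2 / (2 * s\<^sup>2) = - a * t\<^sup>2"
      using assms by (simp_all add: s(2))
    then have "normal_density 0 s t = 1 / sqrt (pi / a) * exp (- a * t\<^sup>2)"
      unfolding normal_density_def by (simp only:)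
    then show ?thesis using assms by simp
  qed
  show "integrable lborel (\<lambda>t. exp (- a * t\<^sup>2) :: real)"
    unfolding eq using s by (intro integrable_mult_right integrable_normal_density)
  show "(\<integral>t. exp (- a * t\<^sup>2) \<partial>lborel) = sqrt (pi / a)"
    unfolding eq using s by (simp add: integral_normal_density)
qed

definition gauss :: "real \<Rightarrow> real" where
  "gauss t = exp (- 2 * pi * t\<^sup>2)"

text \<open>Completing the square: half of the Gaussian absorbs the exponential factor and the other
  half remains as an integrable majorant.\<close>

lemma exp_gauss_bound: "exp (b * \<bar>t\<bar>) * gauss t \<le> exp (b\<^sup>2 / (4 * pi)) * exp (- pi * t\<^sup>2)"
proof -
  have "0 \<le> (2 * pi * \<bar>t\<bar> - b)\<^sup>2 / (4 * pi)" by simp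
  also have "\<dots> = pi * t\<^sup>2 - b * \<bar>t\<bar> + b\<^sup>2 / (4 * pi)"
    by (simp add: power2_diff field_simps power2_eq_square)
  finally show ?thesis unfolding gauss_def by (simp flip: exp_add)
qed

lemma poly_exp_gauss_bound:
  fixes P :: "complex poly"
  obtains C where "\<And>t::real. cmod (poly P (of_real t) * exp (c * of_real t) * of_real (gauss t))
    \<le> C * exp (- pi * t\<^sup>2)"
proof -
  obtain B where B: "B \<ge> 0" "\<And>t. cmod (poly P t) \<le> B * exp (1 * cmod t)"
    by (rule poly_exp_bound[of 1 P]) auto
  define b where "b = 1 + cmod c"
  have "cmod (poly P (of_real t) * exp (c * of_real t) * of_real (gauss t))
      \<le> (B * exp (b\<^sup>2 / (4 * pi))) * exp (- pi * t\<^sup>2)" for t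
  proof -
    have "Re (c * of_real t) \<le> cmod c * \<bar>t\<bar>"
      by (metis complex_Re_le_cmod norm_mult norm_of_real)
    then have "cmod (poly P (of_real t) * exp (c * of_real t) * of_real (gauss t))
        \<le> (B * exp (1 * \<bar>t\<bar>)) * exp (cmod c * \<bar>t\<bar>) * gauss t"
      using B(2)[of "of_real t"] B(1)
      unfolding norm_mult by (intro mult_mono) (auto simp: gauss_def)
    also have "\<dots> = B * (exp (b * \<bar>t\<bar>) * gauss t)"
      by (simp add: b_def algebra_simps exp_add)
    also have "\<dots> \<le> B * (exp (b\<^sup>2 / (4 * pi)) * exp (- pi * t\<^sup>2))"
      by (intro mult_left_mono exp_gauss_bound B)
    finally show ?thesis by (simp add: mult.assoc)
  qed
  then show ?thesis by (rule that)
qed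

lemma integrable_poly_exp_gauss:
  fixes P :: "complex poly"
  shows "integrable lborel (\<lambda>t. poly P (of_real t) * exp (c * of_real t) * of_real (gauss t))"
proof -
  obtain C where C: "\<And>t::real. cmod (poly P (of_real t) * exp (c * of_real t) * of_real (gauss t))
    \<le> C * exp (- pi * t\<^sup>2)" by (rule poly_exp_gauss_bound[of P c]) blast
  show ?thesis
  proof (rule Bochner_Integration.integrable_bound)
    show "integrable lborel (\<lambda>t. C * exp (- pi * t\<^sup>2))"
      by (intro integrable_mult_right gaussian_integral) simp
    show "(\<lambda>t. poly P (of_real t) * exp (c * of_real t) * of_real (gauss t)) \<in> borel_measurable lborel"
      unfolding gauss_def measurable_lborel2
      by (intro borel_measurable_continuous_onI continuous_intros)
    show "AE t in lborel. norm (poly P (of_real t) * exp (c * of_real t) * of_real (gauss t))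
        \<le> norm (C * exp (- pi * t\<^sup>2))"
      by (intro AE_I2 order_trans[OF C]) (simp only: real_norm_def abs_ge_self)
  qed
qed

text \<open>With \<open>c = 0\<close> this is the pairing that makes the Hermite polynomials
  orthogonal; imaginary \<open>c\<close> gives Fourier transforms, and general complex
  \<open>c\<close> occurs in the kernel.\<close>

definition gauss_int :: "complex \<Rightarrow> complex poly \<Rightarrow> complex" where
  "gauss_int c P = (\<integral>t. poly P (of_real t) * exp (c * of_real t) * of_real (gauss t) \<partial>lborel)"

lemma gauss_int_add: "gauss_int c (P + Q) = gauss_int c P + gauss_int c Q"
  unfolding gauss_int_def by (simp add: distrib_right integrable_poly_exp_gauss)

lemma gauss_int_diff: "gauss_int c (P - Q) = gauss_int c P - gauss_int c Q"
  unfolding gauss_int_def by (simp add: left_diff_distrib integrable_poly_exp_gauss)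

lemma gauss_int_smult: "gauss_int c (smult a P) = a * gauss_int c P"
  unfolding gauss_int_def by (simp add: mult.assoc)

lemma gauss_int_0 [simp]: "gauss_int c 0 = 0"
  by (simp add: gauss_int_def)

lemma gauss_int_sum: "gauss_int c (\<Sum>i\<in>I. P i) = (\<Sum>i\<in>I. gauss_int c (P i))"
  by (induction I rule: infinite_finite_induct) (auto simp: gauss_int_add)

text \<open>The derivative of polynomial times exponential times Gaussian integrates to zero.
  Together with the value at the constant 1 this identity determines \<open>gauss_int c\<close>, as
  it trades a factor t for lower degrees.\<close>

lemma gauss_int_by_parts: "4 * of_real pi * gauss_int c (pCons 0 P) = gauss_int c (pderiv P) + c * gauss_int c P"
proof -
  let ?F = "\<lambda>t::real. poly P (of_real t) * exp (c * of_real t) * of_real (gauss t)"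
  \<comment> \<open>\<open>?Q\<close> is the polynomial factor of the derivative of
    \<open>?F\<close>.\<close>
  let ?Q = "pderiv P + smult c P - smult (4 * of_real pi) (pCons 0 P)"
  let ?f = "\<lambda>t::real. poly ?Q (of_real t) * exp (c * of_real t) * of_real (gauss t)"
  obtain C where C: "\<And>t::real. cmod (?F t) \<le> C * exp (- pi * t\<^sup>2)"
    by (rule poly_exp_gauss_bound[of P c]) blast
  have deriv: "(?F has_vector_derivative ?f t) (at t)" for t
  proof -
    have "((\<lambda>z. poly P z * exp (c * z) * exp (- 2 * of_real pi * z\<^sup>2))
      has_field_derivative poly ?Q z * exp (c * z) * exp (- 2 * of_real pi * z\<^sup>2)) (at z)" for z
      by (auto intro!: derivative_eq_intros simp: algebra_simps)
    from has_vector_derivative_real_field[OF this[of "of_real t"]]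
    show ?thesis by (simp add: gauss_def flip: exp_of_real)
  qed
  have lim_top: "((\<lambda>t. ?F t) \<longlongrightarrow> 0) at_top"
    by (rule Lim_null_comparison[OF always_eventually[OF allI[OF C]]]) real_asymp
  have lim_bot: "((\<lambda>t. ?F t) \<longlongrightarrow> 0) at_bot"
    by (rule Lim_null_comparison[OF always_eventually[OF allI[OF C]]]) real_asymp
  have "(LBINT t=-\<infinity>..\<infinity>. ?f t) = 0 - 0"
  proof (rule interval_integral_FTC_integrable)
    show "((?F \<circ> real_of_ereal) \<longlongrightarrow> 0) (at_right (-\<infinity>))" "((?F \<circ> real_of_ereal) \<longlongrightarrow> 0) (at_left \<infinity>)"
      using lim_top lim_bot by (simp_all add: ereal_tendsto_simps)
    show "set_integrable lborel (einterval (- \<infinity>) \<infinity>) ?f"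
      using integrable_poly_exp_gauss[of ?Q c] by (simp add: set_integrable_def)
    show "isCont ?f t" for t
      unfolding gauss_def by (intro continuous_intros)
  qed (use deriv in auto)
  then have "gauss_int c ?Q = 0"
    by (simp add: interval_lebesgue_integral_def set_lebesgue_integral_def gauss_int_def)
  then show ?thesis by (simp only: gauss_int_add gauss_int_diff gauss_int_smult) simp
qed

text \<open>The real part of \<open>c\<close> is removed by translating the variable; the imaginary
  part leads to the characteristic function of the normal distribution.\<close>

lemma gauss_int_1: "gauss_int c 1 = exp (c\<^sup>2 / (8 * of_real pi)) / sqrt 2"
proof -
  \<comment> \<open>Substituting \<open>a + k * x\<close> centres the real exponential and turns the
    Gaussian into exp (- x^2 / 2), since 2 * pi * k^2 = 1 / 2.\<close>
  define k where "k = 1 / (2 * sqrt pi)"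
  define a where "a = Re c / (4 * pi)"
  define b where "b = Im c"
  have k: "k > 0" "k\<^sup>2 = 1 / (4 * pi)" by (auto simp: k_def power_divide)
  have c: "c = of_real (4 * pi * a) + \<i> * of_real b"
    by (simp add: a_def b_def complex_eq_iff)
  let ?f = "\<lambda>t::real. exp (c * of_real t) * of_real (gauss t)"
  have pt: "?f (a + k * x) = exp (c * of_real a - 2 * of_real pi * (of_real a)\<^sup>2) *
     (of_real (exp (- x\<^sup>2 / 2)) * iexp (b * k * x))" for x
  proof -
    have "2 * pi * (k * x)\<^sup>2 = x\<^sup>2 / 2" using k by (simp add: power_mult_distrib)
    then have "- 2 * pi * (a + k * x)\<^sup>2 = - 2 * pi * a\<^sup>2 - 4 * pi * a * k * x - x\<^sup>2 / 2"
      by (simp add: power2_sum algebra_simps)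
    then have g: "complex_of_real (gauss (a + k * x)) =
        exp (of_real (- 2 * pi * a\<^sup>2 - 4 * pi * a * k * x - x\<^sup>2 / 2))"
      by (simp only: gauss_def exp_of_real)
    have e: "complex_of_real (exp (- x\<^sup>2 / 2)) = exp (of_real (- x\<^sup>2 / 2))" by (simp only: exp_of_real)
    show ?thesis
      unfolding g e exp_add[symmetric]
      by (rule arg_cong[where f=exp]) (simp add: c algebra_simps power2_eq_square)
  qed
  have chi: "(\<integral>x. of_real (exp (- x\<^sup>2 / 2)) * iexp (b * k * x) \<partial>lborel)
      = of_real (sqrt (2 * pi) * exp (- (b * k)\<^sup>2 / 2))"
  proof -
    have "of_real (exp (- (b * k)\<^sup>2 / 2)) = (\<integral>x. iexp (b * k * x) \<partial>std_normal_distribution)"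
      using fun_cong[OF char_std_normal_distribution, of "b * k"] by (simp add: char_def)
    also have "\<dots> = (\<integral>x. std_normal_density x *\<^sub>R iexp (b * k * x) \<partial>lborel)"
      by (rule integral_density) auto
    also have "\<dots> = (\<integral>x. of_real (1 / sqrt (2 * pi)) * (of_real (exp (- x\<^sup>2 / 2)) * iexp (b * k * x)) \<partial>lborel)"
      by (simp add: std_normal_density_def scaleR_conv_of_real mult.assoc)
    also have "\<dots> = of_real (1 / sqrt (2 * pi)) * (\<integral>x. of_real (exp (- x\<^sup>2 / 2)) * iexp (b * k * x) \<partial>lborel)"
      by (rule integral_mult_right_zero)
    finally have "of_real (sqrt (2 * pi)) * of_real (exp (- (b * k)\<^sup>2 / 2)) =
        of_real (sqrt (2 * pi) * (1 / sqrt (2 * pi))) *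
        (\<integral>x. of_real (exp (- x\<^sup>2 / 2)) * iexp (b * k * x) \<partial>lborel)"
      by (simp only: of_real_mult mult.assoc)
    moreover have "sqrt (2 * pi) * (1 / sqrt (2 * pi)) = 1" by simp
    ultimately show ?thesis by (simp only: of_real_1 mult_1 of_real_mult)
  qed
  have "gauss_int c 1 = \<bar>k\<bar> *\<^sub>R (\<integral>x. ?f (a + k * x) \<partial>lborel)"
    unfolding gauss_int_def using k by (subst lborel_integral_real_affine[of k _ a]) auto
  also have "\<dots> = of_real k * (exp (c * of_real a - 2 * of_real pi * (of_real a)\<^sup>2) *
      of_real (sqrt (2 * pi) * exp (- (b * k)\<^sup>2 / 2)))"
    unfolding pt integral_mult_right_zero chi using k by (simp add: scaleR_conv_of_real)
  also have "\<dots> = of_real (k * sqrt (2 * pi)) *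
      exp (c * of_real a - 2 * of_real pi * (of_real a)\<^sup>2 + of_real (- (b * k)\<^sup>2 / 2))"
    by (simp only: exp_add exp_of_real of_real_mult mult_ac)
  also have "c * of_real a - 2 * of_real pi * (of_real a)\<^sup>2 + of_real (- (b * k)\<^sup>2 / 2)
      = c\<^sup>2 / (8 * of_real pi)"
  proof -
    have "- (b * k)\<^sup>2 / 2 = - b\<^sup>2 / (8 * pi)" by (simp add: power_mult_distrib k(2))
    then show ?thesis
      by (simp only:) (simp add: c field_simps power2_eq_square)
  qed
  also have "k * sqrt (2 * pi) = 1 / sqrt 2"
    by (simp add: k_def real_sqrt_mult field_simps)
  finally show ?thesis by (simp add: field_simps)
qed

text \<open>Formally the line of integration moves by \<open>c / (4 * of_real pi)\<close>, a complex
  number. Both sides obey the same rule of integration by parts, which lowers the degree, so the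
  induction reduces the claim to constants.\<close>

lemma gauss_int_shift:
  "gauss_int c P = exp (c\<^sup>2 / (8 * of_real pi)) * gauss_int 0 (pcompose P [:c / (4 * of_real pi), 1:])"
proof (induction "degree P" arbitrary: P rule: less_induct)
  case less
  let ?S = "[:c / (4 * of_real pi), 1:]"
  let ?E = "exp (c\<^sup>2 / (8 * of_real pi))"
  show ?case
  proof (cases "degree P = 0")
    case True
    then obtain a where P: "P = [:a:]" by (rule degree_eq_zeroE)
    have "gauss_int b [:a:] = a * gauss_int b 1" for b
      using gauss_int_smult[of b a 1] by (simp add: one_pCons)
    note this[simp]
    show ?thesis unfolding P pcompose_const by (simp add: gauss_int_1 del: one_pCons)
  next
    case False
    obtain a Q where P: "P = pCons a Q" by (cases P)
    have Q: "degree Q < degree P" using False by (auto simp: P split: if_splits)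
    have Q': "degree (pderiv Q) < degree P" using Q by (simp add: degree_pderiv)
    let ?R = "pcompose Q ?S"
    have a: "gauss_int b [:a:] = a * gauss_int b 1" for b
      using gauss_int_smult[of b a 1] by (simp add: one_pCons)
    have parts: "gauss_int b (pCons 0 X) = (gauss_int b (pderiv X) + b * gauss_int b X) / (4 * of_real pi)" for b X
      using gauss_int_by_parts[of b X] by (simp add: field_simps)
    have "gauss_int c P = gauss_int c ([:a:] + pCons 0 Q)" by (simp add: P)
    also have "\<dots> = a * gauss_int c 1 + (gauss_int c (pderiv Q) + c * gauss_int c Q) / (4 * of_real pi)"
      by (simp only: gauss_int_add a parts)
    also have "\<dots> = ?E * (a * gauss_int 0 1 + (gauss_int 0 (pcompose (pderiv Q) ?S) + c * gauss_int 0 ?R) / (4 * of_real pi))"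
      unfolding less(1)[OF Q] less(1)[OF Q'] by (simp add: gauss_int_1 algebra_simps add_divide_distrib)
    also have "pcompose (pderiv Q) ?S = pderiv ?R"
      by (simp add: pderiv_pcompose pderiv_pCons)
    also have "a * gauss_int 0 1 + (gauss_int 0 (pderiv ?R) + c * gauss_int 0 ?R) / (4 * of_real pi)
        = gauss_int 0 ([:a:] + (smult (c / (4 * of_real pi)) ?R + pCons 0 ?R))"
      by (simp only: gauss_int_add a parts gauss_int_smult) (simp add: add_divide_distrib)
    also have "[:a:] + (smult (c / (4 * of_real pi)) ?R + pCons 0 ?R) = pcompose P ?S"
      by (simp add: P pcompose_pCons mult_pCons_left)
    finally show ?thesis .
  qed
qed

section \<open>Hermite polynomials for the weight \<open>exp (- 2 * pi * t\<^sup>2)\<close>\<close>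

text \<open>The recursion is the action of \<open>d_z\<close> on the weighted functions
  \<open>exp (- pi * (cmod z)\<^sup>2) * poly (herm r) (Im z + \<mu>) * gauss_exp \<mu> z\<close>, up to a factor \<open>\<i>\<close>.\<close>

primrec herm :: "nat \<Rightarrow> complex poly" where
  "herm 0 = 1"
| "herm (Suc r) = smult (2 * of_real pi) (pCons 0 (herm r)) - smult (1 / 2) (pderiv (herm r))"

text \<open>The raising step of the recursion is adjoint to half the derivative.\<close>

lemma gauss_int_herm_Suc: "gauss_int 0 (herm (Suc r) * P) = gauss_int 0 (herm r * pderiv P) / 2"
proof -
  have "herm (Suc r) * P = smult (2 * of_real pi) (pCons 0 (herm r * P)) - smult (1 / 2) (pderiv (herm r) * P)"
    by (simp add: left_diff_distrib)
  then have "gauss_int 0 (herm (Suc r) * P)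
      = 2 * of_real pi * gauss_int 0 (pCons 0 (herm r * P)) - gauss_int 0 (pderiv (herm r) * P) / 2"
    by (simp only: gauss_int_diff gauss_int_smult) simp
  also have "2 * of_real pi * gauss_int 0 (pCons 0 (herm r * P)) = gauss_int 0 (pderiv (herm r * P)) / 2"
    using gauss_int_by_parts[of 0 "herm r * P"] by (simp add: field_simps)
  finally show ?thesis
    by (simp add: pderiv_mult gauss_int_add mult.commute add_divide_distrib)
qed

text \<open>The Appell property. Differentiating the recursion produces the commutator of the
  derivative with multiplication by t, which adds one more copy of the lower polynomial at each
  step.\<close>

lemma pderiv_herm_Suc: "pderiv (herm (Suc r)) = smult (2 * of_real pi * of_nat (Suc r)) (herm r)"
proof (induction r)
  case 0
  show ?case by (simp add: pderiv_pCons pderiv_diff pderiv_smult one_pCons)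
next
  case (Suc r)
  have "pderiv (herm (Suc (Suc r))) = smult (2 * of_real pi) (herm (Suc r))
     + smult (2 * of_real pi) (pCons 0 (pderiv (herm (Suc r)))) - smult (1 / 2) (pderiv (pderiv (herm (Suc r))))"
    by (subst herm.simps(2)) (simp add: pderiv_diff pderiv_smult pderiv_pCons smult_add_right del: herm.simps)
  also have "\<dots> = smult (2 * of_real pi) (herm (Suc r)) +
     smult (2 * of_real pi * of_nat (Suc r)) (herm (Suc r))"
    unfolding Suc pderiv_smult by (simp add: smult_diff_right ac_simps del: of_nat_Suc)
  also have "\<dots> = smult (2 * of_real pi * of_nat (Suc (Suc r))) (herm (Suc r))"
    by (simp add: smult_add_left[symmetric] algebra_simps del: herm.simps)
  finally show ?case .
qed

text \<open>Read as multiplication by t, this moves a level to its two neighbours; hence the span of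
  all levels is stable under multiplication by Im z plus the frequency.\<close>

lemma herm_recurrence:
  "smult (2 * of_real pi) (pCons 0 (herm (Suc r))) = herm (Suc (Suc r)) + smult (of_real pi * of_nat (Suc r)) (herm r)"
  by (subst herm.simps(2)[of "Suc r"]) (simp add: pderiv_herm_Suc mult.assoc del: herm.simps of_nat_Suc)

text \<open>Each use of the adjoint relation lowers both indices by one, until one of them is
  zero.\<close>

lemma gauss_int_herm_herm: "gauss_int 0 (herm r * herm s) = (if r = s then of_real (pi ^ r * fact r / sqrt 2) else 0)"
proof (induction r arbitrary: s)
  case 0
  show ?case
  proof (cases s)
    case 0
    then show ?thesis by (simp add: gauss_int_1)
  next
    case (Suc s')
    then show ?thesis using gauss_int_herm_Suc[of s' 1] by simp
  qed
next
  case (Suc r)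
  show ?case
  proof (cases s)
    case 0
    then show ?thesis using gauss_int_herm_Suc[of r 1] by simp
  next
    case (Suc s')
    have "gauss_int 0 (herm (Suc r) * herm s) = of_real pi * of_nat (Suc s') * gauss_int 0 (herm r * herm s')"
      unfolding Suc gauss_int_herm_Suc pderiv_herm_Suc mult_smult_right gauss_int_smult by simp
    then show ?thesis unfolding Suc.IH by (simp add: \<open>s = Suc s'\<close>)
  qed
qed

text \<open>Each raising step moves over as a derivative, and \<open>r\<close> derivatives kill a
  polynomial of smaller degree.\<close>

lemma gauss_int_herm_low_degree: "degree P < r \<Longrightarrow> gauss_int 0 (herm r * P) = 0"
proof (induction r arbitrary: P)
  case (Suc r)
  show ?case
  proof (cases "degree P = 0")
    case True
    then have "pderiv P = 0" by (simp add: pderiv_eq_0_iff)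
    then show ?thesis unfolding gauss_int_herm_Suc by simp
  next
    case False
    then have "degree (pderiv P) < r" using Suc.prems by (simp add: degree_pderiv)
    then show ?thesis unfolding gauss_int_herm_Suc using Suc.IH by simp
  qed
qed simp

text \<open>Pascal's rule for an arbitrary sequence \<open>h\<close>, so that it serves both the
  translated Hermite polynomials and the Leibniz expansion of \<open>d_z\<close>.\<close>

lemma binomial_sum_Suc:
  fixes x :: "'a::comm_ring_1"
  shows "(\<Sum>j\<le>Suc n. of_nat (Suc n choose j) * x ^ (Suc n - j) * h j) =
    x * (\<Sum>j\<le>n. of_nat (n choose j) * x ^ (n - j) * h j) +
    (\<Sum>j\<le>n. of_nat (n choose j) * x ^ (n - j) * h (Suc j))"
proof -
  have 1: "x * (\<Sum>j\<le>n. of_nat (n choose j) * x ^ (n - j) * h j)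
      = (\<Sum>j\<le>n. of_nat (n choose j) * x ^ (Suc n - j) * h j)"
    unfolding sum_distrib_left by (intro sum.cong) (auto simp: Suc_diff_le)
  have "(\<Sum>j\<le>n. of_nat (n choose j) * x ^ (Suc n - j) * h j)
      = (\<Sum>j\<le>Suc n. of_nat (n choose j) * x ^ (Suc n - j) * h j)"
    by (simp add: binomial_eq_0)
  also have "\<dots> = x ^ Suc n * h 0 + (\<Sum>j\<le>n. of_nat (n choose Suc j) * x ^ (n - j) * h (Suc j))"
    by (subst sum.atMost_Suc_shift) simp
  finally show ?thesis
    unfolding 1 by (subst sum.atMost_Suc_shift) (simp add: distrib_right sum.distrib algebra_simps)
qed

text \<open>Translation by \<open>a\<close> turns the raising operator into itself plus the constant
  2 * pi * a; the two summands commute, whence the binomial formula.\<close>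

lemma pcompose_herm:
  "pcompose (herm r) [:a, 1:] =
    (\<Sum>j\<le>r. of_nat (r choose j) * [:2 * of_real pi * a:] ^ (r - j) * herm j)"
proof (induction r)
  case (Suc r)
  let ?S = "[:a, 1:]" and ?b = "[:2 * of_real pi * a:]"
  let ?X = "pcompose (herm r) ?S"
  define raise where "raise P = smult (2 * of_real pi) (pCons 0 P) - smult (1 / 2) (pderiv P)" for P :: "complex poly"
  have raise_add: "raise (P + Q) = raise P + raise Q" for P Q
  proof -
    have "pCons 0 (A + B) = pCons 0 A + pCons 0 B" for A B :: "complex poly" by simp
    then show ?thesis
      unfolding raise_def pderiv_add by (simp only: smult_add_right add_diff_add)
  qed
  have raise_0: "raise 0 = 0" by (simp add: raise_def)
  have raise_sum: "raise (\<Sum>i\<in>I. P i) = (\<Sum>i\<in>I. raise (P i))" for I and P :: "nat \<Rightarrow> complex poly"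
    by (induction I rule: infinite_finite_induct)
      (auto simp: raise_0 raise_add)
  have raise_smult: "raise (smult c P) = smult c (raise P)" for c P
    by (simp add: raise_def pderiv_smult smult_diff_right mult.commute)
  have const: "of_nat n * [:c:] ^ m * P = smult (of_nat n * c ^ m) P" for n m c and P :: "complex poly"
    by (simp add: of_nat_poly poly_const_pow mult.commute)
  have "pcompose (herm (Suc r)) ?S = smult (2 * of_real pi) (?S * ?X) - smult (1 / 2) (pcompose (pderiv (herm r)) ?S)"
    by (simp add: pcompose_diff pcompose_smult pcompose_pCons)
  also have "pcompose (pderiv (herm r)) ?S = pderiv ?X"
    by (simp add: pderiv_pcompose pderiv_pCons)
  also have "smult (2 * of_real pi) (?S * ?X) - smult (1 / 2) (pderiv ?X) = ?b * ?X + raise ?X"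
    by (simp add: raise_def smult_add_right)
  also have "raise ?X = (\<Sum>j\<le>r. of_nat (r choose j) * ?b ^ (r - j) * herm (Suc j))"
    unfolding Suc raise_sum const raise_smult by (simp add: raise_def)
  also have "?b * ?X + \<dots> = (\<Sum>j\<le>Suc r. of_nat (Suc r choose j) * ?b ^ (Suc r - j) * herm j)"
    unfolding Suc by (rule binomial_sum_Suc[symmetric])
  finally show ?case .
qed (simp add: pcompose_1)

section \<open>Laguerre polynomials and products of translated Hermite polynomials\<close>

lemma laguerre_0: "laguerre r 0 x = (\<Sum>i\<le>r. (-1) ^ i * of_nat (r choose i) * x ^ i / fact i)"
  unfolding laguerre_def
proof (rule sum.cong)
  fix i assume "i \<in> {..r}"
  then have "(real r + 0) gchoose (r - i) = of_nat (r choose i)"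
    using binomial_gbinomial[of r "r - i", where 'a=real] binomial_symmetric[of i r] by simp
  then show "(-1) ^ i * (real r + 0 gchoose (r - i)) * x ^ i / fact i =
    (-1) ^ i * of_nat (r choose i) * x ^ i / fact i" by simp
qed simp

lemma laguerre_1: "laguerre r 1 x = (\<Sum>i\<le>r. (-1) ^ i * of_nat (Suc r choose Suc i) * x ^ i / fact i)"
  unfolding laguerre_def
proof (rule sum.cong)
  fix i assume "i \<in> {..r}"
  then have "(real r + 1) gchoose (r - i) = of_nat (Suc r choose Suc i)"
    using binomial_gbinomial[of "Suc r" "r - i", where 'a=real] binomial_symmetric[of "Suc i" "Suc r"]
    by (simp add: add.commute)
  then show "(-1) ^ i * (real r + 1 gchoose (r - i)) * x ^ i / fact i =
    (-1) ^ i * of_nat (Suc r choose Suc i) * x ^ i / fact i" by simp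
qed simp

text \<open>Pascal's rule for \<open>Suc n choose Suc i\<close>. This merges the kernels of the
  levels into a single Laguerre polynomial of parameter 1.\<close>

lemma sum_laguerre_0: "(\<Sum>r<Suc n. laguerre r 0 x) = laguerre n 1 x"
proof (induction n)
  case 0
  then show ?case by (simp add: laguerre_0 laguerre_1)
next
  case (Suc n)
  have "laguerre n 1 x = (\<Sum>i\<le>Suc n. (-1) ^ i * of_nat (Suc n choose Suc i) * x ^ i / fact i)"
    unfolding laguerre_1 by (simp add: binomial_eq_0)
  then have "laguerre n 1 x + laguerre (Suc n) 0 x = laguerre (Suc n) 1 x"
    unfolding laguerre_0 laguerre_1 sum.distrib[symmetric]
    by (simp add: sum.distrib[symmetric] algebra_simps add_divide_distrib del: sum.atMost_Suc)
  then show ?case using Suc by simp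
qed

text \<open>Orthogonality leaves only the diagonal of the two binomial expansions. Read in reverse
  order it is a Laguerre polynomial, and the kernel will supply shifts for which - 4 * a * b is a
  squared distance.\<close>

lemma gauss_int_herm_shifted:
  assumes "4 * (a * b) = - of_real \<rho>"
  shows "gauss_int 0 (pcompose (herm r) [:a, 1:] * pcompose (herm r) [:b, 1:])
    = of_real (pi ^ r * fact r / sqrt 2 * laguerre r 0 (pi * \<rho>))"
proof -
  have const: "of_nat n * [:c:] ^ m * P = smult (of_nat n * c ^ m) P" for n m c and P :: "complex poly"
    by (simp add: of_nat_poly poly_const_pow mult.commute)
  let ?u = "\<lambda>a j. of_nat (r choose j) * (2 * of_real pi * a) ^ (r - j) :: complex"
  have "gauss_int 0 (pcompose (herm r) [:a, 1:] * pcompose (herm r) [:b, 1:])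
      = (\<Sum>i\<le>r. \<Sum>j\<le>r. ?u a i * (?u b j * gauss_int 0 (herm i * herm j)))"
    unfolding pcompose_herm const sum_product gauss_int_sum mult_smult_left mult_smult_right gauss_int_smult
    by (simp only: mult_ac)
  also have "\<dots> = (\<Sum>i\<le>r. \<Sum>j\<le>r. if i = j then ?u a i * (?u b i * of_real (pi ^ i * fact i / sqrt 2)) else 0)"
    unfolding gauss_int_herm_herm by (intro sum.cong refl) simp
  also have "\<dots> = (\<Sum>i\<le>r. ?u a i * (?u b i * of_real (pi ^ i * fact i / sqrt 2)))"
    by simp
  also have "\<dots> = (\<Sum>i\<le>r. ?u a (r - i) * (?u b (r - i) * of_real (pi ^ (r - i) * fact (r - i) / sqrt 2)))"
    using sum.nat_diff_reindex[of "\<lambda>i. ?u a i * (?u b i * of_real (pi ^ i * fact i / sqrt 2))" "Suc r"]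
    by (simp add: lessThan_Suc_atMost)
  also have "\<dots> = (\<Sum>i\<le>r. of_real (pi ^ r * fact r / sqrt 2 *
      ((-1) ^ i * of_nat (r choose i) * (pi * \<rho>) ^ i / fact i)))"
  proof (rule sum.cong)
    fix i assume "i \<in> {..r}"
    then have i: "i \<le> r" by simp
    have ab: "(2 * of_real pi * a) ^ i * (2 * of_real pi * b) ^ i = (of_real (pi * (- (pi * \<rho>))) :: complex) ^ i"
    proof -
      have "(2 * of_real pi * a) * (2 * of_real pi * b) = of_real pi * (of_real pi * (4 * (a * b)))"
        by (simp add: algebra_simps)
      also have "\<dots> = (of_real (pi * (- (pi * \<rho>))) :: complex)" by (simp add: assms)
      finally show ?thesis by (metis power_mult_distrib)
    qed
    have c: "real (r choose i) * fact (r - i) = fact r / fact i"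
      using binomial_fact[OF i, where 'a=real] by simp
    have "?u a (r - i) * (?u b (r - i) * of_real (pi ^ (r - i) * fact (r - i) / sqrt 2))
        = of_nat (r choose i) * of_nat (r choose i) * ((2 * of_real pi * a) ^ i * (2 * of_real pi * b) ^ i)
          * of_real (pi ^ (r - i) * fact (r - i) / sqrt 2)"
      using i binomial_symmetric[OF i] by (simp add: mult_ac)
    also have "\<dots> = of_real (of_nat (r choose i) * (of_nat (r choose i) * fact (r - i)) *
        (pi * (- (pi * \<rho>))) ^ i * pi ^ (r - i) / sqrt 2)"
      unfolding ab by simp
    also have "of_nat (r choose i) * (of_nat (r choose i) * fact (r - i)) *
        (pi * (- (pi * \<rho>))) ^ i * pi ^ (r - i) / sqrt 2
        = real (r choose i) * (fact r / fact i) * (- (pi * \<rho>)) ^ i * (pi ^ i * pi ^ (r - i)) / sqrt 2"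
      unfolding c power_mult_distrib by simp
    also have "pi ^ i * pi ^ (r - i) = pi ^ r" using i by (simp flip: power_add)
    also have "(- (pi * \<rho>)) ^ i = (-1) ^ i * (pi * \<rho>) ^ i" by (metis mult_minus1 power_mult_distrib)
    finally show "?u a (r - i) * (?u b (r - i) * of_real (pi ^ (r - i) * fact (r - i) / sqrt 2)) =
      of_real (pi ^ r * fact r / sqrt 2 * ((-1) ^ i * of_nat (r choose i) * (pi * \<rho>) ^ i / fact i))"
      by (simp add: mult_ac)
  qed simp
  also have "\<dots> = of_real (pi ^ r * fact r / sqrt 2 * laguerre r 0 (pi * \<rho>))"
    unfolding laguerre_0 sum_distrib_left of_real_sum ..
  finally show ?thesis .
qed

section \<open>The weighted strip\<close>

lemma measurable_Complex [measurable]: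
  "(\<lambda>(x, y). Complex x y) \<in> borel_measurable (lborel \<Otimes>\<^sub>M lborel)"
  unfolding lborel_prod measurable_lborel2
  by (intro borel_measurable_continuous_onI) (auto simp: split_beta Complex_eq intro!: continuous_intros)

text \<open>Agreement on boxes identifies the two measures; this opens the way to Fubini in Re z and
  Im z.\<close>

lemma lborel_complex_eq: "lborel = distr (lborel \<Otimes>\<^sub>M lborel) borel (\<lambda>(x, y). Complex x y)"
proof (rule lborel_eqI)
  fix l u :: complex
  assume le: "\<And>b. b \<in> Basis \<Longrightarrow> l \<bullet> b \<le> u \<bullet> b"
  have re: "Re l \<le> Re u" and im: "Im l \<le> Im u"
    using le[of 1] le[of \<i>] by (auto simp: Basis_complex_def)
  have pre: "(\<lambda>(x, y). Complex x y) -` box l u \<inter> space (lborel \<Otimes>\<^sub>M lborel)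
      = {Re l<..<Re u} \<times> {Im l<..<Im u}"
    by (auto simp: box_def Basis_complex_def space_pair_measure)
  have "emeasure (distr (lborel \<Otimes>\<^sub>M lborel) borel (\<lambda>(x, y). Complex x y)) (box l u)
      = emeasure (lborel \<Otimes>\<^sub>M lborel) ({Re l<..<Re u} \<times> {Im l<..<Im u})"
    by (subst emeasure_distr) (auto simp: pre[symmetric])
  also have "\<dots> = ennreal ((Re u - Re l) * (Im u - Im l))"
    using re im by (subst lborel.emeasure_pair_measure_Times) (auto simp: ennreal_mult)
  also have "(Re u - Re l) * (Im u - Im l) = (\<Prod>b\<in>Basis. (u - l) \<bullet> b)"
    by (simp add: Basis_complex_def)
  finally show "emeasure (distr (lborel \<Otimes>\<^sub>M lborel) borel (\<lambda>(x, y). Complex x y)) (box l u)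
      = (\<Prod>b\<in>Basis. (u - l) \<bullet> b)" by simp
qed simp

text \<open>The horizontal variable is the inner one because in the applications its integral picks
  out a Fourier mode.\<close>

lemma integral_complex_iterated:
  fixes f :: "complex \<Rightarrow> complex"
  assumes f: "integrable lborel f"
  shows "(\<integral>z. f z \<partial>lborel) = (\<integral>y. (\<integral>x. f (Complex x y) \<partial>lborel) \<partial>lborel)"
proof -
  have m: "f \<in> borel_measurable borel" using f by auto
  have int: "integrable (lborel \<Otimes>\<^sub>M lborel) (\<lambda>(x, y). f (Complex x y))"
    using f unfolding lborel_complex_eq
    by (subst (asm) integrable_distr_eq) (auto simp: case_prod_unfold m)
  have "(\<integral>z. f z \<partial>lborel) = (\<integral>p. (case p of (x, y) \<Rightarrow> f (Complex x y)) \<partial>(lborel \<Otimes>\<^sub>M lborel))"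
    by (subst lborel_complex_eq, subst integral_distr) (auto simp: m case_prod_unfold)
  also have "\<dots> = (\<integral>y. (\<integral>x. f (Complex x y) \<partial>lborel) \<partial>lborel)"
    by (rule lborel_pair.integral_snd[OF int, symmetric])
  finally show ?thesis .
qed

lemma integral_complex_product:
  fixes a b :: "real \<Rightarrow> complex"
  assumes a: "integrable lborel a" and b: "integrable lborel b"
  shows "integrable lborel (\<lambda>z. a (Re z) * b (Im z))"
    and "(\<integral>z. a (Re z) * b (Im z) \<partial>lborel) = (\<integral>x. a x \<partial>lborel) * (\<integral>y. b y \<partial>lborel)"
proof -
  have [measurable]: "a \<in> borel_measurable borel" "b \<in> borel_measurable borel"
    using a b by auto
  have m: "(\<lambda>z. a (Re z) * b (Im z)) \<in> borel_measurable borel" by measurable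
  have int: "integrable (lborel \<Otimes>\<^sub>M lborel) (\<lambda>(x, y). a x * b y)"
  proof (rule lborel_pair.Fubini_integrable)
    show "integrable lborel (\<lambda>x. \<integral>y. norm (case (x, y) of (x, y) \<Rightarrow> a x * b y) \<partial>lborel)"
      using a by (simp add: norm_mult)
    show "AE x in lborel. integrable lborel (\<lambda>y. case (x, y) of (x, y) \<Rightarrow> a x * b y)"
      using b by simp
  qed measurable
  show int': "integrable lborel (\<lambda>z. a (Re z) * b (Im z))"
    by (subst lborel_complex_eq, subst integrable_distr_eq) (use int in \<open>auto simp: m case_prod_unfold\<close>)
  show "(\<integral>z. a (Re z) * b (Im z) \<partial>lborel) = (\<integral>x. a x \<partial>lborel) * (\<integral>y. b y \<partial>lborel)"
    unfolding integral_complex_iterated[OF int'] by simp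
qed

section \<open>The measure of the strip and its inner product\<close>

definition weight :: "complex \<Rightarrow> real" where
  "weight z = indicator strip z * exp (- pi * (cmod z)\<^sup>2)"

text \<open>Based on the completion \<open>lebesgue\<close>, as membership in \<open>L2_qp\<close>
  asks only for Lebesgue measurability. Integrals of Borel functions are moved to
  \<open>lborel\<close>, where Fubini is available.\<close>

definition MS :: "complex measure" where
  "MS = density lebesgue (\<lambda>z. ennreal (weight z))"

lemma strip_measurable [measurable]: "strip \<in> sets borel"
  unfolding strip_def by measurable

lemma weight_nonneg [simp]: "0 \<le> weight z"
  by (simp add: weight_def)

lemma weight_measurable [measurable]: "weight \<in> borel_measurable borel"
  unfolding weight_def by measurable

lemma weight_measurable_lebesgue [measurable]: "weight \<in> borel_measurable lebesgue"
  by (rule measurable_completion) simp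

lemma space_MS [simp]: "space MS = UNIV"
  by (simp add: MS_def)

lemma borel_measurable_MS: "borel_measurable MS = borel_measurable lebesgue"
  unfolding MS_def by (rule measurable_cong_sets) auto

lemma borel_measurable_MS_if_borel:
  "f \<in> borel_measurable borel \<Longrightarrow> f \<in> borel_measurable MS"
  unfolding borel_measurable_MS by (rule measurable_completion) simp

lemma borel_measurable_MS_if_continuous:
  "continuous_on UNIV f \<Longrightarrow> f \<in> borel_measurable MS"
  by (rule borel_measurable_MS_if_borel) (rule borel_measurable_continuous_onI)

lemma integral_MS:
  fixes f :: "complex \<Rightarrow> 'b::{banach, second_countable_topology}"
  assumes "f \<in> borel_measurable MS"
  shows "(\<integral>z. f z \<partial>MS) = (\<integral>z. weight z *\<^sub>R f z \<partial>lebesgue)"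
  using assms unfolding MS_def by (intro integral_density) auto

lemma integrable_MS:
  fixes f :: "complex \<Rightarrow> 'b::{banach, second_countable_topology}"
  assumes "f \<in> borel_measurable MS"
  shows "integrable MS f \<longleftrightarrow> integrable lebesgue (\<lambda>z. weight z *\<^sub>R f z)"
  using assms unfolding MS_def by (intro integrable_density) auto

lemma integral_MS_borel:
  fixes f :: "complex \<Rightarrow> 'b::{banach, second_countable_topology}"
  assumes [measurable]: "f \<in> borel_measurable borel"
  shows "(\<integral>z. f z \<partial>MS) = (\<integral>z. weight z *\<^sub>R f z \<partial>lborel)"
    and "integrable MS f \<longleftrightarrow> integrable lborel (\<lambda>z. weight z *\<^sub>R f z)"
  unfolding integral_MS[OF borel_measurable_MS_if_borel[OF assms]]
    integrable_MS[OF borel_measurable_MS_if_borel[OF assms]]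
  by (auto intro!: integral_completion integrable_completion)

lemma AE_MS_iff: "(AE z in MS. P z) \<longleftrightarrow> (AE z in lebesgue. z \<in> strip \<longrightarrow> P z)"
proof -
  have "0 < ennreal (weight z) \<longleftrightarrow> z \<in> strip" for z
    by (simp add: weight_def indicator_def)
  then show ?thesis
    unfolding MS_def by (subst AE_density) simp_all
qed

lemma AE_MS_strip: "AE z in MS. z \<in> strip"
  by (simp add: AE_MS_iff)

lemma ip_MS:
  assumes "F \<in> borel_measurable lebesgue" "G \<in> borel_measurable lebesgue"
  shows "ip MS F G = (LINT z:strip|lebesgue. F z * cnj (G z) * of_real (exp (- pi * (cmod z)\<^sup>2)))"
proof -
  have "(\<lambda>z. F z * cnj (G z)) \<in> borel_measurable MS"
    unfolding borel_measurable_MS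
    by (intro borel_measurable_times borel_measurable_continuous_on[of cnj] continuous_intros assms)
  then show ?thesis
    unfolding ip_def set_lebesgue_integral_def
    by (subst integral_MS) (auto simp: weight_def indicator_def scaleR_conv_of_real mult_ac intro!: Bochner_Integration.integral_cong)
qed

lemma winner_eq_ip:
  assumes "F \<in> borel_measurable lebesgue" "G \<in> borel_measurable lebesgue"
  shows "winner F G = ip MS F G"
  unfolding winner_def ip_MS[OF assms] ..

lemma wnorm_eq_nrm:
  assumes [measurable]: "F \<in> borel_measurable lebesgue"
  shows "wnorm F = nrm MS F"
proof -
  have "(\<lambda>z. (cmod (F z))\<^sup>2) \<in> borel_measurable MS"
    unfolding borel_measurable_MS by measurable
  then show ?thesis
    unfolding nrm_def wnorm_def set_lebesgue_integral_def
    by (subst integral_MS) (auto simp: weight_def indicator_def mult_ac intro!: Bochner_Integration.integral_cong)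
qed

lemma L2_qp_iff: "F \<in> L2_qp \<nu> \<longleftrightarrow> sq_int MS F \<and> quasi_periodic \<nu> F"
proof -
  have "integrable MS (\<lambda>z. (cmod (F z))\<^sup>2) \<longleftrightarrow>
      set_integrable lebesgue strip (\<lambda>z. (cmod (F z))\<^sup>2 * exp (- pi * (cmod z)\<^sup>2))"
    if [measurable]: "F \<in> borel_measurable lebesgue"
  proof -
    have "(\<lambda>z. (cmod (F z))\<^sup>2) \<in> borel_measurable MS"
      unfolding borel_measurable_MS by measurable
    then show ?thesis
      unfolding set_integrable_def
      by (subst integrable_MS) (auto simp: weight_def indicator_def mult_ac intro!: Bochner_Integration.integrable_cong)
  qed
  then show ?thesis by (auto simp: L2_qp_def sq_int_def borel_measurable_MS)
qed

lemma weight_split: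
  "weight (Complex x y) = (indicator {0..<1} x * exp (- pi * x\<^sup>2)) * exp (- pi * y\<^sup>2)"
  by (auto simp: weight_def strip_def indicator_def cmod_power2 algebra_simps simp flip: exp_add)

lemma integrable_indicator_01:
  fixes g :: "real \<Rightarrow> 'b::{banach, second_countable_topology}"
  assumes "continuous_on UNIV g"
  shows "integrable lborel (\<lambda>x. indicator {0..<1} x *\<^sub>R g x)"
proof -
  have "set_integrable lborel {0..1} g"
    by (rule borel_integrable_compact[unfolded set_integrable_def[symmetric]]) (auto intro: continuous_on_subset[OF assms])
  then have "set_integrable lborel {0..<1} g"
    by (rule set_integrable_subset) auto
  then show ?thesis by (simp add: set_integrable_def)
qed

text \<open>Finiteness makes constants square integrable majorants, as bounded pointwise limits
  require.\<close>

lemma finite_MS: "finite_measure MS"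
proof -
  have "integrable lborel (\<lambda>z. complex_of_real (indicator {0..<1} (Re z) *\<^sub>R exp (- pi * (Re z)\<^sup>2))
      * complex_of_real (exp (- pi * (Im z)\<^sup>2)))"
  proof (rule integral_complex_product(1))
    show "integrable lborel (\<lambda>x. complex_of_real (indicator {0..<1} x *\<^sub>R exp (- pi * x\<^sup>2)))"
      by (intro integrable_of_real integrable_indicator_01 continuous_intros)
    show "integrable lborel (\<lambda>y. complex_of_real (exp (- pi * y\<^sup>2)))"
      by (intro integrable_of_real gaussian_integral) simp
  qed
  then have "integrable lborel (\<lambda>z. complex_of_real (weight z))"
    using weight_split[of "Re z" "Im z" for z] by (simp add: mult_ac)
  from integrable_Re[OF this] have "integrable lborel (\<lambda>z. weight z *\<^sub>R (1::real))"
    by simp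
  then have "integrable MS (\<lambda>z. 1::real)"
    by (subst integral_MS_borel) auto
  then show ?thesis
    by (intro finite_measureI) (auto simp: integrable_iff_bounded)
qed

lemma integrable_MS_const: "integrable MS (\<lambda>z. c :: real)"
  using finite_MS by (rule finite_measure.integrable_const)

text \<open>The zero set is closed and contains almost every point of the open strip, hence all of
  it. The edge Re z = 0 follows by a limit from the right, the other points by translation.\<close>

lemma continuous_qp_eq_0:
  assumes cont: "continuous_on UNIV F" and qp: "quasi_periodic \<nu> F"
    and null: "AE z in MS. F z = 0"
  shows "F z = 0"
proof -
  let ?S = "{z. 0 < Re z \<and> Re z < 1}"
  have open_strip: "open ?S"
    by (intro open_Collect_conj open_Collect_less continuous_intros)
  have "AE z in lebesgue. z \<in> strip \<longrightarrow> F z = 0" using null by (simp add: AE_MS_iff)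
  then have "AE z in lebesgue. z \<in> ?S \<longrightarrow> z \<in> {z. F z = 0}"
    by eventually_elim (auto simp: strip_def)
  then have "AE z\<in>?S in lebesgue. z \<in> {z. F z = 0}" by simp
  moreover have closed: "closed {z. F z = 0}"
    by (intro closed_Collect_eq cont continuous_on_const)
  ultimately have zero: "F z = 0" if "z \<in> ?S" for z
    using mem_closed_if_AE_lebesgue_open[OF open_strip closed _ that] by blast
  have zero': "F z = 0" if "z \<in> strip" for z
  proof -
    \<comment> \<open>The shifts to the right are at most half the distance to the line Re z = 1, so
      the sequence stays in the open strip.\<close>
    have "(\<lambda>n. z + of_real ((1 - Re z) / 2 * inverse (real (Suc n)))) \<longlonglongrightarrow> z + of_real ((1 - Re z) / 2 * 0)"
      by (intro tendsto_intros LIMSEQ_inverse_real_of_nat)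
    then have lim: "(\<lambda>n. z + of_real ((1 - Re z) / 2 * inverse (real (Suc n)))) \<longlonglongrightarrow> z" by simp
    have "\<And>n. z + of_real ((1 - Re z) / 2 * inverse (real (Suc n))) \<in> {z. F z = 0}"
    proof -
      fix n :: nat
      define d where "d = (1 - Re z) / 2 * inverse (real (Suc n))"
      have inv: "inverse (real (Suc n)) > 0" "inverse (real (Suc n)) \<le> 1"
        by (simp_all add: inverse_le_1_iff)
      have z: "0 \<le> Re z" "Re z < 1" using that by (auto simp: strip_def)
      have "0 < d" using z inv by (simp add: d_def)
      moreover have "d \<le> (1 - Re z) / 2 * 1"
        unfolding d_def using z inv by (intro mult_left_mono) auto
      ultimately have "z + of_real d \<in> ?S" using z by simp
      from zero[OF this] show "z + of_real ((1 - Re z) / 2 * inverse (real (Suc n))) \<in> {z. F z = 0}"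
        unfolding d_def by simp
    qed
    from closed_sequentially[OF closed this lim] show ?thesis by simp
  qed
  let ?k = "\<lfloor>Re z\<rfloor>"
  have "0 \<le> Re z - of_int ?k" "Re z - of_int ?k < 1" by linarith+
  then have "z - of_int ?k \<in> strip" by (simp add: strip_def)
  from zero'[OF this] show ?thesis
    using qp[unfolded quasi_periodic_def, rule_format, of "z - of_int ?k" ?k] by simp
qed

section \<open>The orthonormal basis\<close>

text \<open>For \<open>\<mu> = \<nu> + n\<close> these are the modes \<open>exp (pi * z\<^sup>2 / 2) * exp (2 * pi * \<i> * \<mu> * z)\<close> of a
  quasi-periodic entire function, scaled so that the squared modulus times the weight is a Gaussian
  in \<open>Im z + \<mu>\<close>.\<close>

definition gauss_exp :: "real \<Rightarrow> complex \<Rightarrow> complex" where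
  "gauss_exp \<mu> z = exp (of_real pi * z\<^sup>2 / 2 + 2 * of_real pi * \<i> * of_real \<mu> * z - of_real (pi * \<mu>\<^sup>2))"

lemma gauss_exp_holomorphic: "gauss_exp \<mu> holomorphic_on A"
  unfolding gauss_exp_def by (intro holomorphic_intros) auto

lemma continuous_gauss_exp [continuous_intros]: "continuous_on A (gauss_exp \<mu>)"
  by (rule holomorphic_on_imp_continuous_on[OF gauss_exp_holomorphic])

lemma cmod_square_Re_Im: "(cmod z)\<^sup>2 = Re z * Re z + Im z * Im z"
  using cmod_power2[of z] by (simp add: power2_eq_square)

text \<open>All inner products separate through this identity: the dependence on Re z is a character
  of the frequency difference, the rest lives in Im z.\<close>

lemma gauss_exp_mult_cnj:
  "gauss_exp \<mu> z * cnj (gauss_exp \<mu>' z) * of_real (exp (- pi * (cmod z)\<^sup>2)) =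
    exp (2 * of_real pi * \<i> * of_real (\<mu> - \<mu>') * of_real (Re z)) *
    of_real (exp (- pi * (Im z + \<mu>)\<^sup>2) * exp (- pi * (Im z + \<mu>')\<^sup>2))"
proof -
  have "gauss_exp \<mu> z * cnj (gauss_exp \<mu>' z) * of_real (exp (- pi * (cmod z)\<^sup>2)) =
     exp ((of_real pi * z\<^sup>2 / 2 + 2 * of_real pi * \<i> * of_real \<mu> * z - of_real (pi * \<mu>\<^sup>2)) +
       cnj (of_real pi * z\<^sup>2 / 2 + 2 * of_real pi * \<i> * of_real \<mu>' * z - of_real (pi * \<mu>'\<^sup>2)) +
       of_real (- pi * (cmod z)\<^sup>2))"
    unfolding gauss_exp_def exp_cnj exp_of_real[symmetric] exp_add[symmetric] ..
  also have "(of_real pi * z\<^sup>2 / 2 + 2 * of_real pi * \<i> * of_real \<mu> * z - of_real (pi * \<mu>\<^sup>2)) +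
       cnj (of_real pi * z\<^sup>2 / 2 + 2 * of_real pi * \<i> * of_real \<mu>' * z - of_real (pi * \<mu>'\<^sup>2)) +
       of_real (- pi * (cmod z)\<^sup>2) =
     2 * of_real pi * \<i> * of_real (\<mu> - \<mu>') * of_real (Re z) +
     of_real ((- pi * (Im z + \<mu>)\<^sup>2) + (- pi * (Im z + \<mu>')\<^sup>2))"
    by (simp only: cmod_square_Re_Im) (simp add: complex_eq_iff power2_eq_square algebra_simps)
  finally show ?thesis by (simp only: exp_add exp_of_real of_real_mult)
qed

lemma cmod_gauss_exp_square:
  "(cmod (gauss_exp \<mu> z))\<^sup>2 * exp (- pi * (cmod z)\<^sup>2) = gauss (Im z + \<mu>)"
proof -
  have "complex_of_real ((cmod (gauss_exp \<mu> z))\<^sup>2 * exp (- pi * (cmod z)\<^sup>2)) = of_real (gauss (Im z + \<mu>))"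
    using gauss_exp_mult_cnj[of \<mu> z \<mu>]
    by (simp add: complex_norm_square[symmetric] gauss_def flip: exp_add)
  then show ?thesis by (simp only: of_real_eq_iff)
qed

lemma cmod_gauss_exp: "cmod (gauss_exp \<mu> z) = exp (pi * (cmod z)\<^sup>2 / 2) * exp (- pi * (Im z + \<mu>)\<^sup>2)"
  unfolding gauss_exp_def norm_exp_eq_Re exp_add[symmetric]
  by (rule arg_cong[where f=exp]) (simp only: cmod_square_Re_Im, simp add: power2_eq_square field_simps)

lemma integrable_exp_abs_gauss:
  "integrable lborel (\<lambda>y. exp (b * \<bar>y + \<mu>\<bar>) * gauss (y + \<mu>))"
proof -
  have "integrable lborel (\<lambda>y. exp (b * \<bar>y\<bar>) * gauss y)"
  proof (rule Bochner_Integration.integrable_bound)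
    show "integrable lborel (\<lambda>t. exp (b\<^sup>2 / (4 * pi)) * exp (- pi * t\<^sup>2))"
      by (intro integrable_mult_right gaussian_integral) simp
    show "AE y in lborel. norm (exp (b * \<bar>y\<bar>) * gauss y) \<le> norm (exp (b\<^sup>2 / (4 * pi)) * exp (- pi * y\<^sup>2))"
      using exp_gauss_bound[of b] by (intro AE_I2) (simp add: gauss_def)
    show "(\<lambda>y. exp (b * \<bar>y\<bar>) * gauss y) \<in> borel_measurable lborel"
      unfolding gauss_def by measurable
  qed
  from lborel_integrable_real_affine[OF this, of 1 \<mu>] show ?thesis by (simp add: add.commute)
qed

text \<open>The factor with \<open>b\<close> leaves room for exponential growth in Im z, so that one
  majorant covers polynomials as well as the partial sums of exponential series.\<close>

lemma integrable_exp_abs_gauss_exp: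
  "integrable MS (\<lambda>z. (exp (b * \<bar>Im z + \<mu>\<bar>) * cmod (gauss_exp \<mu> z))\<^sup>2)"
proof -
  have [measurable]: "gauss_exp \<mu> \<in> borel_measurable borel"
    by (intro borel_measurable_continuous_onI continuous_gauss_exp)
  have int: "integrable lborel (\<lambda>z. complex_of_real (indicator {0..<1} (Re z) *\<^sub>R 1) *
      complex_of_real (exp (2 * b * \<bar>Im z + \<mu>\<bar>) * gauss (Im z + \<mu>)))"
  proof (rule integral_complex_product(1))
    show "integrable lborel (\<lambda>x::real. complex_of_real (indicator {0..<1} x *\<^sub>R 1))"
      by (rule integrable_of_real, rule integrable_indicator_01[where g="\<lambda>_. 1 :: real"]) simp
    show "integrable lborel (\<lambda>y. complex_of_real (exp (2 * b * \<bar>y + \<mu>\<bar>) * gauss (y + \<mu>)))"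
      by (intro integrable_of_real integrable_exp_abs_gauss)
  qed
  have eq: "Re (complex_of_real (indicator {0..<1} (Re z) *\<^sub>R 1) *
      complex_of_real (exp (2 * b * \<bar>Im z + \<mu>\<bar>) * gauss (Im z + \<mu>)))
      = weight z *\<^sub>R (exp (b * \<bar>Im z + \<mu>\<bar>) * cmod (gauss_exp \<mu> z))\<^sup>2" for z
  proof -
    have "exp (2 * b * \<bar>Im z + \<mu>\<bar>) = (exp (b * \<bar>Im z + \<mu>\<bar>))\<^sup>2"
      by (simp add: power2_eq_square flip: exp_add)
    then show ?thesis
      unfolding cmod_gauss_exp_square[of \<mu> z, symmetric]
      by (auto simp: weight_def strip_def indicator_def power_mult_distrib)
  qed
  from integrable_Re[OF int] have "integrable lborel (\<lambda>z. weight z *\<^sub>R (exp (b * \<bar>Im z + \<mu>\<bar>) * cmod (gauss_exp \<mu> z))\<^sup>2)"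
    unfolding eq .
  then show ?thesis by (subst integral_MS_borel) auto
qed

lemma sq_int_exp_gauss_exp:
  assumes "continuous_on UNIV f" "\<And>t. cmod (f t) \<le> C * exp (b * \<bar>t\<bar>)"
  shows "sq_int MS (\<lambda>z. f (Im z + \<mu>) * gauss_exp \<mu> z)"
proof (rule sq_int_bound)
  show "integrable MS (\<lambda>z. C\<^sup>2 * (exp (b * \<bar>Im z + \<mu>\<bar>) * cmod (gauss_exp \<mu> z))\<^sup>2)"
    by (intro integrable_mult_right integrable_exp_abs_gauss_exp)
  show "(\<lambda>z. f (Im z + \<mu>) * gauss_exp \<mu> z) \<in> borel_measurable MS"
    by (intro borel_measurable_MS_if_continuous continuous_intros continuous_on_compose2[OF assms(1)]) auto
  have "(cmod (f (Im z + \<mu>) * gauss_exp \<mu> z))\<^sup>2 \<le> C\<^sup>2 * (exp (b * \<bar>Im z + \<mu>\<bar>) * cmod (gauss_exp \<mu> z))\<^sup>2" for z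
  proof -
    have "cmod (f (Im z + \<mu>)) * cmod (gauss_exp \<mu> z) \<le> (C * exp (b * \<bar>Im z + \<mu>\<bar>)) * cmod (gauss_exp \<mu> z)"
      by (intro mult_right_mono assms) simp
    then have "(cmod (f (Im z + \<mu>) * gauss_exp \<mu> z))\<^sup>2 \<le> ((C * exp (b * \<bar>Im z + \<mu>\<bar>)) * cmod (gauss_exp \<mu> z))\<^sup>2"
      unfolding norm_mult by (intro power_mono) auto
    then show ?thesis by (simp add: power_mult_distrib)
  qed
  then show "AE z in MS. (cmod (f (Im z + \<mu>) * gauss_exp \<mu> z))\<^sup>2 \<le> C\<^sup>2 * (exp (b * \<bar>Im z + \<mu>\<bar>) * cmod (gauss_exp \<mu> z))\<^sup>2"
    by simp
qed

lemma poly_real_exp_bound: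
  obtains C where "C \<ge> 0" "\<And>t::real. cmod (poly P (of_real t)) \<le> C * exp (1 * \<bar>t\<bar>)"
  using poly_exp_bound[of 1 P] by (metis norm_of_real zero_less_one)

lemma sq_int_poly_gauss_exp: "sq_int MS (\<lambda>z. poly P (of_real (Im z + \<mu>)) * gauss_exp \<mu> z)"
proof -
  obtain C where C: "\<And>t::real. cmod (poly P (of_real t)) \<le> C * exp (1 * \<bar>t\<bar>)"
    by (rule poly_real_exp_bound) blast
  show ?thesis
    by (rule sq_int_exp_gauss_exp[OF _ C]) (intro continuous_intros)
qed

lemma integral_exp_01:
  "(\<integral>x. indicator {0..<1} x *\<^sub>R exp (2 * of_real pi * \<i> * of_int k * of_real x) \<partial>lborel)
    = (of_bool (k = 0) :: complex)"
proof -
  have "(\<integral>x. indicator {0..<1} x *\<^sub>R exp (2 * of_real pi * \<i> * of_int k * of_real x) \<partial>lborel)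
    = (\<integral>x. indicator {0..1} x *\<^sub>R exp (2 * of_real pi * \<i> * of_int k * complex_of_real x) \<partial>lborel)"
  proof (rule integral_cong_AE)
    have "AE x in lborel. x \<noteq> (1::real)" by (rule AE_lborel_singleton)
    then show "AE x in lborel. indicator {0..<1} x *\<^sub>R exp (2 * of_real pi * \<i> * of_int k * complex_of_real x)
        = indicator {0..1} x *\<^sub>R exp (2 * of_real pi * \<i> * of_int k * complex_of_real x)"
      by eventually_elim (auto simp: indicator_def)
  qed measurable
  also have "\<dots> = of_bool (k = 0)"
  proof (cases "k = 0")
    case False
    let ?c = "2 * of_real pi * \<i> * of_int k :: complex"
    have c: "?c \<noteq> 0" using False by simp
    have "(\<integral>x. indicator {0..1} x *\<^sub>R exp (?c * complex_of_real x) \<partial>lborel)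
        = exp (?c * complex_of_real 1) / ?c - exp (?c * complex_of_real 0) / ?c"
    proof (rule integral_FTC_atLeastAtMost)
      fix x :: real
      have "((\<lambda>z. exp (?c * z) / ?c) has_field_derivative exp (?c * z)) (at z)" for z
        using c by (auto intro!: derivative_eq_intros)
      from has_vector_derivative_real_field[OF this]
      show "((\<lambda>x. exp (?c * complex_of_real x) / ?c) has_vector_derivative exp (?c * complex_of_real x)) (at x within {0..1})" .
    qed (auto intro!: continuous_intros)
    moreover have "exp (?c * complex_of_real 1) = 1"
      using exp_integer_2pi[of "of_int k"] by (simp add: mult_ac)
    ultimately show ?thesis using False by simp
  qed simp
  finally show ?thesis .
qed

text \<open>The horizontal integral over a period annihilates distinct frequencies; for equal ones
  the vertical integral is translated to the common centre of the Gaussians.\<close>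

lemma ip_gauss_exp:
  fixes f g :: "real \<Rightarrow> complex"
  assumes f: "continuous_on UNIV f" "\<And>t. cmod (f t) \<le> Cf * exp (bf * \<bar>t\<bar>)"
    and g: "continuous_on UNIV g" "\<And>t. cmod (g t) \<le> Cg * exp (bg * \<bar>t\<bar>)"
    and k: "\<mu> - \<mu>' = of_int k"
  shows "ip MS (\<lambda>z. f (Im z + \<mu>) * gauss_exp \<mu> z) (\<lambda>z. g (Im z + \<mu>') * gauss_exp \<mu>' z) =
    of_bool (k = 0) * (\<integral>t. f t * cnj (g t) * of_real (gauss t) \<partial>lborel)"
proof -
  let ?F = "\<lambda>z. f (Im z + \<mu>) * gauss_exp \<mu> z" and ?G = "\<lambda>z. g (Im z + \<mu>') * gauss_exp \<mu>' z"
  let ?h = "\<lambda>y. f (y + \<mu>) * cnj (g (y + \<mu>')) * of_real (exp (- pi * (y + \<mu>)\<^sup>2) * exp (- pi * (y + \<mu>')\<^sup>2))"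
  let ?e = "\<lambda>x. indicator {0..<1} x *\<^sub>R exp (2 * of_real pi * \<i> * of_int k * complex_of_real x)"
  have int: "integrable MS (\<lambda>z. ?F z * cnj (?G z))"
    by (intro ip_integrable sq_int_exp_gauss_exp[OF f] sq_int_exp_gauss_exp[OF g])
  have [measurable]: "f \<in> borel_measurable borel" "g \<in> borel_measurable borel" "gauss_exp \<mu> \<in> borel_measurable borel"
    "gauss_exp \<mu>' \<in> borel_measurable borel"
    using f g by (auto intro!: borel_measurable_continuous_onI continuous_gauss_exp)
  have [measurable]: "cnj \<in> borel_measurable borel"
    by (intro borel_measurable_continuous_onI continuous_intros)
  have meas: "(\<lambda>z. ?F z * cnj (?G z)) \<in> borel_measurable borel" by measurable
  have eq: "weight z *\<^sub>R (?F z * cnj (?G z)) = ?e (Re z) * ?h (Im z)" for z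
  proof -
    have "weight z *\<^sub>R (?F z * cnj (?G z)) = indicator {0..<1} (Re z) *\<^sub>R
      (f (Im z + \<mu>) * cnj (g (Im z + \<mu>')) * (gauss_exp \<mu> z * cnj (gauss_exp \<mu>' z) * of_real (exp (- pi * (cmod z)\<^sup>2))))"
      by (auto simp: weight_def strip_def indicator_def scaleR_conv_of_real)
    then show ?thesis
      unfolding gauss_exp_mult_cnj k by (simp add: mult_ac scaleR_conv_of_real)
  qed
  have "ip MS ?F ?G = (\<integral>z. ?e (Re z) * ?h (Im z) \<partial>lborel)"
    unfolding ip_def integral_MS_borel[OF meas] eq ..
  also have "\<dots> = (\<integral>y. (\<integral>x. ?e (Re (Complex x y)) * ?h (Im (Complex x y)) \<partial>lborel) \<partial>lborel)"
    using int unfolding integral_MS_borel[OF meas] eq by (rule integral_complex_iterated)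
  also have "\<dots> = (\<integral>y. of_bool (k = 0) * ?h y \<partial>lborel)"
    unfolding complex.sel integral_mult_left_zero integral_exp_01 ..
  also have "\<dots> = of_bool (k = 0) * (\<integral>y. ?h y \<partial>lborel)"
    by (rule integral_mult_right_zero)
  also have "\<dots> = of_bool (k = 0) * (\<integral>t. f t * cnj (g t) * of_real (gauss t) \<partial>lborel)"
  proof (cases "k = 0")
    case True
    then have \<mu>: "\<mu>' = \<mu>" using k by simp
    have h: "?h y = f (\<mu> + 1 * y) * cnj (g (\<mu> + 1 * y)) * of_real (gauss (\<mu> + 1 * y))" for y
      unfolding \<mu> by (simp add: gauss_def add.commute flip: exp_add of_real_mult)
    have "(\<integral>y. ?h y \<partial>lborel) = (\<integral>t. f t * cnj (g t) * of_real (gauss t) \<partial>lborel)"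
      unfolding h
      using lborel_integral_real_affine[of 1 "\<lambda>t. f t * cnj (g t) * of_real (gauss t)" \<mu>] by simp
    then show ?thesis by simp
  qed simp
  finally show ?thesis .
qed

lemma cnj_poly_herm: "cnj (poly (herm r) (of_real t)) = poly (herm r) (of_real t)"
proof -
  have "coeff (herm r) n \<in> \<real>" for n
  proof (induction r arbitrary: n)
    case (Suc r)
    show ?case using Suc
      by (cases n) (auto simp: coeff_pderiv intro!: Reals_mult Reals_diff Reals_minus)
  qed (auto simp: one_pCons coeff_pCons split: nat.split)
  from poly_cnj_real[OF this, of "of_real t"] show ?thesis by simp
qed

text \<open>The square is the inverse of \<open>gauss_int 0 (herm r * herm r)\<close>.\<close>

definition herm_scale :: "nat \<Rightarrow> real" where
  "herm_scale r = sqrt (sqrt 2 / (pi ^ r * fact r))"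

lemma herm_scale_pos: "herm_scale r > 0"
  by (simp add: herm_scale_def)

lemma herm_scale_square: "(herm_scale r)\<^sup>2 * (pi ^ r * fact r / sqrt 2) = 1"
  by (simp add: herm_scale_def)

definition bas :: "real \<Rightarrow> nat \<Rightarrow> int \<Rightarrow> complex \<Rightarrow> complex" where
  "bas \<nu> r n z = of_real (herm_scale r) *
    (poly (herm r) (of_real (Im z + (\<nu> + of_int n))) * gauss_exp (\<nu> + of_int n) z)"

lemma sq_int_bas: "sq_int MS (bas \<nu> r n)"
  unfolding bas_def by (intro sq_int_scale sq_int_poly_gauss_exp)

lemma continuous_bas [continuous_intros]: "continuous_on A (bas \<nu> r n)"
  unfolding bas_def by (intro continuous_intros)

lemma ip_poly_gauss_exp:
  "ip MS (\<lambda>z. poly P (of_real (Im z + (\<nu> + of_int m))) * gauss_exp (\<nu> + of_int m) z)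
     (\<lambda>z. poly (herm s) (of_real (Im z + (\<nu> + of_int n))) * gauss_exp (\<nu> + of_int n) z) =
   of_bool (m = n) * gauss_int 0 (herm s * P)"
proof -
  obtain C where C: "\<And>t::real. cmod (poly P (of_real t)) \<le> C * exp (1 * \<bar>t\<bar>)"
    by (rule poly_real_exp_bound) blast
  obtain D where D: "\<And>t::real. cmod (poly (herm s) (of_real t)) \<le> D * exp (1 * \<bar>t\<bar>)"
    by (rule poly_real_exp_bound) blast
  have "ip MS (\<lambda>z. poly P (of_real (Im z + (\<nu> + of_int m))) * gauss_exp (\<nu> + of_int m) z)
     (\<lambda>z. poly (herm s) (of_real (Im z + (\<nu> + of_int n))) * gauss_exp (\<nu> + of_int n) z) =
    of_bool (m - n = 0) * (\<integral>t. poly P (of_real t) * cnj (poly (herm s) (of_real t)) * of_real (gauss t) \<partial>lborel)"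
    by (rule ip_gauss_exp[OF _ C _ D]) (auto intro!: continuous_intros)
  then show ?thesis by (simp add: gauss_int_def cnj_poly_herm mult_ac)
qed

lemma ip_bas: "ip MS (bas \<nu> r m) (bas \<nu> s n) = of_bool (r = s \<and> m = n)"
proof -
  have "of_real (herm_scale r) * (of_real (herm_scale r) * complex_of_real (pi ^ r * fact r / sqrt 2)) = 1"
    unfolding of_real_mult[symmetric] mult.assoc[symmetric] power2_eq_square[symmetric] herm_scale_square by simp
  then show ?thesis
    unfolding bas_def ip_scale_left ip_scale_right ip_poly_gauss_exp gauss_int_herm_herm by auto
qed

lemma summable_exp_int: "(\<lambda>n::int. exp (- \<bar>real_of_int n\<bar>)) summable_on UNIV"
proof -
  have nat: "(\<lambda>n::nat. exp (- real n)) summable_on UNIV"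
  proof -
    have "summable (\<lambda>n. exp (- 1 :: real) ^ n)" by (intro summable_geometric) simp
    then have "summable (\<lambda>n. exp (- real n))" by (simp flip: exp_of_nat_mult)
    then show ?thesis by (intro summable_nonneg_imp_summable_on) auto
  qed
  have "(\<lambda>n::int. exp (- \<bar>real_of_int n\<bar>)) summable_on range int"
    by (subst summable_on_reindex) (auto simp: o_def nat)
  moreover have "(\<lambda>n::int. exp (- \<bar>real_of_int n\<bar>)) summable_on range (\<lambda>n. - int n)"
    by (subst summable_on_reindex) (auto simp: o_def nat inj_on_def)
  ultimately have "(\<lambda>n::int. exp (- \<bar>real_of_int n\<bar>)) summable_on range int \<union> range (\<lambda>n. - int n)"
    by (rule summable_on_union)
  also have "range int \<union> range (\<lambda>n. - int n) = UNIV"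
    by (auto simp: image_iff) (metis int_cases2)
  finally show ?thesis .
qed

text \<open>One majorant for all frequencies, locally uniform in \<open>z\<close>: it yields
  absolute convergence at each point here and uniform convergence on discs later.\<close>

lemma bas_bound:
  obtains C where "C \<ge> 0"
    "\<And>n z. cmod (bas \<nu> r n z) \<le> C * exp (pi * (cmod z)\<^sup>2 / 2 + \<bar>Im z\<bar>) * exp (- \<bar>real_of_int n\<bar>)"
proof -
  obtain D where D: "D \<ge> 0" "\<And>t::real. cmod (poly (herm r) (of_real t)) \<le> D * exp (1 * \<bar>t\<bar>)"
    by (rule poly_real_exp_bound) blast
  have "cmod (bas \<nu> r n z) \<le> (herm_scale r * D * exp (1 / pi + \<bar>\<nu>\<bar>)) *
      exp (pi * (cmod z)\<^sup>2 / 2 + \<bar>Im z\<bar>) * exp (- \<bar>real_of_int n\<bar>)" for n z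
  proof -
    define t where "t = Im z + (\<nu> + of_int n)"
    \<comment> \<open>Completing the square makes the Gaussian pay for
      \<open>2 * \<bar>t\<bar>\<close>: one half cancels the growth of the polynomial, the other
      becomes the decay in \<open>n\<close>.\<close>
    have "0 \<le> (pi * \<bar>t\<bar> - 1)\<^sup>2 / pi" by simp
    also have "\<dots> = pi * t\<^sup>2 - 2 * \<bar>t\<bar> + 1 / pi"
      by (simp add: power2_eq_square field_simps)
    finally have "1 * \<bar>t\<bar> + - pi * t\<^sup>2 \<le> 1 / pi - \<bar>t\<bar>" by simp
    also have "\<dots> \<le> 1 / pi + \<bar>\<nu>\<bar> + \<bar>Im z\<bar> - \<bar>real_of_int n\<bar>"
      unfolding t_def by linarith
    finally have 1: "exp (1 * \<bar>t\<bar>) * exp (- pi * t\<^sup>2) \<le> exp (1 / pi + \<bar>\<nu>\<bar> + \<bar>Im z\<bar> - \<bar>real_of_int n\<bar>)"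
      by (simp flip: exp_add)
    have "cmod (bas \<nu> r n z) = herm_scale r * (cmod (poly (herm r) (of_real t)) *
        (exp (pi * (cmod z)\<^sup>2 / 2) * exp (- pi * t\<^sup>2)))"
      using herm_scale_pos[of r] by (simp add: bas_def norm_mult cmod_gauss_exp t_def)
    also have "\<dots> \<le> herm_scale r * ((D * exp (1 * \<bar>t\<bar>)) * (exp (pi * (cmod z)\<^sup>2 / 2) * exp (- pi * t\<^sup>2)))"
      using herm_scale_pos[of r] by (intro mult_left_mono mult_right_mono D) auto
    also have "\<dots> = (herm_scale r * D * exp (pi * (cmod z)\<^sup>2 / 2)) * (exp (1 * \<bar>t\<bar>) * exp (- pi * t\<^sup>2))"
      by (simp add: mult_ac)
    also have "\<dots> \<le> (herm_scale r * D * exp (pi * (cmod z)\<^sup>2 / 2)) *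
        exp (1 / pi + \<bar>\<nu>\<bar> + \<bar>Im z\<bar> - \<bar>real_of_int n\<bar>)"
      using herm_scale_pos[of r] D by (intro mult_left_mono 1) auto
    also have "\<dots> = (herm_scale r * D * exp (1 / pi + \<bar>\<nu>\<bar>)) *
      exp (pi * (cmod z)\<^sup>2 / 2 + \<bar>Im z\<bar>) * exp (- \<bar>real_of_int n\<bar>)"
      unfolding mult.assoc exp_add[symmetric] by (simp add: algebra_simps)
    finally show ?thesis .
  qed
  then show ?thesis
    using that[of "herm_scale r * D * exp (1 / pi + \<bar>\<nu>\<bar>)"] D herm_scale_pos[of r] by simp
qed

interpretation bas: orthonormal_seq MS "bas \<nu> r" for \<nu> r
proof
  show "sq_int MS (bas \<nu> r n)" for n by (rule sq_int_bas)
  show "ip MS (bas \<nu> r m) (bas \<nu> r n) = of_bool (m = n)" for m n by (simp add: ip_bas)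
  fix z :: complex
  obtain C where C: "C \<ge> 0"
    "\<And>n z. cmod (bas \<nu> r n z) \<le> C * exp (pi * (cmod z)\<^sup>2 / 2 + \<bar>Im z\<bar>) * exp (- \<bar>real_of_int n\<bar>)"
    using bas_bound[of \<nu> r] by blast
  show "(\<lambda>n. cmod (bas \<nu> r n z)) summable_on UNIV"
    by (rule summable_on_comparison_test[OF summable_on_cmult_right[OF summable_exp_int] C(2)]) auto
qed

lemma quasi_periodic_bas: "quasi_periodic \<nu> (bas \<nu> r n)"
  unfolding quasi_periodic_def
proof (intro allI)
  fix z :: complex and k :: int
  let ?\<mu> = "\<nu> + of_int n"
  have "gauss_exp ?\<mu> (z + of_int k) = exp ((2 * of_real pi * \<i> * of_int k * of_real \<nu>) +
      (of_real pi * of_int k * z + of_real pi / 2 * (of_int k)\<^sup>2) +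
      (of_real pi * z\<^sup>2 / 2 + 2 * of_real pi * \<i> * of_real ?\<mu> * z - of_real (pi * ?\<mu>\<^sup>2)) +
      (2 * of_int (n * k) * of_real pi) * \<i>)"
    unfolding gauss_exp_def by (rule arg_cong[where f=exp]) (simp add: power2_eq_square field_simps)
  also have "\<dots> = exp (2 * of_real pi * \<i> * of_int k * of_real \<nu>) *
        exp (of_real pi * of_int k * z + of_real pi / 2 * (of_int k)\<^sup>2) * gauss_exp ?\<mu> z"
  proof -
    have "exp ((2 * of_int (n * k) * of_real pi) * \<i>) = 1" 
      using exp_integer_2pi[of "of_int (n * k)"] by (simp add: mult_ac)
    then show ?thesis unfolding gauss_exp_def exp_add by (simp only: mult_1_right)
  qed
  finally have "gauss_exp ?\<mu> (z + of_int k) = exp (2 * of_real pi * \<i> * of_int k * of_real \<nu>) *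
        exp (of_real pi * of_int k * z + of_real pi / 2 * (of_int k)\<^sup>2) * gauss_exp ?\<mu> z" .
  then show "bas \<nu> r n (z + of_int k) = exp (2 * of_real pi * \<i> * of_int k * of_real \<nu>) *
        exp (of_real pi * of_int k * z + of_real pi / 2 * (of_int k)\<^sup>2) * bas \<nu> r n z"
    by (simp add: bas_def)
qed

lemma quasi_periodic_ssum: "quasi_periodic \<nu> (bas.ssum \<nu> r c)"
  unfolding quasi_periodic_def bas.ssum_def
proof (intro allI)
  fix z :: complex and k :: int
  let ?a = "exp (2 * of_real pi * \<i> * of_int k * of_real \<nu>) *
        exp (of_real pi * of_int k * z + of_real pi / 2 * (of_int k)\<^sup>2)"
  have "c n * bas \<nu> r n (z + of_int k) = ?a * (c n * bas \<nu> r n z)" for n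
    using quasi_periodic_bas[of \<nu> r n] by (simp add: quasi_periodic_def)
  then show "(\<Sum>\<^sub>\<infinity>n. c n * bas \<nu> r n (z + of_int k)) = ?a * (\<Sum>\<^sub>\<infinity>n. c n * bas \<nu> r n z)"
    by (simp only: infsum_cmult_right')
qed

lemma ip_ssum_ssum:
  assumes "r \<noteq> s" "ell2 c" "ell2 d"
  shows "ip MS (bas.ssum \<nu> r c) (bas.ssum \<nu> s d) = 0"
proof (rule bas.ssum_orthogonal[OF assms(2) bas.ssum_approx(1)[OF assms(3)]])
  fix n
  have "ip MS (bas.ssum \<nu> s d) (bas \<nu> r n) = 0"
    by (rule bas.ssum_orthogonal[OF assms(3) sq_int_bas]) (use assms(1) in \<open>simp add: ip_bas\<close>)
  then show "ip MS (bas \<nu> r n) (bas.ssum \<nu> s d) = 0" by (subst ip_commute) simp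
qed

lemma ssum_L2_qp: "ell2 c \<Longrightarrow> bas.ssum \<nu> r c \<in> L2_qp \<nu>"
  by (simp add: L2_qp_iff bas.ssum_approx quasi_periodic_ssum)

section \<open>Completeness of the basis\<close>

lemma (in orthonormal_seq) proj_add:
  assumes "sq_int M f" "sq_int M g" "x \<in> space M"
  shows "proj (\<lambda>x. f x + g x) x = proj f x + proj g x"
  unfolding proj_def by (simp add: ip_add_left assms sq_int_e ssum_add ell2_coeffs)

lemma (in orthonormal_seq) proj_scale: "proj (\<lambda>x. a * f x) x = a * proj f x"
  unfolding proj_def ip_scale_left ssum_scale ..

definition levels :: "real \<Rightarrow> nat \<Rightarrow> (complex \<Rightarrow> complex) \<Rightarrow> complex \<Rightarrow> complex" where
  "levels \<nu> m F z = (\<Sum>r<m. bas.proj \<nu> r F z)"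

lemma sq_int_levels: "sq_int MS F \<Longrightarrow> sq_int MS (levels \<nu> m F)"
  unfolding levels_def by (intro sq_int_sum bas.sq_int_proj)

lemma levels_add:
  "sq_int MS F \<Longrightarrow> sq_int MS G \<Longrightarrow> levels \<nu> m (\<lambda>z. F z + G z) z = levels \<nu> m F z + levels \<nu> m G z"
  by (simp add: levels_def bas.proj_add sum.distrib)

lemma levels_scale: "levels \<nu> m (\<lambda>z. a * F z) z = a * levels \<nu> m F z"
  by (simp add: levels_def bas.proj_scale sum_distrib_left)

lemma ip_ssum_minus_levels:
  assumes F: "sq_int MS F" and c: "ell2 c" and r: "r < m"
  shows "ip MS (bas.ssum \<nu> r c) (\<lambda>z. F z - levels \<nu> m F z) = 0"
proof -
  have s: "sq_int MS (bas.ssum \<nu> r c)" by (rule bas.ssum_approx(1)[OF c])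
  have "ip MS (bas.ssum \<nu> r c) (levels \<nu> m F) = (\<Sum>s<m. ip MS (bas.ssum \<nu> r c) (bas.proj \<nu> s F))"
    unfolding levels_def by (rule ip_sum_right) (auto intro: bas.sq_int_proj F s)
  also have "\<dots> = (\<Sum>s<m. if r = s then ip MS (bas.ssum \<nu> r c) (bas.proj \<nu> r F) else 0)"
    by (intro sum.cong refl) (auto simp: bas.proj_def intro!: ip_ssum_ssum c bas.ell2_coeffs F)
  also have "\<dots> = ip MS (bas.ssum \<nu> r c) F"
    using r by (simp add: bas.ip_ssum_proj[OF F c])
  finally show ?thesis by (simp add: ip_diff_right F s sq_int_levels)
qed

text \<open>The residual is orthogonal to the projection, so passing to it does not increase the
  norm. This makes the notion \<open>resolved\<close> closed under limits in norm.\<close>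

lemma nrm_minus_levels_le:
  assumes "sq_int MS F"
  shows "nrm MS (\<lambda>z. F z - levels \<nu> m F z) \<le> nrm MS F"
proof -
  let ?R = "\<lambda>z. F z - levels \<nu> m F z"
  have R: "sq_int MS ?R" by (intro sq_int_diff sq_int_levels assms)
  have "ip MS (levels \<nu> m F) ?R = (\<Sum>r<m. ip MS (bas.proj \<nu> r F) ?R)"
    unfolding levels_def[abs_def] by (intro ip_sum_left bas.sq_int_proj assms R[unfolded levels_def])
  also have "\<dots> = 0"
    by (intro sum.neutral ballI) (simp add: bas.proj_def ip_ssum_minus_levels assms bas.ell2_coeffs)
  finally have orth: "ip MS (levels \<nu> m F) ?R = 0" .
  have "(nrm MS F)\<^sup>2 = (nrm MS (levels \<nu> m F))\<^sup>2 + (nrm MS ?R)\<^sup>2"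
    using pythagoras[OF sq_int_levels[OF assms] R orth] by simp
  then have "(nrm MS ?R)\<^sup>2 \<le> (nrm MS F)\<^sup>2" by simp
  then show ?thesis by (rule power2_le_imp_le) simp
qed

text \<open>Membership in the closed span of all levels, phrased through the residuals of the
  projections, so that it already has the form of the Hilbert sum decomposition.\<close>

definition resolved :: "real \<Rightarrow> (complex \<Rightarrow> complex) \<Rightarrow> bool" where
  "resolved \<nu> F \<longleftrightarrow> sq_int MS F \<and> (\<lambda>m. nrm MS (\<lambda>z. F z - levels \<nu> m F z)) \<longlonglongrightarrow> 0"

lemma resolved_add:
  assumes "resolved \<nu> F" "resolved \<nu> G"
  shows "resolved \<nu> (\<lambda>z. F z + G z)"
proof -
  have F: "sq_int MS F" and G: "sq_int MS G" using assms by (auto simp: resolved_def)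
  have "(\<lambda>m. nrm MS (\<lambda>z. F z + G z - levels \<nu> m (\<lambda>z. F z + G z) z)) \<longlonglongrightarrow> 0"
  proof (rule tendsto_sandwich[of "\<lambda>_. 0"])
    show "(\<lambda>m. nrm MS (\<lambda>z. F z - levels \<nu> m F z) + nrm MS (\<lambda>z. G z - levels \<nu> m G z)) \<longlonglongrightarrow> 0"
      using assms unfolding resolved_def by (intro tendsto_add_zero) auto
    have "nrm MS (\<lambda>z. F z + G z - levels \<nu> m (\<lambda>z. F z + G z) z) \<le>
      nrm MS (\<lambda>z. F z - levels \<nu> m F z) + nrm MS (\<lambda>z. G z - levels \<nu> m G z)" for m
      using nrm_triangle[OF sq_int_diff[OF F sq_int_levels[OF F, of \<nu> m]]
          sq_int_diff[OF G sq_int_levels[OF G, of \<nu> m]]]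
      by (simp add: levels_add F G add_diff_add)
    then show "\<forall>\<^sub>F m in sequentially. nrm MS (\<lambda>z. F z + G z - levels \<nu> m (\<lambda>z. F z + G z) z) \<le>
      nrm MS (\<lambda>z. F z - levels \<nu> m F z) + nrm MS (\<lambda>z. G z - levels \<nu> m G z)" by simp
  qed auto
  then show ?thesis using F G by (simp add: resolved_def sq_int_add)
qed

lemma resolved_scale:
  assumes "resolved \<nu> F"
  shows "resolved \<nu> (\<lambda>z. a * F z)"
proof -
  have "(\<lambda>m. cmod a * nrm MS (\<lambda>z. F z - levels \<nu> m F z)) \<longlonglongrightarrow> 0"
    using assms unfolding resolved_def by (intro tendsto_mult_right_zero) auto
  then have "(\<lambda>m. nrm MS (\<lambda>z. a * (F z - levels \<nu> m F z))) \<longlonglongrightarrow> 0"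
    by (simp add: nrm_scale)
  then show ?thesis
    using assms by (simp add: resolved_def sq_int_scale levels_scale right_diff_distrib)
qed

text \<open>The residual of the limit splits into the residual of the difference, which is at most
  its norm, and the residual of one approximant.\<close>

lemma resolved_limit:
  fixes F :: "nat \<Rightarrow> complex \<Rightarrow> complex"
  assumes F: "\<And>i. resolved \<nu> (F i)" and G: "sq_int MS G"
    and lim: "(\<lambda>i. nrm MS (\<lambda>z. G z - F i z)) \<longlonglongrightarrow> 0"
  shows "resolved \<nu> G"
  unfolding resolved_def
proof
  have sF: "sq_int MS (F i)" for i using F by (auto simp: resolved_def)
  show "(\<lambda>m. nrm MS (\<lambda>z. G z - levels \<nu> m G z)) \<longlonglongrightarrow> 0"
  proof (rule LIMSEQ_I)
    fix \<epsilon> :: real assume e: "0 < \<epsilon>"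
    obtain i where i: "nrm MS (\<lambda>z. G z - F i z) < \<epsilon> / 2"
      using LIMSEQ_D[OF lim, of "\<epsilon> / 2"] e by auto
    obtain m0 where m0: "\<And>m. m \<ge> m0 \<Longrightarrow> nrm MS (\<lambda>z. F i z - levels \<nu> m (F i) z) < \<epsilon> / 2"
      using LIMSEQ_D[OF conjunct2[OF F[of i, unfolded resolved_def]], of "\<epsilon> / 2"] e by auto
    have "norm (nrm MS (\<lambda>z. G z - levels \<nu> m G z) - 0) < \<epsilon>" if "m \<ge> m0" for m
    proof -
      let ?D = "\<lambda>z. G z + (-1) * F i z"
      have D: "sq_int MS ?D" by (intro sq_int_add sq_int_scale G sF)
      have "nrm MS (\<lambda>z. G z - levels \<nu> m G z) =
          nrm MS (\<lambda>z. (?D z - levels \<nu> m ?D z) + (F i z - levels \<nu> m (F i) z))"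
        by (simp only: levels_add[OF G sq_int_scale[OF sF]] levels_scale) (simp add: algebra_simps)
      also have "\<dots> \<le> nrm MS (\<lambda>z. ?D z - levels \<nu> m ?D z) + nrm MS (\<lambda>z. F i z - levels \<nu> m (F i) z)"
        by (intro nrm_triangle sq_int_diff D sq_int_levels sF)
      also have "nrm MS (\<lambda>z. ?D z - levels \<nu> m ?D z) \<le> nrm MS ?D"
        by (rule nrm_minus_levels_le[OF D])
      finally show ?thesis using i m0[OF that] by simp
    qed
    then show "\<exists>m0. \<forall>m\<ge>m0. norm (nrm MS (\<lambda>z. G z - levels \<nu> m G z) - 0) < \<epsilon>" by blast
  qed
qed (rule G)

text \<open>The closure principle behind each enlargement: Taylor sums, limits of trigonometric
  functions, simple functions.\<close>

lemma resolved_dominated: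
  fixes F :: "nat \<Rightarrow> complex \<Rightarrow> complex"
  assumes F: "\<And>i. resolved \<nu> (F i)" and G: "G \<in> borel_measurable MS"
    and D: "integrable MS (\<lambda>z. (D z)\<^sup>2)"
    and bound: "\<And>i z. z \<in> strip \<Longrightarrow> cmod (F i z) \<le> D z"
    and lim: "\<And>z. z \<in> strip \<Longrightarrow> (\<lambda>i. F i z) \<longlonglongrightarrow> G z"
  shows "resolved \<nu> G"
proof -
  have meas: "F i \<in> borel_measurable MS" for i using F[of i] by (auto simp: resolved_def)
  have 1: "AE z in MS. cmod (F i z) \<le> D z" for i
    using AE_MS_strip by eventually_elim (rule bound)
  have 2: "AE z in MS. (\<lambda>i. F i z) \<longlonglongrightarrow> G z"
    using AE_MS_strip by eventually_elim (rule lim)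
  show ?thesis
    using nrm_dominated_convergence(1,3)[OF meas G D 1 2] by (intro resolved_limit[OF F])
qed

lemma resolved_sum:
  "(\<And>i. i \<in> I \<Longrightarrow> resolved \<nu> (F i)) \<Longrightarrow> resolved \<nu> (\<lambda>z. \<Sum>i\<in>I. F i z)"
proof (induction I rule: infinite_finite_induct)
  case (insert i I)
  then show ?case using resolved_add[of \<nu> "F i" "\<lambda>z. \<Sum>i\<in>I. F i z"] by simp
qed (auto simp: resolved_def levels_def bas.proj_def bas.ssum_def nrm_def)

lemma resolved_bas: "resolved \<nu> (bas \<nu> r n)"
  unfolding resolved_def
proof
  have proj: "bas.proj \<nu> s (bas \<nu> r n) z = (if s = r then bas \<nu> r n z else 0)" for s z
  proof -
    have "bas.proj \<nu> s (bas \<nu> r n) z = (\<Sum>\<^sub>\<infinity>k. if k = n then (if s = r then bas \<nu> r n z else 0) else 0)"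
      unfolding bas.proj_def bas.ssum_def by (intro infsum_cong) (auto simp: ip_bas)
    also have "\<dots> = (\<Sum>\<^sub>\<infinity>k\<in>{n}. if s = r then bas \<nu> r n z else 0)"
      by (rule infsum_cong_neutral) auto
    finally show ?thesis by simp
  qed
  have "nrm MS (\<lambda>z. bas \<nu> r n z - levels \<nu> m (bas \<nu> r n) z) = 0" if "m \<ge> Suc r" for m
    using that by (simp add: levels_def proj nrm_def)
  then show "(\<lambda>m. nrm MS (\<lambda>z. bas \<nu> r n z - levels \<nu> m (bas \<nu> r n) z)) \<longlonglongrightarrow> 0"
    by (intro tendsto_eventually) (auto simp: eventually_sequentially)
qed (rule sq_int_bas)

lemma resolved_herm_gauss_exp:
  "resolved \<nu> (\<lambda>z. poly (herm r) (of_real (Im z + (\<nu> + of_int n))) * gauss_exp (\<nu> + of_int n) z)"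
proof -
  have "(\<lambda>z. poly (herm r) (of_real (Im z + (\<nu> + of_int n))) * gauss_exp (\<nu> + of_int n) z) =
      (\<lambda>z. inverse (of_real (herm_scale r)) * bas \<nu> r n z)"
    unfolding bas_def using herm_scale_pos[of r] by (simp add: fun_eq_iff flip: mult.assoc)
  then show ?thesis using resolved_scale[OF resolved_bas] by (simp only:)
qed

text \<open>The level \<open>r\<close> stays arbitrary in the induction, since one factor of the
  variable is traded for the levels \<open>r + 1\<close> and \<open>r - 1\<close> by the
  recurrence.\<close>

lemma resolved_power_gauss_exp:
  "resolved \<nu> (\<lambda>z. of_real (Im z + (\<nu> + of_int n)) ^ j *
     (poly (herm r) (of_real (Im z + (\<nu> + of_int n))) * gauss_exp (\<nu> + of_int n) z))"
proof (induction j arbitrary: r)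
  case 0
  then show ?case using resolved_herm_gauss_exp[of \<nu> r n] by simp
next
  case (Suc j)
  let ?t = "\<lambda>z. complex_of_real (Im z + (\<nu> + of_int n))"
  let ?b = "\<lambda>j r z. ?t z ^ j * (poly (herm r) (?t z) * gauss_exp (\<nu> + of_int n) z)"
  show ?case
  proof (cases r)
    case 0
    \<comment> \<open>The bottom level has no lower neighbour; there \<open>herm 1\<close> is 2 * pi
      times the variable.\<close>
    have "?b (Suc j) 0 = (\<lambda>z. inverse (2 * of_real pi) * ?b j 1 z)"
      by (auto simp: fun_eq_iff field_simps)
    moreover have "resolved \<nu> (\<lambda>z. inverse (2 * of_real pi) * ?b j 1 z)"
      by (rule resolved_scale[OF Suc[of 1]])
    ultimately show ?thesis by (simp only: 0)
  next
    case (Suc r')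
    have rec: "2 * of_real pi * (t * poly (herm r) t) =
        poly (herm (Suc r)) t + of_real pi * of_nat r * poly (herm r') t" for t
      using arg_cong[OF herm_recurrence[of r'], of "\<lambda>p. poly p t"] unfolding Suc
      by (simp add: mult_ac del: herm.simps of_nat_Suc)
    have t_herm: "t * poly (herm r) t = inverse (2 * of_real pi) *
        (poly (herm (Suc r)) t + of_real pi * of_nat r * poly (herm r') t)" for t
      unfolding rec[symmetric] by simp
    have alg: "a * ((k * (h + p * h')) * g) = k * (a * (h * g) + p * (a * (h' * g)))"
      for a k h p h' g :: complex by (simp add: algebra_simps)
    have "?b (Suc j) r z = inverse (2 * of_real pi) *
        (?b j (Suc r) z + (of_real pi * of_nat r) * ?b j r' z)" for z
    proof -
      have "?b (Suc j) r z = ?t z ^ j * ((?t z * poly (herm r) (?t z)) * gauss_exp (\<nu> + of_int n) z)"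
        by (simp only: power_Suc mult_ac)
      then show ?thesis unfolding t_herm alg .
    qed
    moreover have "resolved \<nu> (\<lambda>z. inverse (2 * of_real pi) *
        (?b j (Suc r) z + (of_real pi * of_nat r) * ?b j r' z))"
      by (intro resolved_scale resolved_add Suc.IH)
    ultimately show ?thesis by (simp only:)
  qed
qed

text \<open>The partial sums of the exponential series are dominated by the exponential of the
  absolute value, which stays square integrable against the mode.\<close>

lemma resolved_exp_gauss_exp:
  "resolved \<nu> (\<lambda>z. exp (c * of_real (Im z + (\<nu> + of_int n))) * gauss_exp (\<nu> + of_int n) z)"
proof (rule resolved_dominated)
  let ?\<mu> = "\<nu> + of_int n"
  let ?F = "\<lambda>i z. (\<Sum>j<i. (c * of_real (Im z + ?\<mu>)) ^ j /\<^sub>R fact j) * gauss_exp ?\<mu> z"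
  show "resolved \<nu> (?F i)" for i
  proof -
    have "resolved \<nu> (\<lambda>z. \<Sum>j<i. (c ^ j / fact j) * (of_real (Im z + ?\<mu>) ^ j * (poly (herm 0) (of_real (Im z + ?\<mu>)) * gauss_exp ?\<mu> z)))"
      by (intro resolved_sum resolved_scale resolved_power_gauss_exp)
    moreover have "(\<Sum>j<i. (c * t) ^ j /\<^sub>R fact j) * g =
        (\<Sum>j<i. (c ^ j / fact j) * (t ^ j * (poly (herm 0) t * g)))" for t g
      unfolding sum_distrib_right
      by (intro sum.cong refl) (simp add: power_mult_distrib scaleR_conv_of_real divide_inverse mult_ac)
    ultimately show ?thesis by (simp only:)
  qed
  show "integrable MS (\<lambda>z. (exp (cmod c * \<bar>Im z + ?\<mu>\<bar>) * cmod (gauss_exp ?\<mu> z))\<^sup>2)"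
    by (rule integrable_exp_abs_gauss_exp)
  fix z
  have sums: "(\<lambda>j. x ^ j /\<^sub>R fact j) sums exp x" for x :: complex
    unfolding exp_def by (rule summable_sums[OF summable_exp_generic])
  have sums_real: "(\<lambda>j. x ^ j /\<^sub>R fact j) sums exp x" for x :: real
    unfolding exp_def by (rule summable_sums[OF summable_exp_generic])
  show "(\<lambda>i. ?F i z) \<longlonglongrightarrow> exp (c * of_real (Im z + ?\<mu>)) * gauss_exp ?\<mu> z"
    using sums[of "c * of_real (Im z + ?\<mu>)"] unfolding sums_def by (intro tendsto_mult_right)
  fix i
  have "cmod (\<Sum>j<i. (c * of_real (Im z + ?\<mu>)) ^ j /\<^sub>R fact j) \<le>
      (\<Sum>j<i. (cmod c * \<bar>Im z + ?\<mu>\<bar>) ^ j /\<^sub>R fact j)"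
    by (rule sum_norm_le) (simp only: norm_scaleR norm_power norm_mult norm_of_real, simp)
  also have "\<dots> \<le> exp (cmod c * \<bar>Im z + ?\<mu>\<bar>)"
    unfolding sums_unique[OF sums_real]
    by (intro sum_le_suminf sums_summable[OF sums_real]) auto
  finally show "cmod (?F i z) \<le> exp (cmod c * \<bar>Im z + ?\<mu>\<bar>) * cmod (gauss_exp ?\<mu> z)"
    unfolding norm_mult by (rule mult_right_mono) simp
next
  show "(\<lambda>z. exp (c * of_real (Im z + (\<nu> + of_int n))) * gauss_exp (\<nu> + of_int n) z) \<in> borel_measurable MS"
    by (intro borel_measurable_MS_if_continuous continuous_intros)
qed

section \<open>From characters to Borel functions on the strip\<close>

definition phase :: "real \<Rightarrow> complex \<Rightarrow> complex" where
  "phase \<nu> z = exp (of_real pi * z\<^sup>2 / 2 + 2 * of_real pi * \<i> * of_real \<nu> * of_real (Re z))"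

definition trig :: "int \<Rightarrow> real \<Rightarrow> complex \<Rightarrow> complex" where
  "trig n s z = exp (2 * of_real pi * \<i> * of_int n * of_real (Re z) + \<i> * of_real s * of_real (Im z))"

lemma continuous_phase [continuous_intros]: "continuous_on A (phase \<nu>)"
  unfolding phase_def by (intro continuous_intros) auto

lemma continuous_trig [continuous_intros]: "continuous_on A (trig n s)"
  unfolding trig_def by (intro continuous_intros)

text \<open>The factor \<open>phase\<close> grows with |Re z|, but on the strip it is bounded, so
  bounded limits of trigonometric functions stay dominated after multiplication by it.\<close>

lemma cmod_phase_strip:
  assumes "z \<in> strip"
  shows "cmod (phase \<nu> z) \<le> exp (pi / 2)"
proof -
  have x: "0 \<le> Re z" "Re z < 1" using assms by (auto simp: strip_def)
  have "(Re z)\<^sup>2 \<le> 1" using x by (simp add: power_le_one)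
  moreover have "0 \<le> (Im z)\<^sup>2" by simp
  ultimately have "(Re z)\<^sup>2 - (Im z)\<^sup>2 \<le> 1" by linarith
  then have "pi * ((Re z)\<^sup>2 - (Im z)\<^sup>2) \<le> pi * 1" by (intro mult_left_mono) auto
  then show ?thesis
    unfolding phase_def norm_exp_eq_Re by (simp add: Re_power2)
qed

lemma resolved_trig: "resolved \<nu> (\<lambda>z. phase \<nu> z * trig n s z)"
proof -
  let ?\<mu> = "\<nu> + of_int n"
  \<comment> \<open>The real part of \<open>?c\<close> cancels the growth of the mode exp (2 * pi *
    \<i> * \<mu> * z) in Im z; the imaginary part creates the frequency \<open>s\<close>.\<close>
  let ?c = "2 * of_real (pi * ?\<mu>) + \<i> * of_real s"
  have "phase \<nu> z * trig n s z = exp (- of_real (pi * ?\<mu>\<^sup>2) - \<i> * of_real s * of_real ?\<mu>) *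
      (exp (?c * of_real (Im z + ?\<mu>)) * gauss_exp ?\<mu> z)" for z
  proof -
    obtain x y where z: "z = of_real x + \<i> * of_real y" by (metis complex_eq)
    show ?thesis
      unfolding phase_def trig_def gauss_exp_def exp_add[symmetric]
      by (rule arg_cong[where f=exp]) (simp add: z complex_eq_iff power2_eq_square algebra_simps)
  qed
  then show ?thesis using resolved_scale[OF resolved_exp_gauss_exp[of \<nu> ?c n]] by (simp only:)
qed

text \<open>The closure of the trigonometric polynomials under bounded pointwise limits on the strip
  is an algebra, so that the sets with indicator function in it form a \<open>\<sigma>\<close>-algebra.\<close>

inductive_set trigcl :: "(complex \<Rightarrow> complex) set" where
  base: "trig n s \<in> trigcl"
| add: "f \<in> trigcl \<Longrightarrow> g \<in> trigcl \<Longrightarrow> (\<lambda>z. f z + g z) \<in> trigcl"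
| scale: "f \<in> trigcl \<Longrightarrow> (\<lambda>z. c * f z) \<in> trigcl"
| lim: "(\<And>j::nat. F j \<in> trigcl) \<Longrightarrow> (\<And>j z. z \<in> strip \<Longrightarrow> cmod (F j z) \<le> C) \<Longrightarrow>
    (\<And>z. z \<in> strip \<Longrightarrow> (\<lambda>j. F j z) \<longlonglongrightarrow> f z) \<Longrightarrow> f \<in> borel_measurable borel \<Longrightarrow> f \<in> trigcl"

lemma trigcl_measurable: "f \<in> trigcl \<Longrightarrow> f \<in> borel_measurable borel"
proof (induction rule: trigcl.induct)
  case (base n s)
  show ?case by (intro borel_measurable_continuous_onI continuous_intros)
qed auto

lemma trigcl_bounded: "f \<in> trigcl \<Longrightarrow> \<exists>C. \<forall>z\<in>strip. cmod (f z) \<le> C"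
proof (induction rule: trigcl.induct)
  case (base n s)
  show ?case by (auto simp: trig_def norm_exp_eq_Re)
next
  case (add f g)
  then obtain C D where "\<forall>z\<in>strip. cmod (f z) \<le> C" "\<forall>z\<in>strip. cmod (g z) \<le> D" by blast
  then show ?case by (intro exI[of _ "C + D"]) (auto intro: norm_triangle_mono)
next
  case (scale f c)
  then obtain C where "\<forall>z\<in>strip. cmod (f z) \<le> C" by blast
  then show ?case by (intro exI[of _ "cmod c * C"]) (auto simp: norm_mult intro: mult_left_mono)
next
  case (lim F C f)
  have "cmod (f z) \<le> C" if "z \<in> strip" for z
    using lim(2)[OF that] tendsto_norm[OF lim(3)[OF that]] by (intro LIMSEQ_le_const2) auto
  then show ?case by blast
qed

text \<open>The limit rule admits a constant sequence and looks at the strip only, so a member may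
  be altered off the strip as long as it stays Borel.\<close>

lemma trigcl_cong:
  assumes "f \<in> trigcl" "g \<in> borel_measurable borel" "\<And>z. z \<in> strip \<Longrightarrow> f z = g z"
  shows "g \<in> trigcl"
proof -
  obtain C where C: "\<forall>z\<in>strip. cmod (f z) \<le> C" using trigcl_bounded[OF assms(1)] by blast
  show ?thesis
  proof (rule trigcl.lim[of "\<lambda>_. f" C])
    show "(\<lambda>j::nat. f z) \<longlonglongrightarrow> g z" if "z \<in> strip" for z
      unfolding assms(3)[OF that] by (rule tendsto_const)
  qed (use C assms(1,2) in blast)+
qed

lemma trigcl_trig_mult: "f \<in> trigcl \<Longrightarrow> (\<lambda>z. trig n s z * f z) \<in> trigcl"
proof (induction rule: trigcl.induct)
  case (base m t)
  have "(\<lambda>z. trig n s z * trig m t z) = trig (n + m) (s + t)"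
    by (simp add: trig_def fun_eq_iff algebra_simps flip: exp_add)
  then show ?case by (simp add: trigcl.base)
next
  case (add f g)
  then show ?case using trigcl.add by (simp add: distrib_left)
next
  case (scale f c)
  then show ?case using trigcl.scale[of "\<lambda>z. trig n s z * f z" c] by (simp add: mult.left_commute)
next
  case (lim F C f)
  show ?case
  proof (rule trigcl.lim[OF lim.IH])
    have [measurable]: "trig n s \<in> borel_measurable borel" "f \<in> borel_measurable borel"
      using lim.hyps(4) by (auto intro!: borel_measurable_continuous_onI continuous_intros)
    show "(\<lambda>z. trig n s z * f z) \<in> borel_measurable borel" by measurable
    fix z assume z: "z \<in> strip"
    show "cmod (trig n s z * F j z) \<le> C" for j
      using lim.hyps(2)[OF z, of j] by (simp add: norm_mult trig_def norm_exp_eq_Re)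
    show "(\<lambda>j. trig n s z * F j z) \<longlonglongrightarrow> trig n s z * f z"
      by (intro tendsto_intros lim.hyps(3) z)
  qed
qed

text \<open>Induction on one factor at a time: a character as first factor is the previous lemma,
  and the limit rule survives multiplication by a function bounded on the strip.\<close>

lemma trigcl_mult:
  assumes "f \<in> trigcl" "g \<in> trigcl"
  shows "(\<lambda>z. f z * g z) \<in> trigcl"
  using assms
proof (induction rule: trigcl.induct)
  case (base n s)
  then show ?case by (rule trigcl_trig_mult)
next
  case (add f h)
  then show ?case using trigcl.add by (simp add: distrib_right)
next
  case (scale f c)
  then show ?case using trigcl.scale[of "\<lambda>z. f z * g z" c] by (simp add: mult.assoc)
next
  case (lim F C f)
  obtain D where D: "\<forall>z\<in>strip. cmod (g z) \<le> D" using trigcl_bounded[OF assms(2)] by blast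
  show ?case
  proof (rule trigcl.lim[OF lim.IH])
    have [measurable]: "g \<in> borel_measurable borel" "f \<in> borel_measurable borel"
      using lim.hyps(4) trigcl_measurable[OF assms(2)] by auto
    show "(\<lambda>z. f z * g z) \<in> borel_measurable borel" by measurable
    show "g \<in> trigcl" for j :: nat by (rule assms)
    fix z assume z: "z \<in> strip"
    show "cmod (F j z * g z) \<le> C * D" for j
      using lim.hyps(2)[OF z, of j] D z norm_ge_zero[of "F j z"]
      by (auto simp: norm_mult intro!: mult_mono order_trans[OF norm_ge_zero])
    show "(\<lambda>j. F j z * g z) \<longlonglongrightarrow> f z * g z"
      by (intro tendsto_intros lim.hyps(3) z)
  qed
qed

lemma trigcl_const: "(\<lambda>z. c) \<in> trigcl"
  using trigcl.scale[OF trigcl.base[of 0 0], of c] by (simp add: trig_def)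

lemma trigcl_sum: "(\<And>i. i \<in> I \<Longrightarrow> f i \<in> trigcl) \<Longrightarrow> (\<lambda>z. \<Sum>i\<in>I. f i z) \<in> trigcl"
  by (induction I rule: infinite_finite_induct) (auto intro: trigcl_const trigcl.add)

lemma trigcl_prod: "(\<And>i. i \<in> I \<Longrightarrow> f i \<in> trigcl) \<Longrightarrow> (\<lambda>z. \<Prod>i\<in>I. f i z) \<in> trigcl"
  by (induction I rule: infinite_finite_induct) (auto intro: trigcl_const trigcl_mult)

lemma trigcl_power: "f \<in> trigcl \<Longrightarrow> (\<lambda>z. f z ^ n) \<in> trigcl"
  by (induction n) (auto intro: trigcl_const trigcl_mult)

lemma trigcl_diff: "f \<in> trigcl \<Longrightarrow> g \<in> trigcl \<Longrightarrow> (\<lambda>z. f z - g z) \<in> trigcl"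
  using trigcl.add[OF _ trigcl.scale[of g "-1"], of f] by simp

lemma resolved_trigcl: "f \<in> trigcl \<Longrightarrow> resolved \<nu> (\<lambda>z. phase \<nu> z * f z)"
proof (induction rule: trigcl.induct)
  case (base n s)
  show ?case by (rule resolved_trig)
next
  case (add f g)
  then show ?case using resolved_add by (simp add: distrib_left)
next
  case (scale f c)
  then show ?case using resolved_scale[of \<nu> "\<lambda>z. phase \<nu> z * f z" c] by (simp add: mult.left_commute)
next
  case (lim F C f)
  show ?case
  proof (rule resolved_dominated[OF lim.IH])
    have [measurable]: "phase \<nu> \<in> borel_measurable borel" "f \<in> borel_measurable borel"
      using lim.hyps(4) by (auto intro!: borel_measurable_continuous_onI continuous_intros)
    show "(\<lambda>z. phase \<nu> z * f z) \<in> borel_measurable MS"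
      by (rule borel_measurable_MS_if_borel) measurable
    show "integrable MS (\<lambda>z. (exp (pi / 2) * C)\<^sup>2)" by (rule integrable_MS_const)
    fix z assume z: "z \<in> strip"
    show "cmod (phase \<nu> z * F j z) \<le> exp (pi / 2) * C" for j
      unfolding norm_mult by (intro mult_mono cmod_phase_strip lim.hyps(2) z) auto
    show "(\<lambda>j. phase \<nu> z * F j z) \<longlonglongrightarrow> phase \<nu> z * f z"
      by (intro tendsto_intros lim.hyps(3) z)
  qed
qed

text \<open>Bernstein polynomials approximate \<open>\<phi>\<close> uniformly on the unit interval,
  hence the composition uniformly on the strip; polynomials of \<open>y\<close> belong to the
  algebra.\<close>

lemma trigcl_continuous_comp:
  fixes \<phi> :: "real \<Rightarrow> real" and y :: "complex \<Rightarrow> real"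
  assumes y: "(\<lambda>z. of_real (y z)) \<in> trigcl" "\<And>z. z \<in> strip \<Longrightarrow> y z \<in> {0..1}"
    and \<phi>: "continuous_on UNIV \<phi>"
  shows "(\<lambda>z. of_real (\<phi> (y z))) \<in> trigcl"
proof -
  define B where "B n z = (\<Sum>k\<le>n. \<phi> (k / n) * Bernstein n k (y z))" for n z
  have \<phi>': "continuous_on {0..1} \<phi>" by (rule continuous_on_subset[OF \<phi>]) simp
  have [measurable]: "y \<in> borel_measurable borel"
    using measurable_compose[OF trigcl_measurable[OF y(1)] borel_measurable_Re] by simp
  have [measurable]: "\<phi> \<in> borel_measurable borel" by (intro borel_measurable_continuous_onI \<phi>)
  have approx: "\<exists>N. \<forall>n\<ge>N. \<forall>z\<in>strip. \<bar>\<phi> (y z) - B n z\<bar> < e" if "e > 0" for e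
    using Bernstein_Weierstrass[OF \<phi>' that] y(2) unfolding B_def by blast
  have B: "(\<lambda>z. of_real (B n z)) \<in> trigcl" for n
  proof -
    have "(\<lambda>z. \<Sum>k\<le>n. of_real (\<phi> (k / n)) * (of_nat (n choose k) *
        of_real (y z) ^ k * (1 - of_real (y z)) ^ (n - k))) \<in> trigcl"
      by (intro trigcl_sum trigcl.scale trigcl_mult trigcl_power trigcl_diff trigcl_const y(1))
    then show ?thesis by (simp add: B_def Bernstein_def)
  qed
  obtain N where N: "\<And>n z. n \<ge> N \<Longrightarrow> z \<in> strip \<Longrightarrow> \<bar>\<phi> (y z) - B n z\<bar> < 1"
    using approx[of 1] by auto
  have "bounded (\<phi> ` {0..1})" by (intro compact_imp_bounded compact_continuous_image \<phi>') simp
  then obtain K where "\<forall>x\<in>\<phi> ` {0..1}. norm x \<le> K" unfolding bounded_iff by blast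
  then have K: "\<bar>\<phi> (y z)\<bar> \<le> K" if "z \<in> strip" for z using y(2)[OF that] by force
  show ?thesis
  proof (rule trigcl.lim)
    \<comment> \<open>Dropping the first \<open>N\<close> terms leaves approximants within 1 of the
      limit, which gives a common bound.\<close>
    show "(\<lambda>z. of_real (B (n + N) z)) \<in> trigcl" for n by (rule B)
    show "(\<lambda>z. complex_of_real (\<phi> (y z))) \<in> borel_measurable borel" by measurable
    fix z assume z: "z \<in> strip"
    show "cmod (of_real (B (n + N) z)) \<le> K + 1" for n
      using N[of "n + N" z] K[OF z] z by (simp add: abs_if split: if_splits)
    have "(\<lambda>n. B n z) \<longlonglongrightarrow> \<phi> (y z)"
    proof (rule LIMSEQ_I)
      fix e :: real assume "0 < e"
      from approx[OF this] obtain N where "\<And>n. n \<ge> N \<Longrightarrow> \<bar>\<phi> (y z) - B n z\<bar> < e" using z by blast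
      then have "\<And>n. n \<ge> N \<Longrightarrow> norm (B n z - \<phi> (y z)) < e"
        by (simp only: real_norm_def abs_minus_commute)
      then show "\<exists>N. \<forall>n\<ge>N. norm (B n z - \<phi> (y z)) < e" by blast
    qed
    then show "(\<lambda>n. complex_of_real (B (n + N) z)) \<longlonglongrightarrow> of_real (\<phi> (y z))"
      by (intro tendsto_of_real LIMSEQ_ignore_initial_segment)
  qed
qed

lemma trigcl_indicator_ge:
  fixes y :: "complex \<Rightarrow> real"
  assumes y: "(\<lambda>z. of_real (y z)) \<in> trigcl" "\<And>z. z \<in> strip \<Longrightarrow> y z \<in> {0..1}"
  shows "indicator {z. a \<le> y z} \<in> trigcl"
proof -
  have [measurable]: "y \<in> borel_measurable borel"
    using measurable_compose[OF trigcl_measurable[OF y(1)] borel_measurable_Re] by simp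
  \<comment> \<open>For \<open>n > 0\<close> this is a ramp that equals 0 up to a - 1/n and 1 from
    \<open>a\<close> on; the limit is the indicator of a closed half-line.\<close>
  define \<phi> where "\<phi> n x = max 0 (min 1 (1 + real n * (x - a)))" for n x
  show ?thesis
  proof (rule trigcl.lim)
    show "(\<lambda>z. of_real (\<phi> n (y z))) \<in> trigcl" for n
    proof (rule trigcl_continuous_comp[OF y])
      show "continuous_on UNIV (\<phi> n)" unfolding \<phi>_def by (intro continuous_intros)
    qed
    show "(indicator {z. a \<le> y z} :: complex \<Rightarrow> complex) \<in> borel_measurable borel" by measurable
    fix z assume "z \<in> strip"
    show "cmod (of_real (\<phi> n (y z))) \<le> 1" for n by (simp add: \<phi>_def)
    show "(\<lambda>n. complex_of_real (\<phi> n (y z))) \<longlonglongrightarrow> indicator {z. a \<le> y z} z"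
    proof (cases "a \<le> y z")
      case True
      then have "\<phi> n (y z) = 1" for n by (simp add: \<phi>_def)
      then show ?thesis using True by simp
    next
      case False
      obtain N where N: "1 < real N * (a - y z)" using False reals_Archimedean3[of "a - y z"] by auto
      have "\<phi> n (y z) = 0" if "n \<ge> N" for n
      proof -
        have "real N * (a - y z) \<le> real n * (a - y z)" using that False by (intro mult_right_mono) auto
        then show ?thesis using N by (simp add: \<phi>_def algebra_simps)
      qed
      then show ?thesis
        using False by (intro tendsto_eventually) (auto simp: eventually_sequentially)
    qed
  qed
qed

text \<open>Only one period of Re z matters, and there an initial interval is a superlevel set of a
  cosine.\<close>

lemma trigcl_indicator_Re: "indicator {z. Re z \<le> a} \<in> trigcl"
proof -
  have [measurable]: "(indicator {z. Re z \<le> a} :: complex \<Rightarrow> complex) \<in> borel_measurable borel" by measurable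
  consider "a < 0" | "a \<ge> 1" | "0 \<le> a" "a < 1" by linarith
  then show ?thesis
  proof cases
    case 1
    then show ?thesis by (intro trigcl_cong[OF trigcl_const[of 0]]) (auto simp: strip_def)
  next
    case 2
    then show ?thesis by (intro trigcl_cong[OF trigcl_const[of 1]]) (auto simp: strip_def)
  next
    case 3
    \<comment> \<open>The cosine peaks at Re z = a / 2 and takes the value cos (pi * a) at both 0
      and \<open>a\<close>; on the strip it is at least this value exactly for Re z in
      [0, a].\<close>
    let ?y = "\<lambda>z. (1 + cos (2 * pi * Re z - pi * a)) / 2"
    have "(\<lambda>z. 1 / 2 + (exp (- \<i> * of_real (pi * a)) / 4 * trig 1 0 z + exp (\<i> * of_real (pi * a)) / 4 * trig (-1) 0 z)) \<in> trigcl"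
      by (intro trigcl.add trigcl.scale trigcl.base trigcl_const)
    moreover have "complex_of_real (?y z) = 1 / 2 + (exp (- \<i> * of_real (pi * a)) / 4 * trig 1 0 z + exp (\<i> * of_real (pi * a)) / 4 * trig (-1) 0 z)" for z
      by (simp add: trig_def cos_exp_eq add_divide_distrib cos_of_real[symmetric] algebra_simps flip: exp_add)
    ultimately have y: "(\<lambda>z. of_real (?y z)) \<in> trigcl" by (simp only:)
    have y01: "?y z \<in> {0..1}" for z
    proof -
      define c where "c = cos (2 * pi * Re z - pi * a)"
      have "-1 \<le> c" "c \<le> 1" by (auto simp: c_def)
      then have "(1 + c) / 2 \<in> {0..1}" by simp
      then show ?thesis unfolding c_def .
    qed
    have "indicator {z. (1 + cos (pi * a)) / 2 \<le> ?y z} \<in> trigcl"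
      by (rule trigcl_indicator_ge[OF y y01])
    then show ?thesis
    proof (rule trigcl_cong)
      fix z assume "z \<in> strip"
      then have x: "0 \<le> Re z" "Re z < 1" by (auto simp: strip_def)
      define \<theta> where "\<theta> = 2 * pi * Re z - pi * a"
      have a: "0 \<le> pi * a" "pi * a \<le> pi" using 3 mult_left_mono[of a 1 pi] by auto
      have "cos (pi * a) \<le> cos \<theta> \<longleftrightarrow> Re z \<le> a"
      proof
        assume "Re z \<le> a"
        then have "2 * pi * Re z \<le> 2 * pi * a" "0 \<le> 2 * pi * Re z" using x by auto
        then have "\<bar>\<theta>\<bar> \<le> pi * a" unfolding \<theta>_def by linarith
        then have "cos (pi * a) \<le> cos \<bar>\<theta>\<bar>" using a by (intro cos_monotone_0_pi_le) auto
        then show "cos (pi * a) \<le> cos \<theta>" by simp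
      next
        assume le: "cos (pi * a) \<le> cos \<theta>"
        show "Re z \<le> a"
        proof (rule ccontr)
          assume "\<not> Re z \<le> a"
          then have "2 * pi * a < 2 * pi * Re z" "2 * pi * Re z < 2 * pi * 1" using x by auto
          then have t: "pi * a < \<theta>" "pi * a < 2 * pi - \<theta>" unfolding \<theta>_def by linarith+
          have "cos \<theta> < cos (pi * a)"
          proof (cases "\<theta> \<le> pi")
            case True
            then show ?thesis using a t by (intro cos_monotone_0_pi) auto
          next
            case False
            then have "cos (2 * pi - \<theta>) < cos (pi * a)" using a t by (intro cos_monotone_0_pi) auto
            then show ?thesis by (simp add: cos_diff)
          qed
          with le show False by simp
        qed
      qed
      then have "(1 + cos (pi * a)) / 2 \<le> ?y z \<longleftrightarrow> Re z \<le> a"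
        by (simp add: \<theta>_def)
      then show "indicator {z. (1 + cos (pi * a)) / 2 \<le> ?y z} z = (indicator {z. Re z \<le> a} z :: complex)"
        by (simp only: indicator_def mem_Collect_eq)
    qed measurable
  qed
qed

text \<open>Im z ranges over the whole line, so sines of ever longer period are used: at a given
  point, for large \<open>n\<close>, such a sine has the sign of Im z - a.\<close>

lemma trigcl_indicator_Im: "indicator {z. Im z \<le> a} \<in> trigcl"
proof -
  have [measurable]: "(indicator {z. Im z \<le> a} :: complex \<Rightarrow> complex) \<in> borel_measurable borel" by measurable
  let ?s = "\<lambda>n::nat. 1 / real (Suc n)"
  let ?y = "\<lambda>n z. (1 - sin ((Im z - a) * ?s n)) / 2"
  have ind: "indicator {z. 1 / 2 \<le> ?y n z} \<in> trigcl" for n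
  proof (rule trigcl_indicator_ge)
    define t where "t = ?s n"
    have "(\<lambda>z. 1 / 2 + (exp (- \<i> * of_real (a * t)) * \<i> / 4 * trig 0 t z - exp (\<i> * of_real (a * t)) * \<i> / 4 * trig 0 (- t) z)) \<in> trigcl"
      by (intro trigcl.add trigcl_diff trigcl.scale trigcl.base trigcl_const)
    moreover have "complex_of_real ((1 - sin ((Im z - a) * t)) / 2) = 1 / 2 + (exp (- \<i> * of_real (a * t)) * \<i> / 4 * trig 0 t z - exp (\<i> * of_real (a * t)) * \<i> / 4 * trig 0 (- t) z)" for z
    proof -
      define w where "w = \<i> * complex_of_real ((Im z - a) * t)"
      have e1: "exp (- \<i> * of_real (a * t)) * trig 0 t z = exp w"
        unfolding trig_def w_def exp_add[symmetric] by (rule arg_cong[where f=exp]) (simp add: algebra_simps)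
      have e2: "exp (\<i> * of_real (a * t)) * trig 0 (- t) z = exp (- w)"
        unfolding trig_def w_def exp_add[symmetric] by (rule arg_cong[where f=exp]) (simp add: algebra_simps)
      have "complex_of_real (sin ((Im z - a) * t)) = (exp w - exp (- w)) / (2 * \<i>)"
        unfolding sin_of_real[symmetric] sin_exp_eq w_def ..
      then have "complex_of_real ((1 - sin ((Im z - a) * t)) / 2) = (1 - (exp w - exp (- w)) / (2 * \<i>)) / 2"
        by (simp only: of_real_diff of_real_divide of_real_1 of_real_numeral)
      also have "\<dots> = 1 / 2 + (exp w * \<i> / 4 - exp (- w) * \<i> / 4)"
        by (simp add: field_simps)
      finally show ?thesis unfolding e1[symmetric] e2[symmetric] by (simp only: mult_ac times_divide_eq_left times_divide_eq_right)
    qed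
    ultimately have "(\<lambda>z. complex_of_real ((1 - sin ((Im z - a) * t)) / 2)) \<in> trigcl" by (simp only:)
    then show "(\<lambda>z. of_real (?y n z)) \<in> trigcl" unfolding t_def .
    show "?y n z \<in> {0..1}" for z
    proof -
      define c where "c = sin ((Im z - a) * ?s n)"
      have "-1 \<le> c" "c \<le> 1" by (auto simp: c_def)
      then have "(1 - c) / 2 \<in> {0..1}" by simp
      then show ?thesis unfolding c_def .
    qed
  qed
  show ?thesis
  proof (rule trigcl.lim[OF ind])
    show "cmod (indicator {z. 1 / 2 \<le> ?y n z} z) \<le> 1" for n z by (simp add: indicator_def)
    fix z :: complex
    define d where "d = Im z - a"
    have "indicator {z. 1 / 2 \<le> ?y n z} z = (indicator {z. Im z \<le> a} z :: complex)" if n: "real n \<ge> \<bar>d\<bar>" for n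
    proof -
      have ds: "\<bar>d * ?s n\<bar> < pi"
      proof -
        have "\<bar>d * ?s n\<bar> = \<bar>d\<bar> / real (Suc n)" by (simp add: abs_mult)
        also have "\<dots> \<le> 1" using n by simp
        also have "1 < pi" using pi_gt3 by simp
        finally show ?thesis .
      qed
      have "sin (d * ?s n) \<le> 0 \<longleftrightarrow> d \<le> 0"
      proof (cases "d \<le> 0")
        case True
        then have "0 \<le> - (d * ?s n)" by (simp add: divide_nonpos_nonneg)
        then have "0 \<le> sin (- (d * ?s n))" using ds by (intro sin_ge_zero) linarith+
        then show ?thesis using True by simp
      next
        case False
        then have "0 < d * ?s n" by simp
        then have "0 < sin (d * ?s n)" using ds by (intro sin_gt_zero) linarith+
        then show ?thesis using False by simp
      qed
      then show ?thesis by (simp add: indicator_def d_def)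
    qed
    moreover have "\<forall>\<^sub>F n in sequentially. real n \<ge> \<bar>d\<bar>"
      using eventually_ge_at_top[of "nat \<lceil>\<bar>d\<bar>\<rceil>"] by eventually_elim linarith
    ultimately show "(\<lambda>n. indicator {z. 1 / 2 \<le> ?y n z} z) \<longlonglongrightarrow> (indicator {z. Im z \<le> a} z :: complex)"
      by (intro tendsto_eventually) (auto elim: eventually_mono)
  qed measurable
qed

text \<open>Half-planes generate the Borel sets. Closure under products handles unions, as the
  indicator of a finite union is one minus a product.\<close>

lemma trigcl_indicator_borel:
  assumes "A \<in> sets borel"
  shows "(indicator A :: complex \<Rightarrow> complex) \<in> trigcl"
proof -
  let ?G = "(\<lambda>(a, i). {x. x \<bullet> i \<le> a}) ` (UNIV \<times> (Basis :: complex set))"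
  have borel: "sets (borel :: complex measure) = sigma_sets UNIV ?G"
    by (subst borel_eq_halfspace_le) (auto simp: sets_measure_of)
  have "A \<in> sigma_sets UNIV ?G" using assms unfolding borel .
  then show ?thesis
  proof induction
    case (Basic B)
    then obtain a i where i: "i \<in> Basis" "B = {x. x \<bullet> i \<le> a}" by auto
    then show ?case
      using trigcl_indicator_Re[of a] trigcl_indicator_Im[of a] by (auto simp: Basis_complex_def)
  next
    case Empty
    show ?case using trigcl_const[of 0] by simp
  next
    case (Compl B)
    have "(\<lambda>z. 1 - indicator B z) = (indicator (UNIV - B) :: complex \<Rightarrow> complex)"
      by (auto simp: indicator_def)
    then show ?case using trigcl_diff[OF trigcl_const[of 1] Compl.IH] by simp
  next
    case (Union B)
    have meas: "B i \<in> sets borel" for i unfolding borel by (rule Union.hyps)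
    show ?case
    proof (rule trigcl.lim)
      show "(\<lambda>z. 1 - (\<Prod>i<n. 1 - indicator (B i) z)) \<in> trigcl" for n
        by (intro trigcl_diff trigcl_const trigcl_prod Union.IH)
      show "(indicator (\<Union> (range B)) :: complex \<Rightarrow> complex) \<in> borel_measurable borel"
        using meas by measurable
      fix z :: complex
      have prod: "(\<Prod>i<n. 1 - indicator (B i) z) = (if \<exists>i<n. z \<in> B i then 0 else 1 :: complex)" for n
      proof (cases "\<exists>i<n. z \<in> B i")
        case True
        then obtain i where "i < n" "z \<in> B i" by blast
        then have "(\<Prod>i<n. 1 - indicator (B i) z) = (0 :: complex)"
          by (intro prod_zero bexI[of _ i]) auto
        then show ?thesis using True by simp
      qed (auto intro: prod.neutral)
      show "cmod (1 - (\<Prod>i<n. 1 - indicator (B i) z)) \<le> 1" for n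
        by (simp add: prod)
      show "(\<lambda>n. 1 - (\<Prod>i<n. 1 - indicator (B i) z)) \<longlonglongrightarrow> (indicator (\<Union> (range B)) z :: complex)"
      proof (cases "\<exists>i. z \<in> B i")
        case True
        then obtain i where i: "z \<in> B i" by blast
        have "\<forall>\<^sub>F n in sequentially. (1 - (\<Prod>i<n. 1 - indicator (B i) z) :: complex) = 1"
          using eventually_gt_at_top[of i] by eventually_elim (use i in \<open>auto simp: prod\<close>)
        then show ?thesis using True by (intro tendsto_eventually) (auto simp: indicator_def)
      next
        case False
        then show ?thesis by (simp add: prod)
      qed
    qed
  qed
qed

text \<open>After division by \<open>phase\<close> the function is a pointwise limit of simple
  functions, dominated by twice its modulus.\<close>

lemma resolved_borel:
  assumes F: "sq_int MS F" and borel: "F \<in> borel_measurable borel"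
  shows "resolved \<nu> F"
proof -
  have nz: "phase \<nu> z \<noteq> 0" for z by (simp add: phase_def)
  have [measurable]: "phase \<nu> \<in> borel_measurable borel"
    by (intro borel_measurable_continuous_onI continuous_intros)
  note [measurable] = borel
  have "(\<lambda>z. F z / phase \<nu> z) \<in> borel_measurable borel" by measurable
  from borel_measurable_implies_sequence_metric[OF this, of 0]
  obtain S where S: "\<And>i. simple_function borel (S i)" "\<And>z. (\<lambda>i. S i z) \<longlonglongrightarrow> F z / phase \<nu> z"
    "\<And>i z. cmod (S i z) \<le> 2 * cmod (F z / phase \<nu> z)"
    by auto
  have trigcl: "S i \<in> trigcl" for i
  proof -
    have fin: "finite (range (S i))" using S(1)[of i] by (simp add: simple_function_def)
    have "S i -` {y} \<inter> space borel \<in> sets borel" for y by (rule simple_functionD[OF S(1)])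
    then have "(\<lambda>z. \<Sum>y\<in>range (S i). y * indicator (S i -` {y}) z) \<in> trigcl"
      by (intro trigcl_sum trigcl.scale trigcl_indicator_borel) auto
    moreover have "(\<Sum>y\<in>range (S i). y * indicator (S i -` {y}) z) = S i z" for z
    proof -
      have "(\<Sum>y\<in>range (S i). y * indicator (S i -` {y}) z) = (\<Sum>y\<in>range (S i). if S i z = y then y else 0)"
        by (intro sum.cong) (auto simp: indicator_def)
      then show ?thesis using fin by simp
    qed
    ultimately show ?thesis by simp
  qed
  show ?thesis
  proof (rule resolved_dominated[OF resolved_trigcl[OF trigcl]])
    show "integrable MS (\<lambda>z. (2 * cmod (F z))\<^sup>2)"
      using F by (auto simp: power_mult_distrib)
    show "F \<in> borel_measurable MS" using F by auto
    fix z
    show "cmod (phase \<nu> z * S i z) \<le> 2 * cmod (F z)" for i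
      using mult_left_mono[OF S(3)[of i z] norm_ge_zero[of "phase \<nu> z"]] nz[of z]
      by (simp add: norm_mult norm_divide)
    show "(\<lambda>i. phase \<nu> z * S i z) \<longlonglongrightarrow> F z"
      using tendsto_mult_left[OF S(2)[of z], of "phase \<nu> z"] nz[of z] by simp
  qed
qed

text \<open>A Lebesgue measurable function agrees almost everywhere with a Borel one, and
  \<open>resolved\<close> does not see null sets.\<close>

theorem resolved_if_sq_int:
  assumes F: "sq_int MS F"
  shows "resolved \<nu> F"
proof -
  have m: "F \<in> borel_measurable lebesgue" using F by (auto simp: borel_measurable_MS)
  obtain f g where f: "f \<in> borel_measurable lborel" "AE z in lborel. Re (F z) = f z"
    and g: "g \<in> borel_measurable lborel" "AE z in lborel. Im (F z) = g z"
    using completion_ex_borel_measurable_real[of "\<lambda>z. Re (F z)" lborel]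
      completion_ex_borel_measurable_real[of "\<lambda>z. Im (F z)" lborel] m by auto
  let ?G = "\<lambda>z. complex_of_real (f z) + \<i> * complex_of_real (g z)"
  have [measurable]: "f \<in> borel_measurable borel" "g \<in> borel_measurable borel" using f g by auto
  have G: "?G \<in> borel_measurable borel" by measurable
  have "AE z in lborel. F z = ?G z"
    using f(2) g(2) by eventually_elim (simp add: complex_eq_iff)
  then have "AE z in lebesgue. F z = ?G z" by (rule AE_completion)
  then have AE: "AE z in MS. F z = ?G z" unfolding AE_MS_iff by eventually_elim simp
  have sG: "sq_int MS ?G"
  proof (rule sq_int_bound)
    show "?G \<in> borel_measurable MS" by (rule borel_measurable_MS_if_borel[OF G])
    show "integrable MS (\<lambda>z. (cmod (F z))\<^sup>2)" using F by auto
    show "AE z in MS. (cmod (?G z))\<^sup>2 \<le> (cmod (F z))\<^sup>2" using AE by eventually_elim simp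
  qed
  have "nrm MS (\<lambda>z. F z - ?G z) = 0"
    unfolding nrm_eq_0_iff[OF sq_int_diff[OF F sG]] using AE by eventually_elim simp
  then show ?thesis
    by (intro resolved_limit[of \<nu> "\<lambda>_. ?G" F] resolved_borel sG G F) simp
qed

lemma AE_eq_0_if_orthogonal:
  assumes F: "sq_int MS F" and "\<And>r n. ip MS F (bas \<nu> r n) = 0"
  shows "AE z in MS. F z = 0"
proof -
  have "levels \<nu> m F z = 0" for m z
    by (simp add: levels_def bas.proj_def assms bas.ssum_def)
  then have "(\<lambda>m. nrm MS F) \<longlonglongrightarrow> 0"
    using resolved_if_sq_int[OF F, of \<nu>] by (simp add: resolved_def)
  then have "nrm MS F = 0" by (simp add: LIMSEQ_const_iff)
  then show ?thesis by (simp add: nrm_eq_0_iff[OF F])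
qed

section \<open>Wirtinger derivatives and polyanalytic functions\<close>

text \<open>A relation that carries differentiability and both Wirtinger derivatives at once, as
  every real-linear map of the plane has the form \<open>a * h + b * cnj h\<close>. The rules of
  calculus then compose without side conditions on the total functions \<open>d_z\<close> and
  \<open>d_zbar\<close>.\<close>

definition wirt :: "(complex \<Rightarrow> complex) \<Rightarrow> complex \<Rightarrow> complex \<Rightarrow> complex \<Rightarrow> bool" where
  "wirt F a b z \<longleftrightarrow> (F has_derivative (\<lambda>h. a * h + b * cnj h)) (at z)"

lemma wirtD:
  assumes "wirt F a b z"
  shows "F differentiable (at z)" "frechet_derivative F (at z) 1 = a + b"
    "frechet_derivative F (at z) \<i> = \<i> * (a - b)" "d_z F z = a" "d_zbar F z = b"
proof -
  have d: "frechet_derivative F (at z) = (\<lambda>h. a * h + b * cnj h)"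
    using assms frechet_derivative_at unfolding wirt_def by metis
  show "F differentiable (at z)" using assms unfolding wirt_def by (rule differentiableI)
  show "frechet_derivative F (at z) 1 = a + b"
    "frechet_derivative F (at z) \<i> = \<i> * (a - b)" "d_z F z = a" "d_zbar F z = b"
    by (simp_all add: d d_z_def d_zbar_def algebra_simps)
qed

lemma wirt_differentiable:
  assumes "F differentiable (at z)"
  shows "wirt F (d_z F z) (d_zbar F z) z"
proof -
  let ?D = "frechet_derivative F (at z)"
  have D: "(F has_derivative ?D) (at z)" using assms by (simp add: frechet_derivative_works)
  interpret linear ?D by (rule has_derivative_linear[OF D])
  have "?D h = d_z F z * h + d_zbar F z * cnj h" for h
  proof -
    have "h = Re h *\<^sub>R 1 + Im h *\<^sub>R \<i>" by (simp add: complex_eq_iff)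
    then have "?D h = ?D (Re h *\<^sub>R 1 + Im h *\<^sub>R \<i>)" by (rule arg_cong)
    also have "\<dots> = of_real (Re h) * ?D 1 + of_real (Im h) * ?D \<i>"
      unfolding add scale unfolding scaleR_conv_of_real ..
    also have "\<dots> = d_z F z * h + d_zbar F z * cnj h"
      by (simp add: d_z_def d_zbar_def complex_eq_iff field_simps)
    finally show ?thesis .
  qed
  then have "?D = (\<lambda>h. d_z F z * h + d_zbar F z * cnj h)" by blast
  then show ?thesis using D unfolding wirt_def by simp
qed

lemma wirt_field: "(f has_field_derivative a) (at z) \<Longrightarrow> wirt f a 0 z"
  unfolding wirt_def has_field_derivative_def by simp

lemma wirt_holomorphic: "f holomorphic_on UNIV \<Longrightarrow> wirt f (deriv f z) 0 z"
  by (intro wirt_field holomorphic_derivI[of _ UNIV]) auto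

lemma wirt_cnj: "wirt F a b z \<Longrightarrow> wirt (\<lambda>z. cnj (F z)) (cnj b) (cnj a) z"
  unfolding wirt_def by (drule has_derivative_cnj) (simp add: add.commute)

lemma wirt_add: "wirt F a b z \<Longrightarrow> wirt G c d z \<Longrightarrow> wirt (\<lambda>z. F z + G z) (a + c) (b + d) z"
  unfolding wirt_def by (drule (1) has_derivative_add) (simp add: algebra_simps)

lemma wirt_mult: "wirt F a b z \<Longrightarrow> wirt G c d z \<Longrightarrow>
    wirt (\<lambda>z. F z * G z) (a * G z + F z * c) (b * G z + F z * d) z"
  unfolding wirt_def by (drule (1) has_derivative_mult) (simp add: algebra_simps)

lemma wirt_const: "wirt (\<lambda>z. c) 0 0 z"
  by (intro wirt_field DERIV_const)

lemma wirt_sum: "(\<And>i. i \<in> I \<Longrightarrow> wirt (F i) (a i) (b i) z) \<Longrightarrow>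
    wirt (\<lambda>z. \<Sum>i\<in>I. F i z) (\<Sum>i\<in>I. a i) (\<Sum>i\<in>I. b i) z"
  by (induction I rule: infinite_finite_induct) (auto intro: wirt_const wirt_add)

lemma wirt_cnj_power: "wirt (\<lambda>z. cnj z ^ n) 0 (of_nat n * cnj z ^ (n - 1)) z"
proof -
  have "((\<lambda>z. z ^ n) has_field_derivative of_nat n * z ^ (n - 1)) (at z)"
    by (auto intro!: derivative_eq_intros)
  from wirt_cnj[OF wirt_field[OF this]] show ?thesis by simp
qed

lemma wirt_comp:
  assumes "(f has_field_derivative f') (at (F z))" "wirt F a b z"
  shows "wirt (\<lambda>z. f (F z)) (f' * a) (f' * b) z"
  using has_derivative_compose[OF assms(2)[unfolded wirt_def] assms(1)[unfolded has_field_derivative_def]]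
  unfolding wirt_def by (simp add: algebra_simps)

section \<open>Iterated differentiability in the real sense\<close>

lemma C_diff_continuous: "C_diff k F \<Longrightarrow> continuous_on UNIV F"
  by (cases k) (auto intro: differentiable_imp_continuous_on)

lemma C_diff_Suc_imp: "C_diff (Suc k) F \<Longrightarrow> C_diff k F"
proof (induction k arbitrary: F)
  case 0
  then show ?case by (auto intro: differentiable_imp_continuous_on)
next
  case (Suc k)
  show ?case
    unfolding C_diff.simps(2)[of k]
  proof (intro conjI)
    show "F differentiable_on UNIV" using Suc.prems by simp
    show "C_diff k (\<lambda>z. frechet_derivative F (at z) 1)" "C_diff k (\<lambda>z. frechet_derivative F (at z) \<i>)"
      by (rule Suc.IH, use Suc.prems in simp)+
  qed
qed

text \<open>\<open>a + b\<close> and \<open>\<i> * (a - b)\<close> are the two partial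
  derivatives.\<close>

lemma C_diff_wirtI:
  assumes "\<And>z. wirt F (a z) (b z) z" "C_diff k (\<lambda>z. a z + b z)" "C_diff k (\<lambda>z. \<i> * (a z - b z))"
  shows "C_diff (Suc k) F"
  using assms wirtD[OF assms(1)] by (auto simp: differentiable_on_def intro: differentiable_at_withinI)

lemma C_diff_wirt:
  assumes "C_diff (Suc k) F"
  shows "wirt F (d_z F z) (d_zbar F z) z"
  using assms by (intro wirt_differentiable) (auto simp: differentiable_on_def)

lemma C_diff_add: "C_diff k F \<Longrightarrow> C_diff k G \<Longrightarrow> C_diff k (\<lambda>z. F z + G z)"
proof (induction k arbitrary: F G)
  case 0
  then show ?case by (auto intro: continuous_on_add)
next
  case (Suc k)
  note F = C_diff_wirt[OF Suc.prems(1)] and G = C_diff_wirt[OF Suc.prems(2)]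
  show ?case
  proof (rule C_diff_wirtI[OF wirt_add[OF F G]])
    have "C_diff k (\<lambda>z. frechet_derivative F (at z) 1 + frechet_derivative G (at z) 1)"
      using Suc by simp
    then show "C_diff k (\<lambda>z. d_z F z + d_z G z + (d_zbar F z + d_zbar G z))"
      unfolding wirtD(2)[OF F] wirtD(2)[OF G] by (simp add: algebra_simps)
    have "C_diff k (\<lambda>z. frechet_derivative F (at z) \<i> + frechet_derivative G (at z) \<i>)"
      using Suc by simp
    then show "C_diff k (\<lambda>z. \<i> * (d_z F z + d_z G z - (d_zbar F z + d_zbar G z)))"
      unfolding wirtD(3)[OF F] wirtD(3)[OF G] by (simp add: algebra_simps)
  qed
qed

text \<open>The derivative of \<open>h\<close> appears as a new factor, hence \<open>h\<close> is
  arbitrary in the induction.\<close>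

lemma C_diff_holomorphic_mult:
  "h holomorphic_on UNIV \<Longrightarrow> C_diff k F \<Longrightarrow> C_diff k (\<lambda>z. h z * F z)"
proof (induction k arbitrary: h F)
  case 0
  then show ?case using continuous_on_mult[OF holomorphic_on_imp_continuous_on[OF 0(1)]] by simp
next
  case (Suc k)
  note F = C_diff_wirt[OF Suc.prems(2)] and h = wirt_holomorphic[OF Suc.prems(1)]
  have h': "deriv h holomorphic_on UNIV" by (rule holomorphic_deriv[OF Suc.prems(1)]) auto
  have ih': "(\<lambda>z. \<i> * deriv h z) holomorphic_on UNIV" 
    by (rule holomorphic_on_mult[OF holomorphic_on_const h'])
  have Fk: "C_diff k F" by (rule C_diff_Suc_imp[OF Suc.prems(2)])
  show ?case
  proof (rule C_diff_wirtI[OF wirt_mult[OF h F]])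
    have "C_diff k (\<lambda>z. deriv h z * F z + h z * frechet_derivative F (at z) 1)"
      using Suc.prems by (intro C_diff_add Suc.IH h' Fk) auto
    then show "C_diff k (\<lambda>z. deriv h z * F z + h z * d_z F z + (0 * F z + h z * d_zbar F z))"
      unfolding wirtD(2)[OF F] by (simp add: algebra_simps)
    have "C_diff k (\<lambda>z. (\<i> * deriv h z) * F z + h z * frechet_derivative F (at z) \<i>)"
      using Suc.prems by (intro C_diff_add Suc.IH ih' Fk) auto
    then show "C_diff k (\<lambda>z. \<i> * (deriv h z * F z + h z * d_z F z - (0 * F z + h z * d_zbar F z)))"
      unfolding wirtD(3)[OF F] by (simp add: algebra_simps)
  qed
qed

lemma C_diff_scale: "C_diff k F \<Longrightarrow> C_diff k (\<lambda>z. c * F z)"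
  using C_diff_holomorphic_mult[of "\<lambda>z. c" k F] by simp

lemma C_diff_d_zbar:
  assumes "C_diff (Suc k) F"
  shows "C_diff k (d_zbar F)"
proof -
  have "C_diff k (\<lambda>z. (1 / 2) * frechet_derivative F (at z) 1 + (\<i> / 2) * frechet_derivative F (at z) \<i>)"
    using assms by (intro C_diff_add C_diff_scale) auto
  then show ?thesis by (simp add: d_zbar_def[abs_def] add_divide_distrib)
qed

lemma d_zbar_power_holomorphic_mult:
  "h holomorphic_on UNIV \<Longrightarrow> C_diff k F \<Longrightarrow> (d_zbar ^^ k) (\<lambda>z. h z * F z) = (\<lambda>z. h z * (d_zbar ^^ k) F z)"
proof (induction k arbitrary: F)
  case (Suc k)
  have "d_zbar (\<lambda>z. h z * F z) = (\<lambda>z. h z * d_zbar F z)"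
    using wirtD(5)[OF wirt_mult[OF wirt_holomorphic[OF Suc.prems(1)] C_diff_wirt[OF Suc.prems(2)]]]
    by (simp add: fun_eq_iff)
  then show ?case
    using Suc.IH[OF Suc.prems(1) C_diff_d_zbar[OF Suc.prems(2)]]
    by (simp add: funpow_Suc_right del: funpow.simps)
qed simp

text \<open>The classical normal form. It serves to show membership in \<open>poly_fock\<close>; the
  opposite direction goes through the Fourier modes.\<close>

definition polyanalytic :: "nat \<Rightarrow> (complex \<Rightarrow> complex) \<Rightarrow> bool" where
  "polyanalytic N F \<longleftrightarrow> (\<exists>f. (\<forall>j<N. f j holomorphic_on UNIV) \<and> F = (\<lambda>z. \<Sum>j<N. cnj z ^ j * f j z))"

lemma polyanalytic_add:
  assumes "polyanalytic N F" "polyanalytic N G"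
  shows "polyanalytic N (\<lambda>z. F z + G z)"
proof -
  obtain f g where "\<forall>j<N. f j holomorphic_on UNIV" "F = (\<lambda>z. \<Sum>j<N. cnj z ^ j * f j z)"
    "\<forall>j<N. g j holomorphic_on UNIV" "G = (\<lambda>z. \<Sum>j<N. cnj z ^ j * g j z)"
    using assms unfolding polyanalytic_def by blast
  then show ?thesis
    unfolding polyanalytic_def
    by (intro exI[of _ "\<lambda>j z. f j z + g j z"]) (auto simp: algebra_simps sum.distrib intro!: holomorphic_on_add)
qed

lemma polyanalytic_scale:
  assumes "polyanalytic N F"
  shows "polyanalytic N (\<lambda>z. c * F z)"
proof -
  obtain f where "\<forall>j<N. f j holomorphic_on UNIV" "F = (\<lambda>z. \<Sum>j<N. cnj z ^ j * f j z)"
    using assms unfolding polyanalytic_def by blast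
  then show ?thesis
    unfolding polyanalytic_def
    by (intro exI[of _ "\<lambda>j z. c * f j z"]) (auto simp: sum_distrib_left mult_ac intro!: holomorphic_on_mult)
qed

lemma polyanalytic_mono:
  assumes "polyanalytic M F" "M \<le> N"
  shows "polyanalytic N F"
proof -
  obtain f where f: "\<forall>j<M. f j holomorphic_on UNIV" "F = (\<lambda>z. \<Sum>j<M. cnj z ^ j * f j z)"
    using assms(1) unfolding polyanalytic_def by blast
  have "(\<Sum>j<M. cnj z ^ j * f j z) = (\<Sum>j<N. cnj z ^ j * (if j < M then f j z else 0))" for z
    by (rule sum.mono_neutral_cong_left) (use assms(2) in auto)
  then show ?thesis
    unfolding polyanalytic_def
  proof (intro exI[of _ "\<lambda>j z. if j < M then f j z else 0"] conjI allI impI)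
    fix j show "(\<lambda>z. if j < M then f j z else 0) holomorphic_on UNIV"
      using f(1) by (cases "j < M") auto
  qed (use f(2) in auto)
qed

text \<open>The derivative in z keeps the order and the one in its conjugate lowers it; the
  truncated \<open>N - 1\<close> is harmless because for \<open>N = 0\<close> all sums are
  empty.\<close>

lemma polyanalytic_wirt:
  assumes "polyanalytic N F"
  obtains a b where "\<And>z. wirt F (a z) (b z) z" "polyanalytic N a" "polyanalytic (N - 1) b"
proof -
  obtain f where f: "\<forall>j<N. f j holomorphic_on UNIV" and F: "F = (\<lambda>z. \<Sum>j<N. cnj z ^ j * f j z)"
    using assms unfolding polyanalytic_def by blast
  define a where "a z = (\<Sum>j<N. cnj z ^ j * deriv (f j) z)" for z
  define b where "b z = (\<Sum>j<N. of_nat j * cnj z ^ (j - 1) * f j z)" for z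
  have "wirt F (a z) (b z) z" for z
  proof -
    have "wirt (\<lambda>z. \<Sum>j<N. cnj z ^ j * f j z) (\<Sum>j<N. 0 * f j z + cnj z ^ j * deriv (f j) z)
        (\<Sum>j<N. of_nat j * cnj z ^ (j - 1) * f j z + cnj z ^ j * 0) z"
      by (intro wirt_sum wirt_mult wirt_cnj_power wirt_holomorphic) (use f in auto)
    then show ?thesis by (simp add: F a_def b_def)
  qed
  moreover have "polyanalytic N a"
    unfolding polyanalytic_def a_def
    by (intro exI[of _ "\<lambda>j. deriv (f j)"]) (use f in \<open>auto intro!: holomorphic_deriv\<close>)
  moreover have "polyanalytic (N - 1) b"
  proof (cases N)
    case 0
    then show ?thesis by (auto simp: polyanalytic_def b_def)
  next
    case (Suc M)
    have "b = (\<lambda>z. \<Sum>j<M. cnj z ^ j * (of_nat (Suc j) * f (Suc j) z))"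
      unfolding b_def[abs_def] Suc by (subst sum.lessThan_Suc_shift) (simp add: mult_ac)
    then show ?thesis
      unfolding polyanalytic_def Suc
      by (intro exI[of _ "\<lambda>j z. of_nat (Suc j) * f (Suc j) z"]) (use f Suc in \<open>auto intro!: holomorphic_on_mult\<close>)
  qed
  ultimately show ?thesis by (rule that)
qed

lemma polyanalytic_C_diff: "polyanalytic N F \<Longrightarrow> C_diff k F"
proof (induction k arbitrary: F)
  case 0
  then obtain f where f: "\<And>j. j < N \<Longrightarrow> f j holomorphic_on UNIV" "F = (\<lambda>z. \<Sum>j<N. cnj z ^ j * f j z)"
    unfolding polyanalytic_def by blast
  have "continuous_on UNIV F"
    unfolding f(2) by (intro continuous_intros holomorphic_on_imp_continuous_on f(1)) simp
  then show ?case by simp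
next
  case (Suc k)
  obtain a b where ab: "\<And>z. wirt F (a z) (b z) z" "polyanalytic N a" "polyanalytic (N - 1) b"
    using polyanalytic_wirt[OF Suc.prems] by blast
  have b: "polyanalytic N b" using ab(3) by (rule polyanalytic_mono) simp
  have "polyanalytic N (\<lambda>z. a z + b z)" by (intro polyanalytic_add ab b)
  moreover have "polyanalytic N (\<lambda>z. \<i> * (a z + (-1) * b z))"
    by (intro polyanalytic_add polyanalytic_scale ab b)
  ultimately show ?case
    by (intro C_diff_wirtI[OF ab(1)]) (auto intro: Suc.IH)
qed

lemma polyanalytic_d_zbar: "polyanalytic N F \<Longrightarrow> (d_zbar ^^ N) F = (\<lambda>z. 0)"
proof (induction N arbitrary: F)
  case 0
  then show ?case by (auto simp: polyanalytic_def)
next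
  case (Suc N)
  obtain a b where ab: "\<And>z. wirt F (a z) (b z) z" "polyanalytic (Suc N - 1) b"
    using polyanalytic_wirt[OF Suc.prems] by blast
  have "d_zbar F = b" using wirtD(5)[OF ab(1)] by blast
  then show ?case
    using Suc.IH[of b] ab(2) by (simp add: funpow_Suc_right del: funpow.simps)
qed

lemma polyanalytic_poly_fock: "polyanalytic N F \<Longrightarrow> F \<in> L2_qp \<nu> \<Longrightarrow> F \<in> poly_fock \<nu> N"
  by (simp add: poly_fock_def polyanalytic_C_diff polyanalytic_d_zbar)

text \<open>The conjugate of \<open>d_z ^^ r\<close> by the weight \<open>exp (- pi * (cmod z)\<^sup>2)\<close>, expanded for entire functions
  by the Leibniz rule.\<close>

definition raise :: "nat \<Rightarrow> (complex \<Rightarrow> complex) \<Rightarrow> complex \<Rightarrow> complex" where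
  "raise r f z = (\<Sum>j\<le>r. of_nat (r choose j) * (- of_real pi * cnj z) ^ (r - j) * (deriv ^^ j) f z)"

lemma exp_cmod_square: "complex_of_real (exp (- pi * (cmod z)\<^sup>2)) = exp (- of_real pi * z * cnj z)"
proof -
  have "complex_of_real (- pi * (cmod z)\<^sup>2) = - of_real pi * z * cnj z"
    by (simp only: of_real_mult complex_norm_square) simp
  then show ?thesis by (simp only: exp_of_real[symmetric])
qed

lemma wirt_gauss:
  "wirt (\<lambda>z. complex_of_real (exp (- pi * (cmod z)\<^sup>2)))
    (- of_real pi * cnj z * of_real (exp (- pi * (cmod z)\<^sup>2)))
    (- of_real pi * z * of_real (exp (- pi * (cmod z)\<^sup>2))) z"
proof -
  have "wirt (\<lambda>z. (- of_real pi * z) * cnj z ^ 1) (- of_real pi * cnj z ^ 1 + (- of_real pi * z) * 0)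
     (0 * cnj z ^ 1 + (- of_real pi * z) * (of_nat 1 * cnj z ^ (1 - 1))) z"
    by (intro wirt_mult wirt_cnj_power wirt_field) (auto intro!: derivative_eq_intros)
  from wirt_comp[OF DERIV_exp this] show ?thesis
    unfolding exp_cmod_square by (simp add: mult_ac)
qed

text \<open>Each \<open>d_z\<close> either hits the weight, which gives the factor - pi * cnj z, or
  the entire function; powers of \<open>cnj z\<close> behave as constants.\<close>

lemma d_z_power_gauss:
  assumes f: "f holomorphic_on UNIV"
  shows "(d_z ^^ r) (\<lambda>u. of_real (exp (- pi * (cmod u)\<^sup>2)) * f u) =
    (\<lambda>z. of_real (exp (- pi * (cmod z)\<^sup>2)) * raise r f z)"
proof (induction r)
  case 0
  show ?case by (simp add: raise_def)
next
  case (Suc r)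
  have fj: "(deriv ^^ j) f holomorphic_on UNIV" for j by (intro holomorphic_higher_deriv f) auto
  let ?w = "\<lambda>z. complex_of_real (exp (- pi * (cmod z)\<^sup>2))"
  have wr: "wirt (raise r f) (\<Sum>j\<le>r. of_nat (r choose j) * (- of_real pi * cnj z) ^ (r - j) * (deriv ^^ Suc j) f z)
     (\<Sum>j\<le>r. (of_nat (r choose j) * (- of_real pi) ^ (r - j)) * (of_nat (r - j) * cnj z ^ (r - j - 1)) * (deriv ^^ j) f z) z" for z
  proof -
    have "wirt (\<lambda>z. \<Sum>j\<le>r. (of_nat (r choose j) * (- of_real pi) ^ (r - j)) * (cnj z ^ (r - j) * (deriv ^^ j) f z))
      (\<Sum>j\<le>r. 0 * (cnj z ^ (r - j) * (deriv ^^ j) f z) + (of_nat (r choose j) * (- of_real pi) ^ (r - j)) *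
          (0 * (deriv ^^ j) f z + cnj z ^ (r - j) * deriv ((deriv ^^ j) f) z))
      (\<Sum>j\<le>r. 0 * (cnj z ^ (r - j) * (deriv ^^ j) f z) + (of_nat (r choose j) * (- of_real pi) ^ (r - j)) *
          ((of_nat (r - j) * cnj z ^ (r - j - 1)) * (deriv ^^ j) f z + cnj z ^ (r - j) * 0)) z"
      by (intro wirt_sum wirt_mult wirt_const wirt_cnj_power wirt_holomorphic fj)
    then show ?thesis
      unfolding raise_def[abs_def] power_mult_distrib by (simp add: mult.assoc)
  qed
  have "d_z (\<lambda>z. ?w z * raise r f z) z = ?w z * raise (Suc r) f z" for z
    unfolding wirtD(4)[OF wirt_mult[OF wirt_gauss wr]]
    unfolding raise_def binomial_sum_Suc by (simp add: algebra_simps)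
  then show ?case unfolding funpow.simps(2) o_apply Suc by blast
qed

lemma true_poly_fock_eq:
  "true_poly_fock \<nu> r = {(\<lambda>z. c * raise r f z) | c f. f \<in> fock \<nu>}"
proof -
  have "(\<lambda>z. c * (of_real (exp (pi * (cmod z)\<^sup>2)) *
              (d_z ^^ r) (\<lambda>u. of_real (exp (- pi * (cmod u)\<^sup>2)) * f u) z)) = (\<lambda>z. c * raise r f z)"
    if "f \<in> fock \<nu>" for f c
  proof -
    have f: "f holomorphic_on UNIV" using that by (simp add: fock_def)
    have "complex_of_real (exp (pi * (cmod z)\<^sup>2)) * of_real (exp (- pi * (cmod z)\<^sup>2)) = 1" for z
      by (simp only: of_real_mult[symmetric] exp_add[symmetric]) simp
    then show ?thesis unfolding d_z_power_gauss[OF f] by (simp add: mult.assoc[symmetric])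
  qed
  then show ?thesis unfolding true_poly_fock_def by (metis (no_types, lifting))
qed

lemma raise_polyanalytic:
  assumes f: "f holomorphic_on UNIV"
  shows "polyanalytic (Suc r) (raise r f)"
proof -
  let ?g = "\<lambda>i z. of_nat (r choose i) * (- of_real pi) ^ i * (deriv ^^ (r - i)) f z"
  have "raise r f z = (\<Sum>i<Suc r. cnj z ^ i * ?g i z)" for z
  proof -
    have "raise r f z = (\<Sum>i\<le>r. of_nat (r choose (r - i)) * (- of_real pi * cnj z) ^ (r - (r - i)) * (deriv ^^ (r - i)) f z)"
      unfolding raise_def
      using sum.nat_diff_reindex[of "\<lambda>j. of_nat (r choose j) * (- of_real pi * cnj z) ^ (r - j) * (deriv ^^ j) f z" "Suc r"]
      by (simp add: lessThan_Suc_atMost)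
    also have "\<dots> = (\<Sum>i\<le>r. cnj z ^ i * ?g i z)"
      by (intro sum.cong refl) (simp add: binomial_symmetric[symmetric] power_mult_distrib[symmetric] mult_ac)
    finally show ?thesis by (simp only: lessThan_Suc_atMost)
  qed
  moreover have "?g i holomorphic_on UNIV" for i
    by (intro holomorphic_intros holomorphic_higher_deriv f) auto
  ultimately show ?thesis unfolding polyanalytic_def by (intro exI[of _ ?g]) auto
qed

text \<open>With t = Im z + \<mu>, the logarithmic derivatives of weight and mode add up to 2 * pi *
  \<i> * t, and t itself has \<open>d_z\<close> equal to 1 / (2 * \<i>) = - \<i> / 2. So
  \<open>d_z\<close> reproduces the recursion of \<open>herm\<close>, times
  \<open>\<i>\<close>.\<close>

lemma raise_gauss_exp: "raise r (gauss_exp \<mu>) z = \<i> ^ r * (poly (herm r) (of_real (Im z + \<mu>)) * gauss_exp \<mu> z)"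
proof -
  let ?w = "\<lambda>z. complex_of_real (exp (- pi * (cmod z)\<^sup>2))"
  have "(d_z ^^ r) (\<lambda>u. ?w u * gauss_exp \<mu> u) = (\<lambda>z. ?w z * (\<i> ^ r * (poly (herm r) (of_real (Im z + \<mu>)) * gauss_exp \<mu> z)))"
  proof (induction r)
    case 0
    show ?case by simp
  next
    case (Suc r)
    have "d_z (\<lambda>z. ?w z * (\<i> ^ r * (poly (herm r) (of_real (Im z + \<mu>)) * gauss_exp \<mu> z))) z
        = ?w z * (\<i> ^ Suc r * (poly (herm (Suc r)) (of_real (Im z + \<mu>)) * gauss_exp \<mu> z))" for z
    proof -
      define t where "t = complex_of_real (Im z + \<mu>)"
      have t_eq: "of_real (Im z + \<mu>) = (1 / (2 * \<i>)) * z + ((- 1 / (2 * \<i>)) * cnj z ^ 1 + of_real \<mu>)" for z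
        by (simp add: complex_eq_iff)
      have "wirt (\<lambda>z. (1 / (2 * \<i>)) * z + ((- 1 / (2 * \<i>)) * cnj z ^ 1 + of_real \<mu>))
         (1 / (2 * \<i>) + ((0 * cnj z ^ 1 + (- 1 / (2 * \<i>)) * 0) + 0))
         (0 + ((0 * cnj z ^ 1 + (- 1 / (2 * \<i>)) * (of_nat 1 * cnj z ^ (1 - 1))) + 0)) z"
        by (intro wirt_add wirt_mult wirt_const wirt_cnj_power wirt_field) (auto intro!: derivative_eq_intros)
      then have wt: "wirt (\<lambda>z. of_real (Im z + \<mu>)) (1 / (2 * \<i>)) (- 1 / (2 * \<i>)) z"
        unfolding t_eq by simp
      have wp: "wirt (\<lambda>z. poly (herm r) (of_real (Im z + \<mu>))) (poly (pderiv (herm r)) t * (1 / (2 * \<i>)))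
          (poly (pderiv (herm r)) t * (- 1 / (2 * \<i>))) z"
        unfolding t_def by (rule wirt_comp[OF poly_DERIV wt])
      have wg: "wirt (gauss_exp \<mu>) ((of_real pi * z + 2 * of_real pi * \<i> * of_real \<mu>) * gauss_exp \<mu> z) 0 z"
        unfolding gauss_exp_def[abs_def] by (intro wirt_field) (auto intro!: derivative_eq_intros simp: algebra_simps)
      have zt: "of_real pi * z + 2 * of_real pi * \<i> * of_real \<mu> + - of_real pi * cnj z = 2 * of_real pi * \<i> * t"
        unfolding t_def by (simp add: complex_eq_iff algebra_simps)
      have half: "1 / (2 * \<i>) = - \<i> / 2" by (simp add: complex_eq_iff)
      have herm: "poly (herm (Suc r)) t = 2 * of_real pi * (t * poly (herm r) t) - 1 / 2 * poly (pderiv (herm r)) t"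
        by simp
      have alg1: "(c * W) * (I * (h * g)) + W * (0 * (h * g) + I * (h' * q * g + h * (K * g)))
        = W * I * g * (h * (K + c) + h' * q)" for c W I h h' g q K :: complex
        by (simp add: algebra_simps)
      have alg2: "W * I * g * (h * (2 * p * J * t) + h' * (- J / 2)) = W * (J * I * ((2 * p * (t * h) - 1 / 2 * h') * g))"
        for W I g h h' p J :: complex
        by (simp add: algebra_simps)
      have "d_z (\<lambda>z. ?w z * (\<i> ^ r * (poly (herm r) (of_real (Im z + \<mu>)) * gauss_exp \<mu> z))) z
        = ?w z * \<i> ^ r * gauss_exp \<mu> z * (poly (herm r) t * (of_real pi * z + 2 * of_real pi * \<i> * of_real \<mu> + - of_real pi * cnj z)
           + poly (pderiv (herm r)) t * (1 / (2 * \<i>)))"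
        unfolding wirtD(4)[OF wirt_mult[OF wirt_gauss wirt_mult[OF wirt_const wirt_mult[OF wp wg]]]]
        unfolding t_def[symmetric] by (rule alg1)
      also have "\<dots> = ?w z * (\<i> ^ Suc r * (poly (herm (Suc r)) t * gauss_exp \<mu> z))"
        unfolding zt half herm power_Suc by (rule alg2)
      finally show ?thesis unfolding t_def .
    qed
    then show ?case unfolding funpow.simps(2) o_apply Suc by blast
  qed
  then have "?w z * raise r (gauss_exp \<mu>) z = ?w z * (\<i> ^ r * (poly (herm r) (of_real (Im z + \<mu>)) * gauss_exp \<mu> z))"
    unfolding d_z_power_gauss[OF gauss_exp_holomorphic] by (rule fun_cong)
  then show ?thesis by simp
qed

section \<open>The true polyanalytic levels\<close>

text \<open>Convergence along finite subsets matches the definition of infinite sums; uniformity on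
  discs suffices for continuity and for derivatives of the limit.\<close>

lemma ssum_uniform_limit:
  assumes "ell2 c"
  shows "uniform_limit (cball 0 R) (\<lambda>X z. \<Sum>n\<in>X. c n * bas \<nu> r n z) (bas.ssum \<nu> r c)
    (finite_subsets_at_top UNIV)"
proof -
  obtain B where B: "\<And>n. cmod (c n) \<le> B" using ell2_bounded[OF assms] by blast
  obtain C where C: "C \<ge> 0"
    "\<And>n z. cmod (bas \<nu> r n z) \<le> C * exp (pi * (cmod z)\<^sup>2 / 2 + \<bar>Im z\<bar>) * exp (- \<bar>real_of_int n\<bar>)"
    using bas_bound[of \<nu> r] by blast
  have B0: "0 \<le> B" using B[of 0] norm_ge_zero order_trans by blast
  show ?thesis
    unfolding bas.ssum_def[abs_def]
  proof (rule Weierstrass_m_test_general)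
    fix n and z :: complex assume "z \<in> cball 0 R"
    then have z: "cmod z \<le> R" by simp
    have "(cmod z)\<^sup>2 \<le> R\<^sup>2" using z by (intro power_mono) auto
    then have "pi * (cmod z)\<^sup>2 \<le> pi * R\<^sup>2" by simp
    then have "pi * (cmod z)\<^sup>2 / 2 + \<bar>Im z\<bar> \<le> pi * R\<^sup>2 / 2 + R"
      using abs_Im_le_cmod[of z] z by linarith
    then have "cmod (bas \<nu> r n z) \<le> C * exp (pi * R\<^sup>2 / 2 + R) * exp (- \<bar>real_of_int n\<bar>)"
      using C(1) by (intro order_trans[OF C(2)] mult_right_mono mult_left_mono) auto
    then have "cmod (c n) * cmod (bas \<nu> r n z) \<le> B * (C * exp (pi * R\<^sup>2 / 2 + R) * exp (- \<bar>real_of_int n\<bar>))"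
      using B B0 by (intro mult_mono) auto
    then show "norm (c n * bas \<nu> r n z) \<le> (B * (C * exp (pi * R\<^sup>2 / 2 + R))) * exp (- \<bar>real_of_int n\<bar>)"
      by (simp only: norm_mult mult.assoc)
  qed (intro summable_on_cmult_right summable_exp_int)
qed

lemma continuous_ssum:
  assumes "ell2 c"
  shows "continuous_on UNIV (bas.ssum \<nu> r c)"
proof -
  have "isCont (bas.ssum \<nu> r c) z" for z
  proof (rule continuous_on_interior)
    show "continuous_on (cball 0 (cmod z + 1)) (bas.ssum \<nu> r c)"
      by (rule uniform_limit_theorem[OF _ ssum_uniform_limit[OF assms]])
        (auto intro!: always_eventually continuous_intros)
    show "z \<in> interior (cball 0 (cmod z + 1))" by simp
  qed
  then show ?thesis by (simp add: continuous_on_eq_continuous_at)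
qed

lemma holomorphic_bas_0: "bas \<nu> 0 n holomorphic_on A"
proof -
  have "bas \<nu> 0 n = (\<lambda>z. of_real (herm_scale 0) * gauss_exp (\<nu> + of_int n) z)"
    by (simp add: bas_def fun_eq_iff)
  then show ?thesis by (simp only:) (intro holomorphic_on_mult holomorphic_on_const gauss_exp_holomorphic)
qed

lemma holomorphic_ssum_0:
  assumes "ell2 c"
  shows "bas.ssum \<nu> 0 c holomorphic_on UNIV"
proof -
  have "bas.ssum \<nu> 0 c field_differentiable (at z)" for z
  proof -
    have "bas.ssum \<nu> 0 c holomorphic_on ball 0 (cmod z + 1)"
    proof (rule holomorphic_uniform_limit[OF _ ssum_uniform_limit[OF assms]])
      show "\<forall>\<^sub>F X in finite_subsets_at_top UNIV.
          continuous_on (cball 0 (cmod z + 1)) (\<lambda>z. \<Sum>n\<in>X. c n * bas \<nu> 0 n z) \<and>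
          (\<lambda>z. \<Sum>n\<in>X. c n * bas \<nu> 0 n z) holomorphic_on ball 0 (cmod z + 1)"
        by (intro always_eventually allI conjI continuous_intros holomorphic_on_sum holomorphic_on_mult
            holomorphic_on_const holomorphic_bas_0)
    qed auto
    then show ?thesis by (rule holomorphic_on_imp_differentiable_at) auto
  qed
  then show ?thesis by (simp add: holomorphic_on_def field_differentiable_at_within)
qed

section \<open>Raising applied to basis expansions\<close>

lemma raise_add:
  assumes "f holomorphic_on UNIV" "g holomorphic_on UNIV"
  shows "raise r (\<lambda>z. f z + g z) z = raise r f z + raise r g z"
  unfolding raise_def
  by (simp add: higher_deriv_add[OF assms] distrib_left sum.distrib)

lemma raise_scale:
  assumes "f holomorphic_on UNIV"
  shows "raise r (\<lambda>z. c * f z) z = c * raise r f z"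
  unfolding raise_def
  by (simp add: higher_deriv_cmult[OF assms] sum_distrib_left mult_ac)

lemma raise_sum:
  assumes "\<And>i. i \<in> I \<Longrightarrow> f i holomorphic_on UNIV"
  shows "raise r (\<lambda>z. \<Sum>i\<in>I. f i z) z = (\<Sum>i\<in>I. raise r (f i) z)"
  using assms
proof (induction I rule: infinite_finite_induct)
  case (insert i I)
  then show ?case
    by (simp add: raise_add holomorphic_on_sum)
qed (use raise_scale[of "\<lambda>z. 0" r 0 z] in auto)

text \<open>Raising produces \<open>\<i> ^ r\<close> times the Hermite function with the
  normalisation of level 0; the quotient of the scales corrects it.\<close>

definition raise_factor :: "nat \<Rightarrow> complex" where
  "raise_factor r = of_real (herm_scale 0) * \<i> ^ r / of_real (herm_scale r)"

lemma raise_factor_nonzero: "raise_factor r \<noteq> 0"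
  using herm_scale_pos[of r] herm_scale_pos[of 0] by (simp add: raise_factor_def)

lemma raise_bas_0: "raise r (bas \<nu> 0 n) z = raise_factor r * bas \<nu> r n z"
proof -
  have "bas \<nu> 0 n = (\<lambda>z. of_real (herm_scale 0) * gauss_exp (\<nu> + of_int n) z)"
    by (simp add: bas_def fun_eq_iff)
  then have "raise r (bas \<nu> 0 n) z = of_real (herm_scale 0) * raise r (gauss_exp (\<nu> + of_int n)) z"
    by (simp only: raise_scale[OF gauss_exp_holomorphic])
  then show ?thesis
    using herm_scale_pos[of r] by (simp add: raise_gauss_exp raise_factor_def bas_def)
qed

text \<open>At level 0 the expansion converges locally uniformly and consists of entire functions,
  so all derivatives converge and the differential operator acts term by term.\<close>

lemma raise_ssum:
  assumes "ell2 c"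
  shows "raise r (bas.ssum \<nu> 0 c) = bas.ssum \<nu> r (\<lambda>n. raise_factor r * c n)"
proof
  fix z
  let ?F = "finite_subsets_at_top (UNIV :: int set)"
  let ?S = "\<lambda>X z. \<Sum>n\<in>X. c n * bas \<nu> 0 n z"
  have hol: "(\<lambda>z. c n * bas \<nu> 0 n z) holomorphic_on A" for n A
    by (intro holomorphic_on_mult holomorphic_on_const holomorphic_bas_0)
  have "((\<lambda>X. (deriv ^^ j) (?S X) z) \<longlongrightarrow> (deriv ^^ j) (bas.ssum \<nu> 0 c) z) ?F" for j
  proof (rule higher_deriv_complex_uniform_limit)
    show "uniform_limit (ball 0 (cmod z + 1)) ?S (bas.ssum \<nu> 0 c) ?F"
      by (rule uniform_limit_on_subset[OF ssum_uniform_limit[OF assms, where R="cmod z + 1"]]) auto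
  qed (auto intro!: always_eventually holomorphic_on_sum hol)
  then have 1: "((\<lambda>X. raise r (?S X) z) \<longlongrightarrow> raise r (bas.ssum \<nu> 0 c) z) ?F"
    unfolding raise_def by (intro tendsto_intros)
  have "raise r (?S X) z = (\<Sum>n\<in>X. raise_factor r * c n * bas \<nu> r n z)" for X
    by (simp add: raise_sum[OF hol] raise_scale[OF holomorphic_bas_0] raise_bas_0 mult_ac)
  then have 2: "((\<lambda>X. raise r (?S X) z) \<longlongrightarrow> bas.ssum \<nu> r (\<lambda>n. raise_factor r * c n) z) ?F"
    using has_sum_infsum[OF bas.summable_ssum[where \<nu>=\<nu> and r=r and x=z,
          OF ell2_scale[OF assms, of "raise_factor r"]]]
    by (simp add: has_sum_def bas.ssum_def)
  show "raise r (bas.ssum \<nu> 0 c) z = bas.ssum \<nu> r (\<lambda>n. raise_factor r * c n) z"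
    using tendsto_unique[OF _ 1 2] by simp
qed

section \<open>Polyanalytic functions lie in the first levels\<close>

text \<open>The degree bound is expressed by vanishing coefficients, so that \<open>N = 0\<close>
  forces the zero polynomial.\<close>

lemma poly_antiderivative:
  fixes Q :: "complex poly"
  assumes "\<And>j. j \<ge> N \<Longrightarrow> coeff Q j = 0"
  obtains P where "pderiv P = Q" "\<And>j. j \<ge> Suc N \<Longrightarrow> coeff P j = 0"
proof
  define P where "P = (\<Sum>i<Suc N. monom (if i = 0 then 0 else coeff Q (i - 1) / of_nat i) i)"
  have coeff: "coeff P j = (if j = 0 \<or> j \<ge> Suc N then 0 else coeff Q (j - 1) / of_nat j)" for j
  proof -
    have "coeff P j = (\<Sum>i<Suc N. if i = j then (if i = 0 then 0 else coeff Q (i - 1) / of_nat i) else 0)"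
      unfolding P_def coeff_sum coeff_monom ..
    then show ?thesis by auto
  qed
  show "pderiv P = Q"
    using assms by (intro poly_eqI) (simp add: coeff_pderiv coeff del: of_nat_Suc)
  show "coeff P j = 0" if "j \<ge> Suc N" for j using that by (simp add: coeff)
qed

lemma wirt_vertical:
  assumes "wirt F a b (Complex x y)"
  shows "((\<lambda>y. F (Complex x y)) has_vector_derivative \<i> * (a - b)) (at y within S)"
proof -
  have "(Complex x has_derivative (\<lambda>h. of_real h * \<i>)) (at y within S)"
    unfolding Complex_eq by (auto intro!: derivative_eq_intros simp: mult.commute)
  from has_derivative_compose[OF this assms[unfolded wirt_def]]
  show ?thesis by (simp add: has_vector_derivative_def scaleR_conv_of_real algebra_simps)
qed

lemma wirt_horizontal:
  assumes "wirt F a b (Complex x y)"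
  shows "((\<lambda>x. F (Complex x y)) has_vector_derivative a + b) (at x within S)"
proof -
  have "((\<lambda>x. Complex x y) has_derivative (\<lambda>h. of_real h)) (at x within S)"
    unfolding Complex_eq by (auto intro!: derivative_eq_intros)
  from has_derivative_compose[OF this assms[unfolded wirt_def]]
  show ?thesis by (simp add: has_vector_derivative_def scaleR_conv_of_real algebra_simps)
qed

lemma d_zbar_periodic:
  assumes "C_diff (Suc k) g" "\<And>z. g (z + 1) = g z"
  shows "d_zbar g (z + 1) = d_zbar g z"
proof -
  have "((\<lambda>z. z + 1) has_derivative (\<lambda>h. h)) (at z)" by (auto intro!: derivative_eq_intros)
  from has_derivative_compose[OF this C_diff_wirt[OF assms(1), of "z + 1", unfolded wirt_def]]
  have "wirt g (d_z g (z + 1)) (d_zbar g (z + 1)) z" unfolding wirt_def assms(2) .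
  then show ?thesis by (rule wirtD(5)[symmetric])
qed

lemma continuous_Complex_comp:
  assumes "continuous_on UNIV G" "continuous_on A f" "continuous_on A h"
  shows "continuous_on A (\<lambda>t. G (Complex (f t) (h t)))"
  by (rule continuous_on_compose2[OF assms(1)]) (auto simp: Complex_eq intro!: continuous_intros assms)

text \<open>Averaging over a period removes the horizontal derivative, so on the mean
  \<open>d_zbar\<close> acts as \<open>\<i> / 2\<close> times the vertical derivative. As
  \<open>N\<close> of these give zero, a polynomial of degree less than \<open>N\<close> is
  left.\<close>

lemma vertical_mean_polynomial:
  assumes "C_diff N g" "\<And>z. g (z + 1) = g z" "\<And>z. (d_zbar ^^ N) g z = 0"
  obtains P where "\<And>y. integral {0..1} (\<lambda>x. g (Complex x y)) = poly P (of_real y)"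
    "\<And>j. j \<ge> N \<Longrightarrow> coeff P j = 0"
proof -
  have "\<exists>P. (\<forall>y. integral {0..1} (\<lambda>x. g (Complex x y)) = poly P (of_real y)) \<and> (\<forall>j\<ge>N. coeff P j = 0)"
    using assms
  proof (induction N arbitrary: g)
    case 0
    then show ?case by (intro exI[of _ 0]) simp
  next
    case (Suc N)
    let ?\<phi> = "d_zbar g"
    let ?G1 = "\<lambda>z. frechet_derivative g (at z) 1" and ?G2 = "\<lambda>z. frechet_derivative g (at z) \<i>"
    note w = C_diff_wirt[OF Suc.prems(1)]
    have cont: "continuous_on UNIV ?G1" "continuous_on UNIV ?G2" "continuous_on UNIV g"
      using Suc.prems(1) C_diff_continuous[of N] C_diff_continuous[of "Suc N"] by auto
    have "\<exists>Q. (\<forall>y. integral {0..1} (\<lambda>x. ?\<phi> (Complex x y)) = poly Q (of_real y)) \<and> (\<forall>j\<ge>N. coeff Q j = 0)"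
    proof (rule Suc.IH)
      show "C_diff N ?\<phi>" by (rule C_diff_d_zbar[OF Suc.prems(1)])
      show "?\<phi> (z + 1) = ?\<phi> z" for z by (rule d_zbar_periodic[OF Suc.prems(1,2)])
      show "(d_zbar ^^ N) ?\<phi> z = 0" for z
        using Suc.prems(3)[of z] by (simp add: funpow_Suc_right del: funpow.simps)
    qed
    then obtain Q where Q: "\<And>y. integral {0..1} (\<lambda>x. ?\<phi> (Complex x y)) = poly Q (of_real y)"
      "\<And>j. j \<ge> N \<Longrightarrow> coeff Q j = 0" by blast
    let ?A = "\<lambda>y. integral {0..1} (\<lambda>x. g (Complex x y))"
    have A: "(?A has_vector_derivative poly (smult (- 2 * \<i>) Q) (of_real y)) (at y)" for y
    proof -
      have "((\<lambda>y. integral (cbox 0 1) (\<lambda>x. g (Complex x y))) has_vector_derivative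
          integral (cbox 0 1) (\<lambda>x. ?G2 (Complex x y))) (at y within UNIV)"
      proof (rule leibniz_rule_vector_derivative)
        show "((\<lambda>y. g (Complex x y)) has_vector_derivative ?G2 (Complex x y)) (at y within UNIV)" for x y
          unfolding wirtD(3)[OF w] by (rule wirt_vertical[OF w])
        show "(\<lambda>x. g (Complex x y)) integrable_on cbox 0 1" for y
          by (rule integrable_continuous, rule continuous_Complex_comp[OF cont(3)]) (intro continuous_intros)+
        show "continuous_on (UNIV \<times> cbox 0 1) (\<lambda>(y, x). ?G2 (Complex x y))"
          unfolding split_beta by (rule continuous_Complex_comp[OF cont(2)]) (intro continuous_intros)+
      qed auto
      then have 1: "(?A has_vector_derivative integral {0..1} (\<lambda>x. ?G2 (Complex x y))) (at y)" by simp
      \<comment> \<open>The integral of the horizontal derivative is a difference of values one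
        period apart.\<close>
      have "((\<lambda>x. ?G1 (Complex x y)) has_integral (g (Complex 1 y) - g (Complex 0 y))) {0..1}"
        unfolding wirtD(2)[OF w] by (intro fundamental_theorem_of_calculus wirt_horizontal[OF w]) simp
      moreover have "g (Complex 1 y) = g (Complex 0 y)"
      proof -
        have "Complex 1 y = Complex 0 y + 1" by (simp add: complex_eq_iff)
        then show ?thesis using Suc.prems(2) by metis
      qed
      ultimately have "integral {0..1} (\<lambda>x. ?G1 (Complex x y)) = 0" by (simp add: integral_unique)
      moreover have int: "(\<lambda>x. ?G1 (Complex x y)) integrable_on {0..1}" "(\<lambda>x. ?G2 (Complex x y)) integrable_on {0..1}"
        by (rule integrable_continuous_interval, rule continuous_Complex_comp[OF cont(1)],
            (intro continuous_intros)+,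
            rule integrable_continuous_interval, rule continuous_Complex_comp[OF cont(2)],
            (intro continuous_intros)+)
      moreover have "poly Q (of_real y) = integral {0..1} (\<lambda>x. 1 / 2 * ?G1 (Complex x y) + \<i> / 2 * ?G2 (Complex x y))"
        unfolding Q(1)[symmetric] by (simp add: d_zbar_def add_divide_distrib)
      ultimately have q: "poly Q (of_real y) = \<i> / 2 * integral {0..1} (\<lambda>x. ?G2 (Complex x y))"
        by (subst (asm) Henstock_Kurzweil_Integration.integral_add) (auto intro!: integrable_on_mult_right)
      have "integral {0..1} (\<lambda>x. ?G2 (Complex x y)) = poly (smult (- 2 * \<i>) Q) (of_real y)"
        unfolding poly_smult q by simp
      then show ?thesis using 1 by simp
    qed
    \<comment> \<open>The factor \<open>- 2 * \<i>\<close> inverts the \<open>\<i> / 2\<close> in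
      front of the vertical derivative.\<close>
    obtain P0 where P0: "pderiv P0 = smult (- 2 * \<i>) Q" "\<And>j. j \<ge> Suc N \<Longrightarrow> coeff P0 j = 0"
      by (rule poly_antiderivative[of N "smult (- 2 * \<i>) Q"]) (use Q(2) in auto)
    have "((\<lambda>y. ?A y - poly P0 (of_real y)) has_vector_derivative 0) (at y within UNIV)" for y
    proof -
      have "((\<lambda>y. poly P0 (of_real y)) has_vector_derivative poly (pderiv P0) (of_real y)) (at y)"
        by (rule has_vector_derivative_real_field[OF poly_DERIV])
      from has_vector_derivative_diff[OF A this] show ?thesis by (simp add: P0)
    qed
    then obtain c where c: "\<And>y. ?A y - poly P0 (of_real y) = c"
      using has_vector_derivative_zero_constant[of UNIV "\<lambda>y. ?A y - poly P0 (of_real y)"] by auto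
    show ?case
    proof (intro exI[of _ "P0 + [:c:]"] conjI allI impI)
      show "?A y = poly (P0 + [:c:]) (of_real y)" for y using c[of y] by (simp add: algebra_simps)
      show "coeff (P0 + [:c:]) j = 0" if "Suc N \<le> j" for j
        using P0(2)[OF that] that by (cases j) auto
    qed
  qed
  then show ?thesis using that by blast
qed

lemma degree_less_if_coeff_0:
  assumes "\<And>j. j \<ge> N \<Longrightarrow> coeff P j = 0" "P \<noteq> 0"
  shows "degree P < N"
  using assms by (metis leading_coeff_0_iff not_le)

lemma integral_01_eq:
  fixes g :: "real \<Rightarrow> complex"
  assumes "continuous_on UNIV g"
  shows "(\<integral>x. indicator {0..<1} x *\<^sub>R g x \<partial>lborel) = integral {0..1} g"
proof -
  have [measurable]: "g \<in> borel_measurable borel" using assms by (rule borel_measurable_continuous_onI)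
  have "set_integrable lborel {0..1} g"
    unfolding set_integrable_def
    by (rule borel_integrable_compact) (auto intro: continuous_on_subset[OF assms])
  then have "(LINT x:{0..1}|lborel. g x) = integral {0..1} g"
    by (rule set_borel_integral_eq_integral(2))
  moreover have "(\<integral>x. indicator {0..<1} x *\<^sub>R g x \<partial>lborel) = (\<integral>x. indicator {0..1} x *\<^sub>R g x \<partial>lborel)"
  proof (rule integral_cong_AE)
    have "AE x in lborel. x \<noteq> (1::real)" by (rule AE_lborel_singleton)
    then show "AE x in lborel. indicator {0..<1} x *\<^sub>R g x = indicator {0..1} x *\<^sub>R g x"
      by eventually_elim (auto simp: indicator_def)
  qed measurable
  ultimately show ?thesis by (simp add: set_lebesgue_integral_def)
qed

text \<open>With the mode removed the function is periodic and still annihilated by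
  \<open>d_zbar ^^ N\<close>, so its horizontal mean is a polynomial of degree less than
  \<open>N\<close>. The vertical integral pairs this with \<open>herm r\<close>.\<close>

lemma poly_fock_orthogonal:
  assumes F: "F \<in> poly_fock \<nu> N" and r: "N \<le> r"
  shows "ip MS F (bas \<nu> r n) = 0"
proof -
  let ?\<mu> = "\<nu> + of_int n"
  \<comment> \<open>The inverse of the mode, taken without the constant exp (- pi * \<mu>^2) of
    \<open>gauss_exp\<close>; the inverse of that constant reappears in \<open>?k\<close>.\<close>
  define h where "h z = exp (- (of_real pi * z\<^sup>2 / 2 + 2 * of_real pi * \<i> * of_real ?\<mu> * z))" for z
  define g where "g z = h z * F z" for z
  have sq: "sq_int MS F" and qp: "quasi_periodic \<nu> F" and C: "C_diff N F"
    and dbar: "\<And>z. (d_zbar ^^ N) F z = 0"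
    using F by (auto simp: poly_fock_def L2_qp_iff)
  have hol: "h holomorphic_on UNIV" unfolding h_def by (intro holomorphic_intros) auto
  have Cg: "C_diff N g" unfolding g_def[abs_def] by (rule C_diff_holomorphic_mult[OF hol C])
  have "(d_zbar ^^ N) g z = 0" for z
    unfolding g_def[abs_def] d_zbar_power_holomorphic_mult[OF hol C] by (simp add: dbar)
  moreover have "g (z + 1) = g z" for z
  proof -
    have "F (z + 1) = exp (2 * of_real pi * \<i> * of_real \<nu>) * exp (of_real pi * z + of_real pi / 2) * F z"
      using qp[unfolded quasi_periodic_def, rule_format, of z 1] by simp
    moreover have "h (z + 1) * (exp (2 * of_real pi * \<i> * of_real \<nu>) * exp (of_real pi * z + of_real pi / 2))
        = h z * exp (- (2 * of_int n * of_real pi * \<i>))"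
      unfolding h_def exp_add[symmetric]
      by (rule arg_cong[where f=exp]) (simp add: power2_eq_square field_simps)
    moreover have "exp (- (2 * of_int n * of_real pi * \<i>)) = 1"
      using exp_integer_2pi[of "of_int (- n)"] by simp
    ultimately show ?thesis by (simp add: g_def mult.assoc[symmetric])
  qed
  ultimately obtain P where P: "\<And>y. integral {0..1} (\<lambda>x. g (Complex x y)) = poly P (of_real y)"
    "\<And>j. j \<ge> N \<Longrightarrow> coeff P j = 0"
    using vertical_mean_polynomial[OF Cg] by blast
  have contF: "continuous_on UNIV F" by (rule C_diff_continuous[OF C])
  have contg: "continuous_on UNIV g" by (rule C_diff_continuous[OF Cg])
  have int: "integrable MS (\<lambda>z. F z * cnj (bas \<nu> r n z))" by (intro ip_integrable sq sq_int_bas)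
  have meas: "(\<lambda>z. F z * cnj (bas \<nu> r n z)) \<in> borel_measurable borel"
    by (intro borel_measurable_continuous_onI continuous_intros contF)
  let ?k = "of_real (herm_scale r * exp (pi * ?\<mu>\<^sup>2)) :: complex"
  let ?b = "\<lambda>y. ?k * (poly (herm r) (of_real (y + ?\<mu>)) * of_real (gauss (y + ?\<mu>)))"
  have eq: "weight z *\<^sub>R (F z * cnj (bas \<nu> r n z)) = (indicator {0..<1} (Re z) *\<^sub>R g z) * ?b (Im z)" for z
  proof -
    have Fg: "F z = g z * (gauss_exp ?\<mu> z * of_real (exp (pi * ?\<mu>\<^sup>2)))"
    proof -
      have "h z * (gauss_exp ?\<mu> z * of_real (exp (pi * ?\<mu>\<^sup>2))) = 1"
        unfolding h_def gauss_exp_def exp_of_real[symmetric] exp_add[symmetric] by simp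
      then show ?thesis unfolding g_def by (simp add: mult_ac)
    qed
    have gg: "gauss_exp ?\<mu> z * cnj (gauss_exp ?\<mu> z) * of_real (exp (- pi * (cmod z)\<^sup>2)) = of_real (gauss (Im z + ?\<mu>))"
      unfolding cmod_gauss_exp_square[symmetric] of_real_mult complex_norm_square ..
    have "weight z *\<^sub>R (F z * cnj (bas \<nu> r n z)) = indicator {0..<1} (Re z) *\<^sub>R
       (g z * (?k * (poly (herm r) (of_real (Im z + ?\<mu>)) *
         (gauss_exp ?\<mu> z * cnj (gauss_exp ?\<mu> z) * of_real (exp (- pi * (cmod z)\<^sup>2))))))"
      unfolding Fg bas_def complex_cnj_mult cnj_poly_herm weight_def scaleR_conv_of_real
      by (simp add: indicator_def strip_def mult_ac)
    then show ?thesis unfolding gg by (simp add: mult_ac)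
  qed
  have "ip MS F (bas \<nu> r n) = (\<integral>z. (indicator {0..<1} (Re z) *\<^sub>R g z) * ?b (Im z) \<partial>lborel)"
    unfolding ip_def integral_MS_borel[OF meas] eq ..
  also have "\<dots> = (\<integral>y. (\<integral>x. (indicator {0..<1} (Re (Complex x y)) *\<^sub>R g (Complex x y)) * ?b (Im (Complex x y)) \<partial>lborel) \<partial>lborel)"
    using int unfolding integral_MS_borel[OF meas] eq by (rule integral_complex_iterated)
  also have "\<dots> = (\<integral>y. (\<integral>x. indicator {0..<1} x *\<^sub>R g (Complex x y) \<partial>lborel) * ?b y \<partial>lborel)"
    unfolding complex.sel integral_mult_left_zero ..
  also have "\<dots> = (\<integral>y. poly P (of_real y) * ?b y \<partial>lborel)"
    by (simp only: integral_01_eq[OF continuous_Complex_comp[OF contg continuous_on_id continuous_on_const]] P(1))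
  also have "\<dots> = (\<integral>t. poly P (of_real (- ?\<mu> + 1 * t)) * ?b (- ?\<mu> + 1 * t) \<partial>lborel)"
    using lborel_integral_real_affine[of 1 "\<lambda>y. poly P (of_real y) * ?b y" "- ?\<mu>"] by (simp only: abs_one scaleR_one)
  also have "\<dots> = (\<integral>t. ?k * (poly (herm r * pcompose P [:- of_real ?\<mu>, 1:]) (of_real t) * exp (0 * of_real t) * of_real (gauss t)) \<partial>lborel)"
    by (rule Bochner_Integration.integral_cong) (simp_all add: poly_pcompose mult_ac)
  also have "\<dots> = ?k * gauss_int 0 (herm r * pcompose P [:- of_real ?\<mu>, 1:])"
    unfolding gauss_int_def by (rule integral_mult_right_zero)
  also have "gauss_int 0 (herm r * pcompose P [:- of_real ?\<mu>, 1:]) = 0"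
  proof (cases "P = 0")
    case False
    have "degree P < N" by (rule degree_less_if_coeff_0[OF P(2) False])
    then have "degree (pcompose P [:- of_real ?\<mu>, 1:]) < r" using r by (simp add: degree_pcompose)
    then show ?thesis by (rule gauss_int_herm_low_degree)
  qed simp
  finally show ?thesis by simp
qed

lemma continuous_levels:
  assumes "sq_int MS F"
  shows "continuous_on UNIV (levels \<nu> m F)"
  unfolding levels_def[abs_def] bas.proj_def
  by (intro continuous_on_sum continuous_ssum bas.ell2_coeffs assms)

lemma quasi_periodic_diff:
  "quasi_periodic \<nu> F \<Longrightarrow> quasi_periodic \<nu> G \<Longrightarrow> quasi_periodic \<nu> (\<lambda>z. F z - G z)"
  by (simp add: quasi_periodic_def right_diff_distrib)

lemma quasi_periodic_sum:
  "(\<And>i. i \<in> I \<Longrightarrow> quasi_periodic \<nu> (F i)) \<Longrightarrow> quasi_periodic \<nu> (\<lambda>z. \<Sum>i\<in>I. F i z)"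
  by (simp add: quasi_periodic_def sum_distrib_left)

text \<open>The residual norms are constant from \<open>N\<close> on and tend to zero; continuity
  and quasi-periodicity turn the resulting equality almost everywhere into equality
  everywhere.\<close>

lemma poly_fock_levels:
  assumes F: "F \<in> poly_fock \<nu> N"
  shows "F z = levels \<nu> N F z"
proof -
  have sq: "sq_int MS F" and qp: "quasi_periodic \<nu> F" and cont: "continuous_on UNIV F"
    using F by (auto simp: poly_fock_def L2_qp_iff intro: C_diff_continuous)
  have proj: "bas.proj \<nu> r F z = 0" if "N \<le> r" for r z
    by (simp add: bas.proj_def bas.ssum_def poly_fock_orthogonal[OF F that])
  have levels: "levels \<nu> m F = levels \<nu> N F" if "N \<le> m" for m
    unfolding levels_def fun_eq_iff
    by (intro allI sum.mono_neutral_right) (use that proj in auto)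
  have "\<forall>\<^sub>F m in sequentially. nrm MS (\<lambda>z. F z - levels \<nu> m F z) = nrm MS (\<lambda>z. F z - levels \<nu> N F z)"
    using eventually_ge_at_top[of N] by eventually_elim (subst levels, assumption, rule refl)
  then have "(\<lambda>m. nrm MS (\<lambda>z. F z - levels \<nu> m F z)) \<longlonglongrightarrow> nrm MS (\<lambda>z. F z - levels \<nu> N F z)"
    by (rule tendsto_eventually)
  moreover have "(\<lambda>m. nrm MS (\<lambda>z. F z - levels \<nu> m F z)) \<longlonglongrightarrow> 0"
    using resolved_if_sq_int[OF sq, of \<nu>] unfolding resolved_def by simp
  ultimately have "nrm MS (\<lambda>z. F z - levels \<nu> N F z) = 0" by (rule LIMSEQ_unique)
  then have "AE z in MS. F z - levels \<nu> N F z = 0"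
    by (simp add: nrm_eq_0_iff[OF sq_int_diff[OF sq sq_int_levels[OF sq]]])
  moreover have "continuous_on UNIV (\<lambda>z. F z - levels \<nu> N F z)"
    by (intro continuous_on_diff cont continuous_levels sq)
  moreover have "quasi_periodic \<nu> (\<lambda>z. F z - levels \<nu> N F z)"
    unfolding levels_def bas.proj_def by (intro quasi_periodic_diff qp quasi_periodic_sum quasi_periodic_ssum)
  ultimately have "F z - levels \<nu> N F z = 0" by (intro continuous_qp_eq_0)
  then show ?thesis by simp
qed

text \<open>Entire functions are the case \<open>N = 1\<close>, where a single level
  remains.\<close>

lemma fock_iff: "f \<in> fock \<nu> \<longleftrightarrow> (\<exists>c. ell2 c \<and> f = bas.ssum \<nu> 0 c)"
proof
  assume f: "f \<in> fock \<nu>"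
  then have hol: "f holomorphic_on UNIV" and L2: "f \<in> L2_qp \<nu>" by (auto simp: fock_def)
  have "polyanalytic 1 f" unfolding polyanalytic_def by (intro exI[of _ "\<lambda>_. f"]) (use hol in auto)
  then have "f \<in> poly_fock \<nu> 1" using L2 by (rule polyanalytic_poly_fock)
  then have "f = bas.ssum \<nu> 0 (\<lambda>n. ip MS f (bas \<nu> 0 n))"
    using poly_fock_levels[of f \<nu> 1] by (simp add: levels_def bas.proj_def fun_eq_iff)
  then show "\<exists>c. ell2 c \<and> f = bas.ssum \<nu> 0 c"
    using L2 bas.ell2_coeffs unfolding L2_qp_iff by blast
next
  assume "\<exists>c. ell2 c \<and> f = bas.ssum \<nu> 0 c"
  then show "f \<in> fock \<nu>" by (auto simp: fock_def holomorphic_ssum_0 ssum_L2_qp)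
qed

text \<open>Raising acts on coefficients as a nonzero constant, so it maps level 0 onto level
  \<open>r\<close>.\<close>

lemma true_poly_fock_iff: "F \<in> true_poly_fock \<nu> r \<longleftrightarrow> (\<exists>c. ell2 c \<and> F = bas.ssum \<nu> r c)"
proof
  assume "F \<in> true_poly_fock \<nu> r"
  then obtain a c where c: "ell2 c" and F: "F = (\<lambda>z. a * raise r (bas.ssum \<nu> 0 c) z)"
    unfolding true_poly_fock_eq fock_iff by blast
  have "F = bas.ssum \<nu> r (\<lambda>n. a * (raise_factor r * c n))"
    unfolding F raise_ssum[OF c] by (simp add: bas.ssum_scale fun_eq_iff)
  then show "\<exists>c. ell2 c \<and> F = bas.ssum \<nu> r c" using ell2_scale[OF ell2_scale[OF c]] by blast
next
  assume "\<exists>c. ell2 c \<and> F = bas.ssum \<nu> r c"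
  then obtain c where c: "ell2 c" and F: "F = bas.ssum \<nu> r c" by blast
  have d: "ell2 (\<lambda>n. inverse (raise_factor r) * c n)" by (rule ell2_scale[OF c])
  have "raise r (bas.ssum \<nu> 0 (\<lambda>n. inverse (raise_factor r) * c n)) = F"
    unfolding raise_ssum[OF d] F using raise_factor_nonzero[of r] by (simp flip: mult.assoc)
  then have "F = (\<lambda>z. 1 * raise r (bas.ssum \<nu> 0 (\<lambda>n. inverse (raise_factor r) * c n)) z)" by simp
  then show "F \<in> true_poly_fock \<nu> r" unfolding true_poly_fock_eq fock_iff using d by blast
qed

lemma polyanalytic_ssum:
  assumes "ell2 c"
  shows "polyanalytic (Suc r) (bas.ssum \<nu> r c)"
proof -
  have d: "ell2 (\<lambda>n. inverse (raise_factor r) * c n)" by (rule ell2_scale[OF assms])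
  have "raise r (bas.ssum \<nu> 0 (\<lambda>n. inverse (raise_factor r) * c n)) = bas.ssum \<nu> r c"
    unfolding raise_ssum[OF d] using raise_factor_nonzero[of r] by (simp flip: mult.assoc)
  then show ?thesis using raise_polyanalytic[OF holomorphic_ssum_0[OF d, of \<nu>], of r] by simp
qed

section \<open>Poisson summation\<close>

definition echar :: "int \<Rightarrow> real \<Rightarrow> complex" where
  "echar k x = exp (2 * of_real pi * \<i> * of_int k * of_real x)"

lemma continuous_echar [continuous_intros]: "continuous_on A (echar k)"
  unfolding echar_def by (intro continuous_intros)

lemma norm_echar [simp]: "cmod (echar k x) = 1"
  by (simp add: echar_def norm_exp_eq_Re)

lemma echar_add_int: "echar k (x + of_int n) = echar k x"
proof -
  have "echar k (x + of_int n) = echar k x * exp (2 * of_int (k * n) * of_real pi * \<i>)"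
    unfolding echar_def exp_add[symmetric] by (rule arg_cong[where f=exp]) (simp add: algebra_simps)
  moreover have "exp (2 * of_int (k * n) * of_real pi * \<i>) = 1"
    using exp_integer_2pi[of "of_int (k * n)"] by (simp add: mult_ac)
  ultimately show ?thesis by simp
qed

lemma echar_mult: "echar k x * echar m x = echar (k + m) x"
  unfolding echar_def exp_add[symmetric] by (rule arg_cong[where f=exp]) (simp add: algebra_simps)

lemma periodic_int:
  fixes d :: "real \<Rightarrow> complex"
  assumes "\<And>x. d (x + 1) = d x"
  shows "d (x + of_int k) = d x"
proof -
  have nat: "d (x + real n) = d x" for n x
  proof (induction n)
    case (Suc n)
    have "d (x + real (Suc n)) = d ((x + real n) + 1)" by (simp add: algebra_simps)
    then show ?case using assms Suc by simp
  qed simp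
  show ?thesis
  proof (cases k rule: int_cases2)
    case (nonneg n)
    then show ?thesis using nat[of x n] by simp
  next
    case (nonpos n)
    then show ?thesis using nat[of "x - real n" n] by simp
  qed
qed

text \<open>Uniqueness of Fourier coefficients follows from the completeness of the basis for \<open>\<nu> = 0\<close>,
  applied to the product of the periodic function with a Gaussian.\<close>

lemma fourier_unique:
  fixes d :: "real \<Rightarrow> complex"
  assumes cont: "continuous_on UNIV d" and per: "\<And>x. d (x + 1) = d x"
    and coeff: "\<And>k. (\<integral>x. indicator {0..<1} x *\<^sub>R (d x * echar k x) \<partial>lborel) = 0"
  shows "d x = 0"
proof -
  define F where "F z = d (Re z) * gauss_exp 0 z" for z
  have contF: "continuous_on UNIV F"
    unfolding F_def[abs_def] by (intro continuous_intros continuous_on_compose2[OF cont]) auto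
  have qp: "quasi_periodic 0 F"
  proof -
    have "gauss_exp 0 z = inverse (of_real (herm_scale 0)) * bas 0 0 0 z" for z
      using herm_scale_pos[of 0] by (simp add: bas_def)
    then have "F z = d (Re z) * (inverse (of_real (herm_scale 0)) * bas 0 0 0 z)" for z by (simp add: F_def)
    then show ?thesis
      using quasi_periodic_bas[of 0 0 0] periodic_int[of d, OF per]
      by (simp add: quasi_periodic_def mult_ac)
  qed
  have sq: "sq_int MS F"
  proof -
    have "bounded (d ` {0..1})"
      by (intro compact_imp_bounded compact_continuous_image continuous_on_subset[OF cont]) auto
    then obtain B where "\<forall>y\<in>d ` {0..1}. norm y \<le> B" unfolding bounded_iff by blast
    then have B: "\<And>x. x \<in> {0..1} \<Longrightarrow> cmod (d x) \<le> B" by blast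
    show ?thesis
    proof (rule sq_int_bound[OF borel_measurable_MS_if_continuous[OF contF]])
      show "integrable MS (\<lambda>z. B\<^sup>2 * (exp (0 * \<bar>Im z + 0\<bar>) * cmod (gauss_exp 0 z))\<^sup>2)"
        by (intro integrable_mult_right integrable_exp_abs_gauss_exp)
      have "(cmod (F z))\<^sup>2 \<le> B\<^sup>2 * (exp (0 * \<bar>Im z + 0\<bar>) * cmod (gauss_exp 0 z))\<^sup>2" if "z \<in> strip" for z
      proof -
        have "(cmod (d (Re z)))\<^sup>2 \<le> B\<^sup>2"
          using that B[of "Re z"] by (intro power_mono) (auto simp: strip_def)
        then show ?thesis by (simp add: F_def norm_mult power_mult_distrib mult_right_mono)
      qed
      then show "AE z in MS. (cmod (F z))\<^sup>2 \<le> B\<^sup>2 * (exp (0 * \<bar>Im z + 0\<bar>) * cmod (gauss_exp 0 z))\<^sup>2"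
        using AE_MS_strip by auto
    qed
  qed
  have "ip MS F (bas 0 r n) = 0" for r n
  proof -
    have int: "integrable MS (\<lambda>z. F z * cnj (bas 0 r n z))" by (intro ip_integrable sq sq_int_bas)
    have meas: "(\<lambda>z. F z * cnj (bas 0 r n z)) \<in> borel_measurable borel"
      by (intro borel_measurable_continuous_onI continuous_intros contF)
    let ?b = "\<lambda>y. of_real (herm_scale r) * poly (herm r) (of_real (y + of_int n)) *
      of_real (exp (- pi * (y + 0)\<^sup>2) * exp (- pi * (y + of_int n)\<^sup>2)) :: complex"
    have eq: "weight z *\<^sub>R (F z * cnj (bas 0 r n z)) =
        (indicator {0..<1} (Re z) *\<^sub>R (d (Re z) * echar (- n) (Re z))) * ?b (Im z)" for z
    proof -
      have "weight z *\<^sub>R (F z * cnj (bas 0 r n z)) = indicator {0..<1} (Re z) *\<^sub>R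
         (d (Re z) * (of_real (herm_scale r) * poly (herm r) (of_real (Im z + of_int n)) *
         (gauss_exp 0 z * cnj (gauss_exp (of_int n) z) * of_real (exp (- pi * (cmod z)\<^sup>2)))))"
        unfolding F_def bas_def complex_cnj_mult cnj_poly_herm weight_def scaleR_conv_of_real
        by (simp add: indicator_def strip_def mult_ac)
      then show ?thesis unfolding gauss_exp_mult_cnj by (simp add: echar_def mult_ac)
    qed
    have "ip MS F (bas 0 r n) =
        (\<integral>z. (indicator {0..<1} (Re z) *\<^sub>R (d (Re z) * echar (- n) (Re z))) * ?b (Im z) \<partial>lborel)"
      unfolding ip_def integral_MS_borel[OF meas] eq ..
    also have "\<dots> = (\<integral>y. (\<integral>x. (indicator {0..<1} (Re (Complex x y)) *\<^sub>R
        (d (Re (Complex x y)) * echar (- n) (Re (Complex x y)))) * ?b (Im (Complex x y)) \<partial>lborel) \<partial>lborel)"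
      using int unfolding integral_MS_borel[OF meas] eq by (rule integral_complex_iterated)
    also have "\<dots> = 0"
      unfolding complex.sel integral_mult_left_zero coeff by simp
    finally show ?thesis .
  qed
  then have "AE z in MS. F z = 0" by (rule AE_eq_0_if_orthogonal[OF sq])
  then have "F (of_real x) = 0" by (rule continuous_qp_eq_0[OF contF qp])
  then show ?thesis by (simp add: F_def gauss_exp_def)
qed

lemma integral_echar: "(\<integral>x. indicator {0..<1} x *\<^sub>R echar k x \<partial>lborel) = of_bool (k = 0)"
  unfolding echar_def by (rule integral_exp_01)

text \<open>Absolute summability dominates the partial sums, and the characters are orthonormal over
  a period.\<close>

lemma fourier_coeff_series:
  fixes c :: "int \<Rightarrow> complex"
  assumes c: "(\<lambda>k. cmod (c k)) summable_on UNIV"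
  shows "(\<integral>x. indicator {0..<1} x *\<^sub>R ((\<Sum>\<^sub>\<infinity>k. c k * echar k x) * echar (- m) x) \<partial>lborel) = c m"
proof -
  let ?S = "\<lambda>j x. \<Sum>k\<in>{- int j..int j}. c k * echar k x"
  let ?T = "\<Sum>\<^sub>\<infinity>k. cmod (c k)"
  have summ: "(\<lambda>k. c k * echar k x) summable_on UNIV" for x
    by (rule abs_summable_summable) (simp add: norm_mult c)
  have lim: "(\<lambda>j. ?S j x) \<longlonglongrightarrow> (\<Sum>\<^sub>\<infinity>k. c k * echar k x)" for x
    by (intro has_sum_int_LIMSEQ has_sum_infsum summ)
  have meas: "?S j \<in> borel_measurable borel" for j
    by (intro borel_measurable_continuous_onI continuous_intros)
  have [measurable]: "echar k \<in> borel_measurable borel" for k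
    by (intro borel_measurable_continuous_onI continuous_intros)
  have [measurable]: "(\<lambda>x. \<Sum>\<^sub>\<infinity>k. c k * echar k x) \<in> borel_measurable borel"
    by (rule borel_measurable_LIMSEQ_metric[OF meas lim])
  have "(\<lambda>j. \<integral>x. indicator {0..<1} x *\<^sub>R (?S j x * echar (- m) x) \<partial>lborel) \<longlonglongrightarrow>
     (\<integral>x. indicator {0..<1} x *\<^sub>R ((\<Sum>\<^sub>\<infinity>k. c k * echar k x) * echar (- m) x) \<partial>lborel)"
  proof (rule integral_dominated_convergence)
    show "integrable lborel (\<lambda>x::real. indicator {0..<1} x *\<^sub>R ?T)"
      by (intro integrable_indicator_01 continuous_intros)
    show "AE x in lborel. (\<lambda>j. indicator {0..<1} x *\<^sub>R (?S j x * echar (- m) x)) \<longlonglongrightarrow>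
        indicator {0..<1} x *\<^sub>R ((\<Sum>\<^sub>\<infinity>k. c k * echar k x) * echar (- m) x)"
      by (intro AE_I2 tendsto_intros lim)
    have "cmod (?S j x) \<le> ?T" for j x
    proof -
      have "cmod (?S j x) \<le> (\<Sum>k\<in>{- int j..int j}. cmod (c k))"
        by (rule sum_norm_le) (simp add: norm_mult)
      also have "\<dots> \<le> ?T" by (intro finite_sum_le_infsum c) auto
      finally show ?thesis .
    qed
    then show "AE x in lborel. norm (indicator {0..<1} x *\<^sub>R (?S j x * echar (- m) x)) \<le> indicator {0..<1} x *\<^sub>R ?T" for j
      by (intro AE_I2) (simp add: norm_mult indicator_def)
  qed measurable
  moreover have "(\<integral>x. indicator {0..<1} x *\<^sub>R (?S j x * echar (- m) x) \<partial>lborel) = c m" if "j \<ge> nat \<bar>m\<bar>" for j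
  proof -
    have "(\<integral>x. indicator {0..<1} x *\<^sub>R (?S j x * echar (- m) x) \<partial>lborel)
        = (\<integral>x. (\<Sum>k\<in>{- int j..int j}. c k * (indicator {0..<1} x *\<^sub>R echar (k - m) x)) \<partial>lborel)"
      using echar_mult[of _ _ "- m"]
      by (intro Bochner_Integration.integral_cong refl)
        (simp add: sum_distrib_right scaleR_sum_right mult.assoc)
    also have "\<dots> = (\<Sum>k\<in>{- int j..int j}. \<integral>x. c k * (indicator {0..<1} x *\<^sub>R echar (k - m) x) \<partial>lborel)"
      by (intro Bochner_Integration.integral_sum integrable_mult_right integrable_indicator_01 continuous_echar)
    also have "\<dots> = (\<Sum>k\<in>{- int j..int j}. c k * of_bool (k - m = 0))"
      by (simp only: integral_mult_right_zero integral_echar)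
    also have "\<dots> = (\<Sum>k\<in>{- int j..int j}. if m = k then c k else 0)"
      by (intro sum.cong) auto
    also have "\<dots> = c m" using that by auto
    finally show ?thesis .
  qed
  then have "(\<lambda>j. \<integral>x. indicator {0..<1} x *\<^sub>R (?S j x * echar (- m) x) \<partial>lborel) \<longlonglongrightarrow> c m"
    by (intro tendsto_eventually) (auto simp: eventually_sequentially)
  ultimately show ?thesis by (rule LIMSEQ_unique)
qed

section \<open>Periodization of functions with Gaussian decay\<close>

context
  fixes f :: "real \<Rightarrow> complex" and B :: real
  assumes cont: "continuous_on UNIV f" and bound: "\<And>t. cmod (f t) \<le> B * exp (- pi * t\<^sup>2)"
begin

text \<open>The Gaussian bound is weakened to exp (- |n|), uniformly for bounded \<open>x\<close>,
  so that one majorant serves all sums over translates.\<close>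

lemma translate_bound:
  assumes "\<bar>x\<bar> \<le> R"
  shows "cmod (f (x + of_int n)) \<le> B * exp (1 + R) * exp (- \<bar>real_of_int n\<bar>)"
proof -
  have B: "0 \<le> B" using order_trans[OF norm_ge_zero bound[of 0]] by simp
  define t where "t = x + real_of_int n"
  have "0 \<le> (\<bar>t\<bar> - 1)\<^sup>2" by simp
  then have "2 * \<bar>t\<bar> \<le> t\<^sup>2 + 1" by (simp add: power2_diff)
  moreover have "2 * t\<^sup>2 \<le> pi * t\<^sup>2" using pi_ge_two by (intro mult_right_mono) auto
  moreover have "0 \<le> t\<^sup>2" by simp
  ultimately have "- (pi * t\<^sup>2) \<le> 1 - \<bar>t\<bar>" by linarith
  also have "\<dots> \<le> 1 + R - \<bar>real_of_int n\<bar>" unfolding t_def using assms by linarith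
  finally have "exp (- pi * t\<^sup>2) \<le> exp (1 + R) * exp (- \<bar>real_of_int n\<bar>)"
    by (simp flip: exp_add)
  then show ?thesis
    using order_trans[OF bound[of t] mult_left_mono[OF _ B]] by (simp add: t_def mult.assoc)
qed

lemma translates_summable: "(\<lambda>n. f (x + of_int n)) summable_on UNIV"
proof (rule abs_summable_summable)
  show "(\<lambda>n. norm (f (x + of_int n))) summable_on UNIV"
    by (rule summable_on_comparison_test[OF summable_on_cmult_right[OF summable_exp_int] translate_bound[OF order_refl]]) auto
qed

lemma continuous_periodization: "continuous_on UNIV (\<lambda>x. \<Sum>\<^sub>\<infinity>n. f (x + of_int n))"
proof -
  have "isCont (\<lambda>x. \<Sum>\<^sub>\<infinity>n. f (x + of_int n)) x" for x
  proof (rule continuous_on_interior)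
    let ?R = "\<bar>x\<bar> + 1"
    have "uniform_limit (cball 0 ?R) (\<lambda>X x. \<Sum>n\<in>X. f (x + of_int n)) (\<lambda>x. \<Sum>\<^sub>\<infinity>n. f (x + of_int n))
        (finite_subsets_at_top UNIV)"
    proof (rule Weierstrass_m_test_general)
      show "norm (f (y + of_int n)) \<le> B * exp (1 + ?R) * exp (- \<bar>real_of_int n\<bar>)" if "y \<in> cball 0 ?R" for y n
        by (rule translate_bound) (use that in simp)
      show "(\<lambda>n. B * exp (1 + ?R) * exp (- \<bar>real_of_int n\<bar>)) summable_on UNIV"
        by (intro summable_on_cmult_right summable_exp_int)
    qed
    then show "continuous_on (cball 0 ?R) (\<lambda>x. \<Sum>\<^sub>\<infinity>n. f (x + of_int n))"
      by (rule uniform_limit_theorem[rotated])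
        (auto intro!: always_eventually continuous_on_sum continuous_on_compose2[OF cont] continuous_intros)
    show "x \<in> interior (cball 0 ?R)" by (simp add: abs_real_def)
  qed
  then show ?thesis by (simp add: continuous_on_eq_continuous_at)
qed

lemma integrable_mult_echar: "integrable lborel (\<lambda>t. f t * echar k t)"
proof (rule Bochner_Integration.integrable_bound)
  show "integrable lborel (\<lambda>t. B * exp (- pi * t\<^sup>2))"
    by (intro integrable_mult_right gaussian_integral) simp
  show "(\<lambda>t. f t * echar k t) \<in> borel_measurable lborel"
    unfolding measurable_lborel2 by (intro borel_measurable_continuous_onI continuous_intros cont)
  show "AE t in lborel. norm (f t * echar k t) \<le> norm (B * exp (- pi * t\<^sup>2))"
    using bound by (intro AE_I2) (simp add: norm_mult, metis abs_ge_self order_trans)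
qed

text \<open>Unfolding: the translates of the unit interval tile the line, and the character is
  invariant under integer shifts.\<close>

lemma fourier_coeff_periodization:
  "(\<integral>x. indicator {0..<1} x *\<^sub>R ((\<Sum>\<^sub>\<infinity>n. f (x + of_int n)) * echar k x) \<partial>lborel) = (\<integral>t. f t * echar k t \<partial>lborel)"
proof -
  let ?A = "\<lambda>j. {- int j..int j}"
  let ?S = "\<lambda>j x. \<Sum>n\<in>?A j. f (x + of_int n)"
  let ?g = "\<lambda>t. f t * echar k t"
  let ?M = "\<lambda>n. B * exp (1 + 1) * exp (- \<bar>real_of_int n\<bar>)"
  have [measurable]: "f \<in> borel_measurable borel" by (intro borel_measurable_continuous_onI cont)
  have [measurable]: "echar k \<in> borel_measurable borel" by (intro borel_measurable_continuous_onI continuous_intros)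
  have [measurable]: "(\<lambda>x. \<Sum>\<^sub>\<infinity>n. f (x + of_int n)) \<in> borel_measurable borel"
    by (intro borel_measurable_continuous_onI continuous_periodization)
  have B: "0 \<le> B" using order_trans[OF norm_ge_zero bound[of 0]] by simp
  have contn: "continuous_on UNIV (\<lambda>x. f (x + of_int n))" for n
    by (rule continuous_on_compose2[OF cont]) (auto intro!: continuous_intros)
  have "(\<lambda>j. \<integral>x. indicator {0..<1} x *\<^sub>R (?S j x * echar k x) \<partial>lborel) \<longlonglongrightarrow>
     (\<integral>x. indicator {0..<1} x *\<^sub>R ((\<Sum>\<^sub>\<infinity>n. f (x + of_int n)) * echar k x) \<partial>lborel)"
  proof (rule integral_dominated_convergence)
    show "integrable lborel (\<lambda>x::real. indicator {0..<1} x *\<^sub>R (\<Sum>\<^sub>\<infinity>n. ?M n))"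
      by (intro integrable_indicator_01 continuous_intros)
    show "AE x in lborel. (\<lambda>j. indicator {0..<1} x *\<^sub>R (?S j x * echar k x)) \<longlonglongrightarrow>
        indicator {0..<1} x *\<^sub>R ((\<Sum>\<^sub>\<infinity>n. f (x + of_int n)) * echar k x)"
      by (intro AE_I2 tendsto_intros has_sum_int_LIMSEQ has_sum_infsum translates_summable)
    have "cmod (?S j x) \<le> (\<Sum>\<^sub>\<infinity>n. ?M n)" if "x \<in> {0..<1}" for j x
    proof -
      have "cmod (?S j x) \<le> (\<Sum>n\<in>?A j. ?M n)"
        by (rule sum_norm_le, rule translate_bound) (use that in auto)
      also have "\<dots> \<le> (\<Sum>\<^sub>\<infinity>n. ?M n)"
        using B by (intro finite_sum_le_infsum summable_on_cmult_right summable_exp_int) auto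
      finally show ?thesis .
    qed
    then show "AE x in lborel. norm (indicator {0..<1} x *\<^sub>R (?S j x * echar k x)) \<le>
        indicator {0..<1} x *\<^sub>R (\<Sum>\<^sub>\<infinity>n. ?M n)" for j
      by (intro AE_I2) (simp add: norm_mult indicator_def)
  qed measurable
  moreover have "(\<integral>x. indicator {0..<1} x *\<^sub>R (?S j x * echar k x) \<partial>lborel) =
      (\<integral>t. (\<Sum>n\<in>?A j. of_bool (\<lfloor>t\<rfloor> = n)) *\<^sub>R ?g t \<partial>lborel)" for j
  proof -
    \<comment> \<open>The unit cell that contains \<open>t\<close> is numbered by its floor, so the
      cut-offs add up to the indicator of a growing interval.\<close>
    have ind: "indicator {0..<1} (t - of_int n) = (of_bool (\<lfloor>t\<rfloor> = n) :: real)" for t :: real and n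
      by (auto simp: indicator_def floor_eq_iff)
    have trans: "(\<integral>x. indicator {0..<1} x *\<^sub>R (f (x + of_int n) * echar k x) \<partial>lborel)
        = (\<integral>t. of_bool (\<lfloor>t\<rfloor> = n) *\<^sub>R ?g t \<partial>lborel)"
      and int: "integrable lborel (\<lambda>t. of_bool (\<lfloor>t\<rfloor> = n) *\<^sub>R ?g t)" for n
    proof -
      let ?h = "\<lambda>x. indicator {0..<1} x *\<^sub>R (f (x + of_int n) * echar k x)"
      have h: "?h (- of_int n + 1 * t) = of_bool (\<lfloor>t\<rfloor> = n) *\<^sub>R ?g t" for t
        using ind[of t n] echar_add_int[of k t "- n"] by (simp add: add.commute)
      have "integrable lborel ?h"
        by (intro integrable_indicator_01 continuous_intros contn)
      from lborel_integrable_real_affine[OF this, of 1 "- of_int n"]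
      show "integrable lborel (\<lambda>t. of_bool (\<lfloor>t\<rfloor> = n) *\<^sub>R ?g t)" by (simp only: h)
      show "(\<integral>x. ?h x \<partial>lborel) = (\<integral>t. of_bool (\<lfloor>t\<rfloor> = n) *\<^sub>R ?g t \<partial>lborel)"
        using lborel_integral_real_affine[of 1 ?h "- of_int n"] by (simp only: h) simp
    qed
    have "(\<integral>x. indicator {0..<1} x *\<^sub>R (?S j x * echar k x) \<partial>lborel) =
        (\<integral>x. (\<Sum>n\<in>?A j. indicator {0..<1} x *\<^sub>R (f (x + of_int n) * echar k x)) \<partial>lborel)"
      by (simp add: sum_distrib_right scaleR_sum_right)
    also have "\<dots> = (\<Sum>n\<in>?A j. \<integral>x. indicator {0..<1} x *\<^sub>R (f (x + of_int n) * echar k x) \<partial>lborel)"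
      by (intro Bochner_Integration.integral_sum integrable_indicator_01 continuous_intros contn)
    also have "\<dots> = (\<integral>t. (\<Sum>n\<in>?A j. of_bool (\<lfloor>t\<rfloor> = n) *\<^sub>R ?g t) \<partial>lborel)"
      unfolding trans by (rule Bochner_Integration.integral_sum[symmetric]) (rule int)
    finally show ?thesis by (simp only: scaleR_sum_left)
  qed
  moreover have "(\<lambda>j. \<integral>t. (\<Sum>n\<in>?A j. of_bool (\<lfloor>t\<rfloor> = n)) *\<^sub>R ?g t \<partial>lborel) \<longlonglongrightarrow> (\<integral>t. ?g t \<partial>lborel)"
  proof (rule integral_dominated_convergence)
    show "integrable lborel (\<lambda>t. norm (?g t))" by (intro integrable_norm integrable_mult_echar)
    have sum: "(\<Sum>n\<in>?A j. of_bool (\<lfloor>t\<rfloor> = n)) = (of_bool (\<lfloor>t\<rfloor> \<in> ?A j) :: real)" for j and t :: real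
      by (simp add: of_bool_def)
    have "(\<lambda>j. (\<Sum>n\<in>?A j. of_bool (\<lfloor>t\<rfloor> = n)) *\<^sub>R ?g t) \<longlonglongrightarrow> ?g t" for t
    proof (rule tendsto_eventually)
      show "\<forall>\<^sub>F j in sequentially. (\<Sum>n\<in>?A j. of_bool (\<lfloor>t\<rfloor> = n)) *\<^sub>R ?g t = ?g t"
        using eventually_ge_at_top[of "nat \<bar>\<lfloor>t\<rfloor>\<bar>"]
      proof eventually_elim
        case (elim j)
        then have "\<lfloor>t\<rfloor> \<in> ?A j" by auto
        then show ?case unfolding sum by simp
      qed
    qed
    then show "AE t in lborel. (\<lambda>j. (\<Sum>n\<in>?A j. of_bool (\<lfloor>t\<rfloor> = n)) *\<^sub>R ?g t) \<longlonglongrightarrow> ?g t"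
      by simp
    show "AE t in lborel. norm ((\<Sum>n\<in>?A j. of_bool (\<lfloor>t\<rfloor> = n)) *\<^sub>R ?g t) \<le> norm (?g t)" for j
      unfolding sum by (intro AE_I2) simp
    show "(\<lambda>t. (\<Sum>n\<in>?A j. of_bool (\<lfloor>t\<rfloor> = n)) *\<^sub>R ?g t) \<in> borel_measurable lborel" for j
      by measurable
  qed measurable
  ultimately show ?thesis using LIMSEQ_unique by simp
qed

text \<open>Both sides are continuous and periodic with the same Fourier coefficients.\<close>

theorem poisson_summation:
  assumes c: "\<And>k. c k = (\<integral>t. f t * echar (- k) t \<partial>lborel)"
    and summable: "(\<lambda>k. cmod (c k)) summable_on UNIV"
  shows "(\<Sum>\<^sub>\<infinity>n. f (x + of_int n)) = (\<Sum>\<^sub>\<infinity>k. c k * echar k x)"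
proof -
  let ?p = "\<lambda>x. \<Sum>\<^sub>\<infinity>n. f (x + of_int n)" and ?q = "\<lambda>x. \<Sum>\<^sub>\<infinity>k. c k * echar k x"
  have q: "continuous_on UNIV ?q"
  proof (rule uniform_limit_theorem)
    show "uniform_limit UNIV (\<lambda>X x. \<Sum>k\<in>X. c k * echar k x) ?q (finite_subsets_at_top UNIV)"
      by (rule Weierstrass_m_test_general[OF _ summable]) (simp add: norm_mult)
  qed (auto intro!: always_eventually continuous_intros)
  have "?p x - ?q x = 0"
  proof (rule fourier_unique)
    show "continuous_on UNIV (\<lambda>x. ?p x - ?q x)"
      by (intro continuous_on_diff continuous_periodization q)
    fix x
    have "?p (x + 1) = (\<Sum>\<^sub>\<infinity>n. f (x + of_int (n + 1)))" by (simp add: algebra_simps)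
    also have "\<dots> = ?p x"
      by (rule infsum_reindex_bij_betw) (rule bij_betwI[of _ _ _ "\<lambda>n. n - 1"], auto)
    finally have "?p (x + 1) = ?p x" .
    moreover have "?q (x + 1) = ?q x" using echar_add_int[of _ x 1] by simp
    ultimately show "?p (x + 1) - ?q (x + 1) = ?p x - ?q x" by simp
  next
    fix k
    have "(\<integral>x. indicator {0..<1} x *\<^sub>R ((?p x - ?q x) * echar k x) \<partial>lborel) =
      (\<integral>x. indicator {0..<1} x *\<^sub>R (?p x * echar k x) - indicator {0..<1} x *\<^sub>R (?q x * echar k x) \<partial>lborel)"
      by (simp only: left_diff_distrib scaleR_diff_right)
    also have "\<dots> = (\<integral>x. indicator {0..<1} x *\<^sub>R (?p x * echar k x) \<partial>lborel) -
       (\<integral>x. indicator {0..<1} x *\<^sub>R (?q x * echar k x) \<partial>lborel)"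
      by (intro Bochner_Integration.integral_diff integrable_indicator_01 continuous_on_mult
          continuous_periodization q continuous_echar)
    also have "\<dots> = c (- k) - c (- k)"
      using fourier_coeff_series[OF summable, of "- k"] unfolding fourier_coeff_periodization c by simp
    finally show "(\<integral>x. indicator {0..<1} x *\<^sub>R ((?p x - ?q x) * echar k x) \<partial>lborel) = 0" by simp
  qed
  then show ?thesis by simp
qed

end

section \<open>The kernels of the levels\<close>

text \<open>The character in \<nu> is split off because Poisson summation treats \<nu> as the
  variable.\<close>

definition kernel_term :: "nat \<Rightarrow> complex \<Rightarrow> complex \<Rightarrow> int \<Rightarrow> complex" where
  "kernel_term r z w k = exp (- of_real pi / 2 * (of_int k)\<^sup>2 + of_real pi * (z - cnj w) * of_int k) *
    complex_of_real (laguerre r 0 (pi * (cmod (z - w - of_int k))\<^sup>2))"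

text \<open>The rate 1/8 makes the Laguerre factor cost at most a quarter of pi * k^2 as
  \<open>k\<close> grows, half of what the Gaussian factor of the kernel provides.\<close>

lemma laguerre_exp_bound:
  obtains D where "D \<ge> 0" "\<And>x. x \<ge> 0 \<Longrightarrow> \<bar>laguerre r 0 x\<bar> \<le> D * exp (x / 8)"
proof -
  define P :: "complex poly" where
    "P = (\<Sum>i\<le>r. monom (of_real ((-1) ^ i * of_nat (r choose i) / fact i)) i)"
  have P: "poly P (of_real x) = of_real (laguerre r 0 x)" for x
    by (simp add: P_def laguerre_0 poly_sum poly_monom)
  obtain D where D: "D \<ge> 0" "\<And>t. cmod (poly P t) \<le> D * exp (1 / 8 * cmod t)"
    by (rule poly_exp_bound[of "1 / 8" P]) auto
  have "\<bar>laguerre r 0 x\<bar> \<le> D * exp (x / 8)" if "x \<ge> 0" for x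
    using D(2)[of "of_real x"] that by (simp add: P)
  then show ?thesis using that D by blast
qed

lemma kernel_term_summable: "(\<lambda>k. cmod (kernel_term r z w k)) summable_on UNIV"
proof -
  obtain D where D: "D \<ge> 0" "\<And>x. x \<ge> 0 \<Longrightarrow> \<bar>laguerre r 0 x\<bar> \<le> D * exp (x / 8)"
    by (rule laguerre_exp_bound[of r]) blast
  \<comment> \<open>The summand 1 becomes the decay exp (- |k|); the term b^2 / pi in
    \<open>a\<close> comes from completing the square against the other quarter of pi * k^2.\<close>
  define b where "b = \<bar>pi * Re (z - cnj w)\<bar> + 1"
  define a where "a = pi * (cmod (z - w))\<^sup>2 / 4 + b\<^sup>2 / pi"
  have "cmod (kernel_term r z w k) \<le> D * exp a * exp (- \<bar>real_of_int k\<bar>)" for k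
  proof -
    let ?k = "\<bar>real_of_int k\<bar>"
    have "(cmod (z - w - of_int k))\<^sup>2 \<le> 2 * (cmod (z - w))\<^sup>2 + 2 * ?k\<^sup>2"
      using norm_add_square_le[of "z - w" "- of_int k"] by (simp add: power2_eq_square)
    then have "pi * (cmod (z - w - of_int k))\<^sup>2 \<le> pi * (2 * (cmod (z - w))\<^sup>2 + 2 * ?k\<^sup>2)"
      by (intro mult_left_mono) auto
    then have 1: "pi * (cmod (z - w - of_int k))\<^sup>2 / 8 \<le> pi * (cmod (z - w))\<^sup>2 / 4 + pi * ?k\<^sup>2 / 4"
      by (simp add: algebra_simps)
    have "pi * Re (z - cnj w) * of_int k \<le> \<bar>pi * Re (z - cnj w) * of_int k\<bar>" by simp
    also have "\<dots> = (b - 1) * ?k" by (simp add: b_def abs_mult)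
    finally have 2: "pi * Re (z - cnj w) * of_int k \<le> b * ?k - ?k" by (simp add: algebra_simps)
    have "0 \<le> (pi * ?k - 2 * b)\<^sup>2 / (4 * pi)" by simp
    also have "\<dots> = pi * ?k\<^sup>2 / 4 - b * ?k + b\<^sup>2 / pi"
      by (simp add: power2_eq_square field_simps)
    finally have 3: "b * ?k \<le> pi * ?k\<^sup>2 / 4 + b\<^sup>2 / pi" by simp
    have "cmod (kernel_term r z w k) = exp (- pi / 2 * ?k\<^sup>2 + pi * Re (z - cnj w) * of_int k) *
        \<bar>laguerre r 0 (pi * (cmod (z - w - of_int k))\<^sup>2)\<bar>"
      unfolding kernel_term_def norm_mult norm_exp_eq_Re by (simp add: Re_power2)
    also have "\<dots> \<le> exp (- pi / 2 * ?k\<^sup>2 + pi * Re (z - cnj w) * of_int k) *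
        (D * exp (pi * (cmod (z - w - of_int k))\<^sup>2 / 8))"
      by (intro mult_left_mono D) auto
    also have "\<dots> = D * exp (- pi / 2 * ?k\<^sup>2 + pi * Re (z - cnj w) * of_int k + pi * (cmod (z - w - of_int k))\<^sup>2 / 8)"
      by (simp add: exp_add)
    also have "\<dots> \<le> D * exp (a - ?k)"
      unfolding a_def using 1 2 3 D(1) by (intro mult_left_mono) auto
    also have "\<dots> = D * exp a * exp (- ?k)" by (simp add: exp_diff exp_minus divide_inverse)
    finally show ?thesis .
  qed
  then show ?thesis
    by (rule summable_on_comparison_test[OF summable_on_cmult_right[OF summable_exp_int]]) auto
qed

lemma pcompose_translate:
  fixes P :: "complex poly"
  shows "pcompose (pcompose P [:a, 1:]) [:b, 1:] = pcompose P [:a + b, 1:]"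
  by (simp add: pcompose_assoc[symmetric] pcompose_pCons)

text \<open>For real frequencies the product of two basis functions is a polynomial times a Gaussian
  with a complex linear exponent. Its Fourier transform at the integers is a value of
  \<open>gauss_int\<close>, and the kernel is its periodization at \<nu>.\<close>

theorem kern_series:
  "cnj (bas.kern \<nu> r z w) = exp (of_real pi * cnj w * z) * (\<Sum>\<^sub>\<infinity>k. kernel_term r z w k * echar k \<nu>)"
proof -
  define A where "A = of_real ((herm_scale r)\<^sup>2) * exp (of_real pi * (z\<^sup>2 + (cnj w)\<^sup>2) / 2)"
  define C where "C = 2 * of_real pi * \<i> * (z - cnj w)"
  define P where "P = pcompose (herm r) [:of_real (Im z), 1:] * pcompose (herm r) [:of_real (Im w), 1:]"
  \<comment> \<open>A function of a real frequency \<open>t\<close>; its values at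
    \<open>\<nu> + of_int n\<close> are the products of basis functions that make up the
    kernel.\<close>
  define f where "f t = A * (poly P (of_real t) * exp (C * of_real t) * of_real (gauss t))" for t :: real
  have f_bas: "f (\<nu> + of_int n) = bas \<nu> r n z * cnj (bas \<nu> r n w)" for n
  proof -
    let ?\<mu> = "\<nu> + of_int n"
    have "exp (of_real pi * (z\<^sup>2 + (cnj w)\<^sup>2) / 2) * (exp (C * of_real ?\<mu>) * of_real (gauss ?\<mu>)) =
        gauss_exp ?\<mu> z * cnj (gauss_exp ?\<mu> w)"
      unfolding gauss_exp_def C_def gauss_def exp_cnj exp_of_real[symmetric] exp_add[symmetric]
      by (rule arg_cong[where f=exp]) (simp add: field_simps)
    note eq = this
    have "f ?\<mu> = of_real ((herm_scale r)\<^sup>2) * poly P (of_real ?\<mu>) * (gauss_exp ?\<mu> z * cnj (gauss_exp ?\<mu> w))"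
      unfolding f_def A_def eq[symmetric] by (simp only: mult_ac)
    then show ?thesis
      unfolding bas_def complex_cnj_mult cnj_poly_herm
      by (simp add: P_def poly_pcompose power2_eq_square mult_ac)
  qed
  obtain C0 where C0: "\<And>t::real. cmod (poly P (of_real t) * exp (C * of_real t) * of_real (gauss t))
    \<le> C0 * exp (- pi * t\<^sup>2)" by (rule poly_exp_gauss_bound[of P C]) blast
  have bound: "cmod (f t) \<le> (cmod A * C0) * exp (- pi * t\<^sup>2)" for t
    unfolding f_def norm_mult[of A] mult.assoc by (intro mult_left_mono C0[unfolded mult.assoc]) auto
  have contf: "continuous_on UNIV f"
    unfolding f_def[abs_def] gauss_def by (intro continuous_intros)
  have coeff: "exp (of_real pi * cnj w * z) * kernel_term r z w k = (\<integral>t. f t * echar (- k) t \<partial>lborel)" for k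
  proof -
    \<comment> \<open>Completing the square shifts the polynomials by \<open>\<alpha>\<close>. With
      d = z - w - k, the total shifts Im z + \<alpha> and Im w + \<alpha> equal \<i> * cnj d / 2 and
      \<i> * d / 2, so four times their product is - |d|^2.\<close>
    define \<zeta> where "\<zeta> = z - cnj w - of_int k"
    define \<alpha> where "\<alpha> = \<i> * \<zeta> / 2"
    have "(\<integral>t. f t * echar (- k) t \<partial>lborel) = (\<integral>t. A * (poly P (of_real t) * exp ((2 * of_real pi * \<i> * \<zeta>) * of_real t) * of_real (gauss t)) \<partial>lborel)"
    proof (rule Bochner_Integration.integral_cong[OF refl])
      fix t :: real
      have "exp (C * of_real t) * echar (- k) t = exp ((2 * of_real pi * \<i> * \<zeta>) * of_real t)"
        unfolding C_def echar_def exp_add[symmetric] \<zeta>_def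
        by (rule arg_cong[where f=exp]) (simp add: algebra_simps)
      note eq = this
      show "f t * echar (- k) t = A * (poly P (of_real t) * exp ((2 * of_real pi * \<i> * \<zeta>) * of_real t) * of_real (gauss t))"
        unfolding f_def eq[symmetric] by (simp only: mult_ac)
    qed
    also have "\<dots> = A * gauss_int (2 * of_real pi * \<i> * \<zeta>) P"
      unfolding gauss_int_def by (rule integral_mult_right_zero)
    also have "\<dots> = A * (exp ((2 * of_real pi * \<i> * \<zeta>)\<^sup>2 / (8 * of_real pi)) * gauss_int 0 (pcompose P [:\<alpha>, 1:]))"
      unfolding gauss_int_shift[of "2 * of_real pi * \<i> * \<zeta>"] by (simp add: \<alpha>_def)
    also have "gauss_int 0 (pcompose P [:\<alpha>, 1:]) = of_real (pi ^ r * fact r / sqrt 2 * laguerre r 0 (pi * (cmod (z - w - of_int k))\<^sup>2))"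
      unfolding P_def pcompose_mult pcompose_translate
      by (rule gauss_int_herm_shifted)
        (simp only: cmod_square_Re_Im, simp add: \<alpha>_def \<zeta>_def complex_eq_iff power2_eq_square field_simps)
    also have "A * (exp ((2 * of_real pi * \<i> * \<zeta>)\<^sup>2 / (8 * of_real pi)) *
        of_real (pi ^ r * fact r / sqrt 2 * laguerre r 0 (pi * (cmod (z - w - of_int k))\<^sup>2)))
      = (exp (of_real pi * (z\<^sup>2 + (cnj w)\<^sup>2) / 2) * exp ((2 * of_real pi * \<i> * \<zeta>)\<^sup>2 / (8 * of_real pi))) *
        of_real (((herm_scale r)\<^sup>2 * (pi ^ r * fact r / sqrt 2)) * laguerre r 0 (pi * (cmod (z - w - of_int k))\<^sup>2))"
      unfolding A_def by (simp only: of_real_mult mult_ac)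
    also have "exp (of_real pi * (z\<^sup>2 + (cnj w)\<^sup>2) / 2) * exp ((2 * of_real pi * \<i> * \<zeta>)\<^sup>2 / (8 * of_real pi)) =
       exp (of_real pi * cnj w * z) * exp (- of_real pi / 2 * (of_int k)\<^sup>2 + of_real pi * (z - cnj w) * of_int k)"
      unfolding exp_add[symmetric] \<zeta>_def
      by (rule arg_cong[where f=exp]) (simp add: power_mult_distrib power2_eq_square field_simps)
    finally show ?thesis unfolding herm_scale_square by (simp add: kernel_term_def mult.assoc)
  qed
  have "cnj (bas.kern \<nu> r z w) = (\<Sum>\<^sub>\<infinity>n. bas \<nu> r n z * cnj (bas \<nu> r n w))"
    unfolding bas.kern_def bas.ssum_def infsum_cnj[symmetric] by simp
  also have "\<dots> = (\<Sum>\<^sub>\<infinity>n. f (\<nu> + of_int n))" unfolding f_bas ..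
  also have "\<dots> = (\<Sum>\<^sub>\<infinity>k. exp (of_real pi * cnj w * z) * kernel_term r z w k * echar k \<nu>)"
  proof (rule poisson_summation[OF contf bound coeff])
    show "(\<lambda>k. cmod (exp (of_real pi * cnj w * z) * kernel_term r z w k)) summable_on UNIV"
      unfolding norm_mult by (rule summable_on_cmult_right[OF kernel_term_summable])
  qed
  also have "\<dots> = exp (of_real pi * cnj w * z) * (\<Sum>\<^sub>\<infinity>k. kernel_term r z w k * echar k \<nu>)"
    unfolding mult.assoc by (rule infsum_cmult_right')
  finally show ?thesis .
qed

section \<open>Reproducing kernels and orthogonal decompositions\<close>

lemma ssum_if_true_poly_fock:
  assumes "F \<in> true_poly_fock \<nu> r"
  obtains c where "ell2 c" "F = bas.ssum \<nu> r c"
  using assms unfolding true_poly_fock_iff by blast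

lemma true_poly_fock_L2_qp: "true_poly_fock \<nu> r \<subseteq> L2_qp \<nu>"
  by (auto simp: true_poly_fock_iff ssum_L2_qp)

lemma proj_true_poly_fock: "sq_int MS F \<Longrightarrow> bas.proj \<nu> r F \<in> true_poly_fock \<nu> r"
  unfolding true_poly_fock_iff bas.proj_def using bas.ell2_coeffs by blast

lemma kern_true_poly_fock: "bas.kern \<nu> r z \<in> true_poly_fock \<nu> r"
  unfolding true_poly_fock_iff bas.kern_def using bas.ell2_kern[of z] by auto

lemma proj_eq_if_true_poly_fock: "F \<in> true_poly_fock \<nu> r \<Longrightarrow> bas.proj \<nu> r F = F"
  unfolding true_poly_fock_iff by (auto simp: bas.proj_ssum)

lemma ip_true_poly_fock:
  "r \<noteq> s \<Longrightarrow> F \<in> true_poly_fock \<nu> r \<Longrightarrow> G \<in> true_poly_fock \<nu> s \<Longrightarrow> ip MS F G = 0"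
  unfolding true_poly_fock_iff by (auto intro: ip_ssum_ssum)

lemma bas_true_poly_fock: "bas \<nu> r n \<in> true_poly_fock \<nu> r"
proof -
  have "bas.ssum \<nu> r (\<lambda>k. if k = n then 1 else 0) z = bas \<nu> r n z" for z
  proof -
    have "bas.ssum \<nu> r (\<lambda>k. if k = n then 1 else 0) z = (\<Sum>\<^sub>\<infinity>k\<in>{n}. bas \<nu> r k z)"
      unfolding bas.ssum_def by (rule infsum_cong_neutral) auto
    then show ?thesis by simp
  qed
  then have "bas \<nu> r n = bas.ssum \<nu> r (\<lambda>k. if k = n then 1 else 0)" by (simp add: fun_eq_iff)
  then show ?thesis unfolding true_poly_fock_iff using ell2_finite[of n 1] by blast
qed

lemma sq_int_true_poly_fock: "F \<in> true_poly_fock \<nu> r \<Longrightarrow> sq_int MS F"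
  using true_poly_fock_L2_qp L2_qp_iff by blast

lemma sum_levels_poly_fock:
  assumes "\<And>r. r < N \<Longrightarrow> f r \<in> true_poly_fock \<nu> r"
  shows "(\<lambda>z. \<Sum>r<N. f r z) \<in> poly_fock \<nu> N"
proof (rule polyanalytic_poly_fock)
  have pa: "polyanalytic N (f r)" if "r < N" for r
    using ssum_if_true_poly_fock[OF assms[OF that]] polyanalytic_ssum polyanalytic_mono that
    by (metis Suc_leI)
  have zero: "polyanalytic N (\<lambda>z. 0)"
    unfolding polyanalytic_def by (intro exI[of _ "\<lambda>_ _. 0"]) auto
  have "polyanalytic N (\<lambda>z. \<Sum>r<m. f r z)" if "m \<le> N" for m
    using that
  proof (induction m)
    case (Suc m)
    then show ?case using polyanalytic_add[OF Suc.IH pa[of m]] by simp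
  qed (simp add: zero)
  then show "polyanalytic N (\<lambda>z. \<Sum>r<N. f r z)" by simp
  have "sq_int MS (f r) \<and> quasi_periodic \<nu> (f r)" if "r < N" for r
    using assms[OF that] true_poly_fock_L2_qp unfolding L2_qp_iff[symmetric] by blast
  then show "(\<lambda>z. \<Sum>r<N. f r z) \<in> L2_qp \<nu>"
    unfolding L2_qp_iff by (intro conjI sq_int_sum quasi_periodic_sum) auto
qed

text \<open>Orthogonality lets the projection recover each component, which yields uniqueness in
  both decompositions.\<close>

lemma proj_sum_levels:
  assumes f: "\<And>s. s < N \<Longrightarrow> f s \<in> true_poly_fock \<nu> s" and r: "r < N"
  shows "bas.proj \<nu> r (\<lambda>z. \<Sum>s<N. f s z) = f r"
proof -
  have "ip MS (\<lambda>z. \<Sum>s<N. f s z) (bas \<nu> r n) = ip MS (f r) (bas \<nu> r n)" for n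
  proof -
    have "ip MS (\<lambda>z. \<Sum>s<N. f s z) (bas \<nu> r n) = (\<Sum>s<N. ip MS (f s) (bas \<nu> r n))"
      by (rule ip_sum_left) (auto intro: sq_int_true_poly_fock f sq_int_bas)
    also have "\<dots> = (\<Sum>s<N. if r = s then ip MS (f s) (bas \<nu> r n) else 0)"
    proof (rule sum.cong[OF refl])
      fix s assume "s \<in> {..<N}"
      then show "ip MS (f s) (bas \<nu> r n) = (if r = s then ip MS (f s) (bas \<nu> r n) else 0)"
        using ip_true_poly_fock[OF _ f bas_true_poly_fock, of s r n] by auto
    qed
    finally show ?thesis using r by simp
  qed
  then have "bas.proj \<nu> r (\<lambda>z. \<Sum>s<N. f s z) = bas.proj \<nu> r (f r)"
    by (simp add: bas.proj_def)
  then show ?thesis using proj_eq_if_true_poly_fock[OF f[OF r]] by simp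
qed

section \<open>Kernels of subspaces and their uniqueness\<close>

lemma is_reproducing_kernel_iff:
  assumes "H \<subseteq> L2_qp \<nu>"
  shows "is_reproducing_kernel H K \<longleftrightarrow> (\<forall>z. (\<lambda>w. cnj (K z w)) \<in> H) \<and>
    (\<forall>F\<in>H. \<forall>z. F z = ip MS F (\<lambda>w. cnj (K z w)))"
proof -
  have meas: "F \<in> borel_measurable lebesgue" if "F \<in> H" for F
    using that assms by (auto simp: L2_qp_def)
  have ip: "ip MS F (\<lambda>w. cnj (K z w)) =
      (LINT w:strip|lebesgue. F w * K z w * of_real (exp (- pi * (cmod w)\<^sup>2)))"
    if "F \<in> H" "(\<lambda>w. cnj (K z w)) \<in> H" for F z
    unfolding ip_MS[OF that[THEN meas]] complex_cnj_cnj ..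
  show ?thesis
    unfolding is_reproducing_kernel_def
  proof (rule conj_cong[OF refl])
    assume mem: "\<forall>z. (\<lambda>w. cnj (K z w)) \<in> H"
    show "(\<forall>F\<in>H. \<forall>z. F z = (LINT w:strip|lebesgue. F w * K z w * of_real (exp (- pi * (cmod w)\<^sup>2)))) \<longleftrightarrow>
        (\<forall>F\<in>H. \<forall>z. F z = ip MS F (\<lambda>w. cnj (K z w)))"
      by (intro ball_cong refl all_cong1) (subst ip[OF _ spec[OF mem]], assumption, rule refl)
  qed
qed

lemma is_reproducing_kernelD:
  assumes "H \<subseteq> L2_qp \<nu>" "is_reproducing_kernel H K"
  shows "(\<lambda>w. cnj (K z w)) \<in> H" "F \<in> H \<Longrightarrow> F z = ip MS F (\<lambda>w. cnj (K z w))"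
proof -
  note K = assms(2)[unfolded is_reproducing_kernel_iff[OF assms(1)]]
  show "(\<lambda>w. cnj (K z w)) \<in> H" by (rule spec[OF conjunct1[OF K]])
  assume "F \<in> H"
  then show "F z = ip MS F (\<lambda>w. cnj (K z w))" by (rule spec[OF bspec[OF conjunct2[OF K]]])
qed

text \<open>Testing each kernel against the other gives \<open>cnj (K2 z' z) = K1 z z'\<close>. For
  equal kernels this is Hermitian symmetry, and the mixed case then identifies the two.\<close>

lemma reproducing_kernel_unique:
  assumes "H \<subseteq> L2_qp \<nu>" "is_reproducing_kernel H K" "is_reproducing_kernel H K'"
  shows "K = K'"
proof -
  have sym: "cnj (K2 z' z) = K1 z z'" if "is_reproducing_kernel H K1" "is_reproducing_kernel H K2" for K1 K2 z z'
  proof -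
    note K1 = is_reproducing_kernelD[OF assms(1) that(1)]
      and K2 = is_reproducing_kernelD[OF assms(1) that(2)]
    have "cnj (K2 z' z) = ip MS (\<lambda>w. cnj (K2 z' w)) (\<lambda>w. cnj (K1 z w))"
      by (rule K1(2)[OF K2(1)])
    also have "\<dots> = cnj (ip MS (\<lambda>w. cnj (K1 z w)) (\<lambda>w. cnj (K2 z' w)))"
      by (rule ip_commute)
    also have "ip MS (\<lambda>w. cnj (K1 z w)) (\<lambda>w. cnj (K2 z' w)) = cnj (K1 z z')"
      by (rule K2(2)[OF K1(1), symmetric])
    finally show ?thesis by simp
  qed
  show ?thesis
    using sym[OF assms(2,2)] sym[OF assms(3,2)] by (simp add: fun_eq_iff)
qed

lemma reproducing_kernel_eq:
  assumes "H \<subseteq> L2_qp \<nu>" "is_reproducing_kernel H K"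
  shows "reproducing_kernel H = K" "\<exists>!K. is_reproducing_kernel H K"
  using assms reproducing_kernel_unique[OF assms(1)]
  unfolding reproducing_kernel_def by (blast intro: the_equality)+

lemma reproducing_kernel_level:
  "is_reproducing_kernel (true_poly_fock \<nu> r) (\<lambda>z w. cnj (bas.kern \<nu> r z w))"
  unfolding is_reproducing_kernel_iff[OF true_poly_fock_L2_qp] complex_cnj_cnj
proof (intro conjI allI ballI)
  show "(\<lambda>w. bas.kern \<nu> r z w) \<in> true_poly_fock \<nu> r" for z by (rule kern_true_poly_fock)
  fix F z assume F: "F \<in> true_poly_fock \<nu> r"
  then show "F z = ip MS F (\<lambda>w. bas.kern \<nu> r z w)"
    using bas.ip_kern[OF sq_int_true_poly_fock[OF F], of z \<nu> r] proj_eq_if_true_poly_fock[OF F] by simp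
qed

lemma poly_fock_L2_qp: "poly_fock \<nu> N \<subseteq> L2_qp \<nu>"
  by (auto simp: poly_fock_def)

text \<open>Each level kernel evaluates the projection onto its level, and the first
  \<open>N\<close> projections of \<open>F\<close> add up to \<open>F\<close>.\<close>

lemma reproducing_kernel_poly:
  "is_reproducing_kernel (poly_fock \<nu> N) (\<lambda>z w. \<Sum>r<N. cnj (bas.kern \<nu> r z w))"
  unfolding is_reproducing_kernel_iff[OF poly_fock_L2_qp] cnj_sum complex_cnj_cnj
proof (intro conjI allI ballI)
  show "(\<lambda>w. \<Sum>r<N. bas.kern \<nu> r z w) \<in> poly_fock \<nu> N" for z
    by (intro sum_levels_poly_fock kern_true_poly_fock)
  fix F z assume F: "F \<in> poly_fock \<nu> N"
  then have sq: "sq_int MS F" using poly_fock_L2_qp L2_qp_iff by blast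
  have "ip MS F (\<lambda>w. \<Sum>r<N. bas.kern \<nu> r z w) = (\<Sum>r<N. ip MS F (bas.kern \<nu> r z))"
    by (rule ip_sum_right) (auto intro: sq sq_int_true_poly_fock kern_true_poly_fock)
  then show "F z = ip MS F (\<lambda>w. \<Sum>r<N. bas.kern \<nu> r z w)"
    using poly_fock_levels[OF F, of z] by (simp add: levels_def bas.ip_kern sq)
qed

text \<open>The projection is a best approximation, so it is at distance zero from any
  \<open>F\<close> that the level approaches. The ambient \<open>H\<close> is left open to serve
  both decompositions.\<close>

lemma closed_subspace_level:
  assumes H: "H \<subseteq> L2_qp \<nu>" and V: "true_poly_fock \<nu> r \<subseteq> H"
  shows "closed_subspace H (true_poly_fock \<nu> r)"
  unfolding closed_subspace_def
proof (intro conjI ballI allI impI V)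
  show "(\<lambda>z. 0) \<in> true_poly_fock \<nu> r"
    using proj_true_poly_fock[of "\<lambda>z. 0" \<nu> r] by (simp add: bas.proj_def bas.ssum_def[abs_def])
next
  fix F G assume "F \<in> true_poly_fock \<nu> r" "G \<in> true_poly_fock \<nu> r"
  then show "(\<lambda>z. F z + G z) \<in> true_poly_fock \<nu> r"
    using ell2_add by (fastforce simp: true_poly_fock_iff bas.ssum_add)
next
  fix a F assume "F \<in> true_poly_fock \<nu> r"
  then obtain c where c: "ell2 c" "F = bas.ssum \<nu> r c" by (rule ssum_if_true_poly_fock)
  have "(\<lambda>z. a * F z) = bas.ssum \<nu> r (\<lambda>n. a * c n)" by (simp add: c bas.ssum_scale fun_eq_iff)
  then show "(\<lambda>z. a * F z) \<in> true_poly_fock \<nu> r"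
    unfolding true_poly_fock_iff using ell2_scale[OF c(1)] by blast
next
  fix F assume F: "F \<in> H" and approx: "\<forall>e>0. \<exists>G\<in>true_poly_fock \<nu> r. wnorm (\<lambda>z. F z - G z) < e"
  have sF: "sq_int MS F" using F H L2_qp_iff by blast
  have wnorm: "wnorm (\<lambda>z. F z - G z) = nrm MS (\<lambda>z. F z - G z)" if "sq_int MS G" for G
    using sq_intD(1)[OF sq_int_diff[OF sF that]] by (intro wnorm_eq_nrm) (simp add: borel_measurable_MS)
  let ?P = "bas.proj \<nu> r F"
  have sP: "sq_int MS ?P" by (rule bas.sq_int_proj[OF sF])
  have "nrm MS (\<lambda>z. F z - ?P z) \<le> nrm MS (\<lambda>z. F z - G z)" if G: "G \<in> true_poly_fock \<nu> r" for G
  proof -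
    obtain c where c: "ell2 c" "G = bas.ssum \<nu> r c" using G by (rule ssum_if_true_poly_fock)
    have sG: "sq_int MS G" by (rule sq_int_true_poly_fock[OF G])
    have res: "sq_int MS (\<lambda>z. F z - ?P z)" by (intro sq_int_diff sF sP)
    have "ip MS ?P (\<lambda>z. F z - ?P z) = 0"
      by (subst (1) bas.proj_def) (rule bas.ip_proj_orthogonal[OF sF bas.ell2_coeffs[OF sF]])
    moreover have "ip MS G (\<lambda>z. F z - ?P z) = 0"
      unfolding c(2) by (rule bas.ip_proj_orthogonal[OF sF c(1)])
    ultimately have "ip MS (\<lambda>z. ?P z - G z) (\<lambda>z. F z - ?P z) = 0"
      by (simp add: ip_diff_left[OF sP sG res])
    from pythagoras[OF sq_int_diff[OF sP sG] res this]
    have "(nrm MS (\<lambda>z. F z - ?P z))\<^sup>2 \<le> (nrm MS (\<lambda>z. F z - G z))\<^sup>2" by simp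
    then show ?thesis by (rule power2_le_imp_le) simp
  qed
  then have "nrm MS (\<lambda>z. F z - ?P z) < e" if "e > 0" for e
    using approx[rule_format, OF that] wnorm sq_int_true_poly_fock by fastforce
  then have "nrm MS (\<lambda>z. F z - ?P z) = 0"
    using nrm_nonneg[of MS "\<lambda>z. F z - ?P z"] by (metis less_irrefl order_less_le)
  then have "wnorm (\<lambda>z. F z - ?P z) = 0" using wnorm[OF sP] by simp
  then show "\<exists>G\<in>true_poly_fock \<nu> r. wnorm (\<lambda>z. F z - G z) = 0"
    using proj_true_poly_fock[OF sF] by blast
qed

lemma orthogonal_levels: "orthogonal_family I (true_poly_fock \<nu>)"
proof -
  have "F \<in> borel_measurable lebesgue" if "F \<in> true_poly_fock \<nu> r" for F r
    using that true_poly_fock_L2_qp by (auto simp: L2_qp_def)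
  then show ?thesis
    unfolding orthogonal_family_def pairwise_def by (metis ip_true_poly_fock winner_eq_ip)
qed

lemma true_poly_fock_subset_poly_fock:
  assumes "r < N"
  shows "true_poly_fock \<nu> r \<subseteq> poly_fock \<nu> N"
proof
  fix F assume F: "F \<in> true_poly_fock \<nu> r"
  then obtain c where "ell2 c" "F = bas.ssum \<nu> r c" by (rule ssum_if_true_poly_fock)
  then have "polyanalytic N F"
    using polyanalytic_mono[OF polyanalytic_ssum] assms by simp
  then show "F \<in> poly_fock \<nu> N"
    using F true_poly_fock_L2_qp by (blast intro: polyanalytic_poly_fock)
qed

theorem poly_fock_decomposition:
  "finite_orthogonal_sum (poly_fock \<nu> N) {..<N} (true_poly_fock \<nu>)"
  unfolding finite_orthogonal_sum_def
proof (intro conjI ballI orthogonal_levels)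
  show "closed_subspace (poly_fock \<nu> N) (true_poly_fock \<nu> r)" if "r \<in> {..<N}" for r
    using that by (intro closed_subspace_level[OF poly_fock_L2_qp] true_poly_fock_subset_poly_fock) simp
  show "bij_betw (\<lambda>f z. \<Sum>r<N. f r z) (Pi\<^sub>E {..<N} (true_poly_fock \<nu>)) (poly_fock \<nu> N)"
    unfolding bij_betw_def
  proof
    show "inj_on (\<lambda>f z. \<Sum>r<N. f r z) (Pi\<^sub>E {..<N} (true_poly_fock \<nu>))"
    proof (rule inj_onI)
      fix f g
      assume f: "f \<in> Pi\<^sub>E {..<N} (true_poly_fock \<nu>)" and g: "g \<in> Pi\<^sub>E {..<N} (true_poly_fock \<nu>)"
        and eq: "(\<lambda>z. \<Sum>r<N. f r z) = (\<lambda>z. \<Sum>r<N. g r z)"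
      show "f = g"
      proof (rule PiE_ext[OF f g])
        fix r assume r: "r \<in> {..<N}"
        have "f r = bas.proj \<nu> r (\<lambda>z. \<Sum>s<N. f s z)"
          using f r by (intro proj_sum_levels[symmetric]) auto
        also have "\<dots> = g r" unfolding eq using g r by (intro proj_sum_levels) auto
        finally show "f r = g r" .
      qed
    qed
    show "(\<lambda>f z. \<Sum>r<N. f r z) ` Pi\<^sub>E {..<N} (true_poly_fock \<nu>) = poly_fock \<nu> N"
    proof (intro subset_antisym subsetI)
      fix F assume "F \<in> (\<lambda>f z. \<Sum>r<N. f r z) ` Pi\<^sub>E {..<N} (true_poly_fock \<nu>)"
      then obtain f where f: "f \<in> Pi\<^sub>E {..<N} (true_poly_fock \<nu>)" and F: "F = (\<lambda>z. \<Sum>r<N. f r z)" by blast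
      show "F \<in> poly_fock \<nu> N" unfolding F by (rule sum_levels_poly_fock) (use f in auto)
    next
      fix F assume F: "F \<in> poly_fock \<nu> N"
      then have sq: "sq_int MS F" using poly_fock_L2_qp L2_qp_iff by blast
      let ?f = "restrict (\<lambda>r. bas.proj \<nu> r F) {..<N}"
      have "?f \<in> Pi\<^sub>E {..<N} (true_poly_fock \<nu>)"
        by (auto intro: proj_true_poly_fock sq)
      moreover have "F = (\<lambda>z. \<Sum>r<N. ?f r z)"
        using poly_fock_levels[OF F] by (simp add: levels_def fun_eq_iff)
      ultimately show "F \<in> (\<lambda>f z. \<Sum>r<N. f r z) ` Pi\<^sub>E {..<N} (true_poly_fock \<nu>)" by blast
    qed
  qed
qed simp

theorem L2_qp_decomposition: "hilbert_orthogonal_sum (L2_qp \<nu>) (true_poly_fock \<nu>)"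
  unfolding hilbert_orthogonal_sum_def
proof (intro conjI allI ballI orthogonal_levels)
  show "closed_subspace (L2_qp \<nu>) (true_poly_fock \<nu> r)" for r
    by (rule closed_subspace_level[OF order_refl true_poly_fock_L2_qp])
  fix F assume F: "F \<in> L2_qp \<nu>"
  then have sF: "sq_int MS F" by (simp add: L2_qp_iff)
  have wnorm: "wnorm (\<lambda>z. F z - G z) = nrm MS (\<lambda>z. F z - G z)" if "sq_int MS G" for G
    using sq_intD(1)[OF sq_int_diff[OF sF that]] by (intro wnorm_eq_nrm) (simp add: borel_measurable_MS)
  show "\<exists>!f. (\<forall>r. f r \<in> true_poly_fock \<nu> r) \<and> (\<lambda>n. wnorm (\<lambda>z. F z - (\<Sum>r<n. f r z))) \<longlonglongrightarrow> 0"
  proof (rule ex1I[of _ "\<lambda>r. bas.proj \<nu> r F"])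
    have "wnorm (\<lambda>z. F z - (\<Sum>r<n. bas.proj \<nu> r F z)) = nrm MS (\<lambda>z. F z - levels \<nu> n F z)" for n
      using wnorm[OF sq_int_levels[OF sF, of \<nu> n]] by (simp add: levels_def)
    then show "(\<forall>r. bas.proj \<nu> r F \<in> true_poly_fock \<nu> r) \<and>
        (\<lambda>n. wnorm (\<lambda>z. F z - (\<Sum>r<n. bas.proj \<nu> r F z))) \<longlonglongrightarrow> 0"
      using resolved_if_sq_int[OF sF, of \<nu>] proj_true_poly_fock[OF sF] by (simp add: resolved_def)
  next
    fix f assume f: "(\<forall>r. f r \<in> true_poly_fock \<nu> r) \<and> (\<lambda>n. wnorm (\<lambda>z. F z - (\<Sum>r<n. f r z))) \<longlonglongrightarrow> 0"
    have sf: "sq_int MS (f r)" for r using f sq_int_true_poly_fock by blast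
    have sS: "sq_int MS (\<lambda>z. \<Sum>r<n. f r z)" for n by (intro sq_int_sum sf)
    have lim: "(\<lambda>n. nrm MS (\<lambda>z. F z - (\<Sum>r<n. f r z))) \<longlonglongrightarrow> 0"
      using f by (simp add: wnorm[OF sS])
    \<comment> \<open>Uniqueness: by Cauchy-Schwarz the coefficients of \<open>F\<close> are limits
      of those of the partial sums, and the latter are constant for \<open>n > r\<close>.\<close>
    have "ip MS F (bas \<nu> r k) = ip MS (f r) (bas \<nu> r k)" for r k
    proof -
      have bound: "cmod (ip MS F (bas \<nu> r k) - ip MS (f r) (bas \<nu> r k)) \<le>
          nrm MS (\<lambda>z. F z - (\<Sum>s<n. f s z)) * nrm MS (bas \<nu> r k)" if n: "n > r" for n
      proof -
        have "bas.proj \<nu> r (\<lambda>z. \<Sum>s<n. f s z) = f r"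
          using f by (intro proj_sum_levels n) auto
        then have "ip MS (\<lambda>z. \<Sum>s<n. f s z) (bas \<nu> r k) = ip MS (f r) (bas \<nu> r k)"
          using bas.ip_proj_e[OF sS[of n], of \<nu> r k] by simp
        then have "ip MS (\<lambda>z. F z - (\<Sum>s<n. f s z)) (bas \<nu> r k) = ip MS F (bas \<nu> r k) - ip MS (f r) (bas \<nu> r k)"
          by (simp add: ip_diff_left[OF sF sS sq_int_bas])
        then show ?thesis
          using Cauchy_Schwarz_ip[OF sq_int_diff[OF sF sS[of n]] sq_int_bas[of \<nu> r k]] by simp
      qed
      have "(\<lambda>n. nrm MS (\<lambda>z. F z - (\<Sum>s<n. f s z)) * nrm MS (bas \<nu> r k)) \<longlonglongrightarrow> 0"
        by (rule tendsto_mult_left_zero[OF lim])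
      then have "cmod (ip MS F (bas \<nu> r k) - ip MS (f r) (bas \<nu> r k)) \<le> 0"
        by (rule LIMSEQ_le_const) (use bound in \<open>auto intro!: exI[of _ "Suc r"]\<close>)
      then show ?thesis by simp
    qed
    then have "bas.proj \<nu> r F = bas.proj \<nu> r (f r)" for r by (simp add: bas.proj_def)
    moreover have "bas.proj \<nu> r (f r) = f r" for r using f by (simp add: proj_eq_if_true_poly_fock)
    ultimately show "f = (\<lambda>r. bas.proj \<nu> r F)" by auto
  qed
qed

lemma has_sum_finite_sum:
  fixes f :: "'i \<Rightarrow> 'a \<Rightarrow> complex"
  assumes "\<And>i. i \<in> I \<Longrightarrow> (f i has_sum s i) A"
  shows "((\<lambda>x. \<Sum>i\<in>I. f i x) has_sum (\<Sum>i\<in>I. s i)) A"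
  using assms by (induction I rule: infinite_finite_induct) (auto intro: has_sum_add)

theorem theorem4:
  fixes \<nu> :: real and N :: nat
  assumes "N \<ge> 1"
  shows "(\<exists>!K. is_reproducing_kernel (poly_fock \<nu> N) K) \<and>
    (\<forall>r<N. \<exists>!K. is_reproducing_kernel (true_poly_fock \<nu> r) K) \<and>
    (\<forall>z w.
      (\<lambda>k::int. exp (2 * of_real pi * \<i> * of_int k * of_real \<nu>) *
          exp (- of_real pi / 2 * (of_int k)\<^sup>2 + of_real pi * (z - cnj w) * of_int k) *
          complex_of_real (laguerre (N - 1) 1 (pi * (cmod (z - w - of_int k))\<^sup>2)))
        summable_on UNIV \<and>
      reproducing_kernel (poly_fock \<nu> N) z w =
        exp (of_real pi * cnj w * z) *
        (\<Sum>\<^sub>\<infinity>k::int. exp (2 * of_real pi * \<i> * of_int k * of_real \<nu>) *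
          exp (- of_real pi / 2 * (of_int k)\<^sup>2 + of_real pi * (z - cnj w) * of_int k) *
          complex_of_real (laguerre (N - 1) 1 (pi * (cmod (z - w - of_int k))\<^sup>2))) \<and>
      reproducing_kernel (poly_fock \<nu> N) z w =
        (\<Sum>r<N. reproducing_kernel (true_poly_fock \<nu> r) z w)) \<and>
    finite_orthogonal_sum (poly_fock \<nu> N) {..<N} (true_poly_fock \<nu>) \<and>
    hilbert_orthogonal_sum (L2_qp \<nu>) (true_poly_fock \<nu>)"
proof (intro conjI allI impI poly_fock_decomposition L2_qp_decomposition)
  note poly = reproducing_kernel_eq[OF poly_fock_L2_qp reproducing_kernel_poly, of \<nu> N]
  note level = reproducing_kernel_eq[OF true_poly_fock_L2_qp reproducing_kernel_level, of \<nu>]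
  show "\<exists>!K. is_reproducing_kernel (poly_fock \<nu> N) K" by (rule poly(2))
  show "\<exists>!K. is_reproducing_kernel (true_poly_fock \<nu> r) K" for r by (rule level(2))
  fix z w
  let ?term = "\<lambda>k::int. exp (2 * of_real pi * \<i> * of_int k * of_real \<nu>) *
          exp (- of_real pi / 2 * (of_int k)\<^sup>2 + of_real pi * (z - cnj w) * of_int k) *
          complex_of_real (laguerre (N - 1) 1 (pi * (cmod (z - w - of_int k))\<^sup>2))"
  show "reproducing_kernel (poly_fock \<nu> N) z w = (\<Sum>r<N. reproducing_kernel (true_poly_fock \<nu> r) z w)"
    unfolding poly(1) level(1) ..
  have summ: "(\<lambda>k. kernel_term r z w k * echar k \<nu>) summable_on UNIV" for r
    by (rule abs_summable_summable) (simp add: norm_mult kernel_term_summable)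
  have term_eq: "?term k = (\<Sum>r<N. kernel_term r z w k * echar k \<nu>)" for k
  proof -
    \<comment> \<open>Here \<open>N \<ge> 1\<close> makes \<open>Suc (N - 1)\<close> equal to
      \<open>N\<close>.\<close>
    have "laguerre (N - 1) 1 (pi * (cmod (z - w - of_int k))\<^sup>2)
        = (\<Sum>r<N. laguerre r 0 (pi * (cmod (z - w - of_int k))\<^sup>2))"
      using sum_laguerre_0[of _ "N - 1"] assms by simp
    then show ?thesis
      by (simp only: of_real_sum kernel_term_def echar_def sum_distrib_left) (simp only: mult_ac)
  qed
  have has_sum: "((\<lambda>k. \<Sum>r<N. kernel_term r z w k * echar k \<nu>) has_sum (\<Sum>r<N. \<Sum>\<^sub>\<infinity>k. kernel_term r z w k * echar k \<nu>)) UNIV"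
    by (intro has_sum_finite_sum has_sum_infsum summ)
  show "?term summable_on UNIV"
    unfolding term_eq using has_sum by (rule has_sum_imp_summable)
  have "reproducing_kernel (poly_fock \<nu> N) z w =
      (\<Sum>r<N. exp (of_real pi * cnj w * z) * (\<Sum>\<^sub>\<infinity>k. kernel_term r z w k * echar k \<nu>))"
    unfolding poly(1) kern_series ..
  also have "\<dots> = exp (of_real pi * cnj w * z) * (\<Sum>\<^sub>\<infinity>k. \<Sum>r<N. kernel_term r z w k * echar k \<nu>)"
    by (simp add: sum_distrib_left[symmetric] infsumI[OF has_sum])
  finally show "reproducing_kernel (poly_fock \<nu> N) z w = exp (of_real pi * cnj w * z) * (\<Sum>\<^sub>\<infinity>k. ?term k)"
    unfolding term_eq .
qed

end
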